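(* Let $n\ge 3$, $0<m<\frac{n-2}{n}$, $\lambda_1>\lambda_2>0$, $0<\mu<n-2$, $\beta<0$, $\alpha=\frac{2\beta-1}{1-m}$, and let $\gamma=\alpha/\beta$ satisfy $\frac{2}{1-m}<\gamma<\frac{n-2}{m}$. Let $u,v$ be solutions of $$u_t=\Delta(u^m/m)\quad\text{in }(\mathbb{R}^n\setminus\{0\})\times(0,\infty)$$ with initial values $u_0,v_0$ respectively, which satisfy $$V_{\lambda_1}\le u,v\le V_{\lambda_2}\quad\text{in }(\mathbb{R}^n\setminus\{0\})\times(0,\infty).$$ Suppose that $|u_0-v_0|\in L^1(\varphi_\mu;\mathbb{R}^n\setminus\{0\})$ for some weight function $\varphi_\mu$ of the form described in the context. Then $$\int_{\mathbb{R}^n}|u-v|(x,t)\,\varphi_\mu(x)\,dx\le\int_{\mathbb{R}^n}|u_0-v_0|(x)\,\varphi_\mu(x)\,dx\qquad\forall t>0$$ and $$\int_{\mathbb{R}^n}(u-v)_+(x,t)\,\varphi_\mu(x)\,dx\le\int_{\mathbb{R}^n}(u_0-v_0)_+(x)\,\varphi_\mu(x)\,dx\qquad\forall t>0.$$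
   Context: Solutions: for $0\le u_0\in L^1_{loc}(\mathbb{R}^n\setminus\{0\})$, $u$ is a solution of $u_t=\Delta(u^m/m)$ in $(\mathbb{R}^n\setminus\{0\})\times(0,\infty)$ with initial value $u_0$ if $u>0$ satisfies the equation in the classical sense in $(\mathbb{R}^n\setminus\{0\})\times(0,\infty)$ and $\|u(\cdot,t)-u_0\|_{L^1(K)}\to0$ as $t\to0$ for every compact $K\subset\mathbb{R}^n\setminus\{0\}$. Self-similar solutions: for $\lambda>0$, $f_\lambda$ denotes the unique (existence and uniqueness are known) radially symmetric solution of $\Delta(f^m/m)+\alpha f+\beta x\cdot\nabla f=0$, $f>0$, in $\mathbb{R}^n\setminus\{0\}$ with $\lim_{|x|\to0}|x|^{\alpha/\beta}f(x)=\lambda^{\frac{1}{(1-m)\beta}}$, and $V_\lambda(x,t)=t^{-\alpha}f_\lambda(t^{-\beta}x)$ for $x\in\mathbb{R}^n\setminus\{0\}$, $t>0$. Weight: for $0<\mu<n-2$, let $\eta_1$ be a smooth non-negative radially symmetric function on $\mathbb{R}^n$ with $\eta_1(r)=0$ for $0\le r=|x|\le1$ and $\eta_1(r)=\mu(n-2-\mu)r^{-\mu-2}$ for $r\ge2$. Then $$\varphi_\mu(x)=1-a_4\int_0^{|x|}\frac{1}{s^{n-1}}\left(\int_0^s\rho^{n-1}\eta_1(\rho)\,d\rho\right)ds,\qquad a_4=\left(\int_0^\infty\frac{1}{s^{n-1}}\left(\int_0^s\rho^{n-1}\eta_1(\rho)\,d\rho\right)ds\right)^{-1}\in(0,\infty).$$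 $L^1(\varphi_\mu;\mathbb{R}^n\setminus\{0\})$ is the set of $v\in L^1_{loc}(\mathbb{R}^n\setminus\{0\})$ with $\int_{\mathbb{R}^n\setminus\{0\}}|v|\varphi_\mu\,dx<\infty$. *)

theory Defs
  imports "HOL-Analysis.Analysis"
begin

definition partial_deriv :: "'n \<Rightarrow> (real ^ 'n \<Rightarrow> real) \<Rightarrow> real ^ 'n::finite \<Rightarrow> real" where
  "partial_deriv i f x = deriv (\<lambda>h. f (x + h *\<^sub>R axis i 1)) 0"

definition gradient :: "(real ^ 'n \<Rightarrow> real) \<Rightarrow> real ^ 'n::finite \<Rightarrow> real ^ 'n" where
  "gradient f x = (\<chi> i. partial_deriv i f x)"

definition laplacian :: "(real ^ 'n \<Rightarrow> real) \<Rightarrow> real ^ 'n::finite \<Rightarrow> real" where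
  "laplacian f x = (\<Sum>i\<in>UNIV. partial_deriv i (partial_deriv i f) x)"

text \<open>
  Since \<^const>\<open>deriv\<close> is total, differentiability has to be demanded separately.
  Meant for open \<open>S\<close>.
\<close>

primrec C_k_on :: "nat \<Rightarrow> (real ^ 'n::finite) set \<Rightarrow> (real ^ 'n \<Rightarrow> real) \<Rightarrow> bool" where
  "C_k_on 0 S f \<longleftrightarrow> continuous_on S f"
| "C_k_on (Suc k) S f \<longleftrightarrow> continuous_on S f \<and>
     (\<forall>i. (\<forall>x\<in>S. (\<lambda>h. f (x + h *\<^sub>R axis i 1)) differentiable (at 0)) \<and>
          C_k_on k S (partial_deriv i f))"

definition smooth_fun :: "(real ^ 'n::finite \<Rightarrow> real) \<Rightarrow> bool" where
  "smooth_fun f \<longleftrightarrow> (\<forall>k. C_k_on k UNIV f)"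

text \<open>
  The usual regularity of classical solutions of parabolic equations; continuity of the
  derivatives is joint in space and time.  Meant for open \<open>S\<close> and \<open>T\<close>.
\<close>

definition C21_on :: "(real ^ 'n::finite) set \<Rightarrow> real set \<Rightarrow> (real ^ 'n \<Rightarrow> real \<Rightarrow> real) \<Rightarrow> bool" where
  "C21_on S T u \<longleftrightarrow>
     (\<forall>t\<in>T. C_k_on 2 S (\<lambda>x. u x t)) \<and>
     (\<forall>x\<in>S. \<forall>t\<in>T. u x differentiable (at t)) \<and>
     continuous_on (S \<times> T) (\<lambda>(x, t). u x t) \<and>
     continuous_on (S \<times> T) (\<lambda>(x, t). deriv (u x) t) \<and>
     (\<forall>i. continuous_on (S \<times> T) (\<lambda>(x, t). partial_deriv i (\<lambda>y. u y t) x)) \<and>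
     (\<forall>i j. continuous_on (S \<times> T)
        (\<lambda>(x, t). partial_deriv j (partial_deriv i (\<lambda>y. u y t)) x))"

abbreviation punctured :: "(real ^ 'n::finite) set" where
  "punctured \<equiv> UNIV - {0}"

text \<open>
  Functions on the punctured space are total functions whose value at the origin is irrelevant.
\<close>

definition L1_loc :: "(real ^ 'n::finite) set \<Rightarrow> (real ^ 'n \<Rightarrow> real) \<Rightarrow> bool" where
  "L1_loc S g \<longleftrightarrow> (\<forall>K. compact K \<and> K \<subseteq> S \<longrightarrow> g absolutely_integrable_on K)"

definition is_solution ::
  "real \<Rightarrow> (real ^ 'n::finite \<Rightarrow> real) \<Rightarrow> (real ^ 'n \<Rightarrow> real \<Rightarrow> real) \<Rightarrow> bool" where
  "is_solution m u0 u \<longleftrightarrow>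
     (AE x in lebesgue. 0 \<le> u0 x) \<and> L1_loc punctured u0 \<and>
     (\<forall>x\<in>punctured. \<forall>t>0. 0 < u x t) \<and>
     C21_on punctured {0<..} u \<and>
     (\<forall>x\<in>punctured. \<forall>t>0. deriv (u x) t = laplacian (\<lambda>y. (u y t) powr m / m) x) \<and>
     (\<forall>K. compact K \<and> K \<subseteq> punctured \<longrightarrow>
        ((\<lambda>t. \<integral>\<^sup>+x\<in>K. ennreal \<bar>u x t - u0 x\<bar> \<partial>lebesgue) \<longlongrightarrow> 0) (at_right 0))"

definition radially_symmetric :: "(real ^ 'n::finite \<Rightarrow> real) \<Rightarrow> bool" where
  "radially_symmetric f \<longleftrightarrow> (\<forall>x y. norm x = norm y \<longrightarrow> f x = f y)"

text \<open>
  \<open>is_profile m \<alpha> \<beta> l f\<close> is the defining property of \<open>f\<^sub>\<lambda>\<close> with \<open>\<lambda> = l\<close>.  It determines \<open>f\<close>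
  away from the origin for the parameters considered here.
\<close>

definition is_profile ::
  "real \<Rightarrow> real \<Rightarrow> real \<Rightarrow> real \<Rightarrow> (real ^ 'n::finite \<Rightarrow> real) \<Rightarrow> bool" where
  "is_profile m \<alpha> \<beta> l f \<longleftrightarrow>
     radially_symmetric f \<and>
     C_k_on 2 punctured f \<and>
     (\<forall>x\<in>punctured. 0 < f x) \<and>
     (\<forall>x\<in>punctured.
        laplacian (\<lambda>y. (f y) powr m / m) x + \<alpha> * f x + \<beta> * (x \<bullet> gradient f x) = 0) \<and>
     ((\<lambda>x. norm x powr (\<alpha> / \<beta>) * f x) \<longlongrightarrow> l powr (1 / ((1 - m) * \<beta>))) (at 0)"

definition self_similar ::
  "real \<Rightarrow> real \<Rightarrow> (real ^ 'n::finite \<Rightarrow> real) \<Rightarrow> real ^ 'n \<Rightarrow> real \<Rightarrow> real" where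
  "self_similar \<alpha> \<beta> f x t = t powr (- \<alpha>) * f (t powr (- \<beta>) *\<^sub>R x)"

text \<open>
  The radial function \<open>\<eta>\<^sub>1\<close> is given by its profile \<open>\<eta>\<close> on the half line; smoothness is that of
  the function \<open>x \<mapsto> \<eta> \<bar>x\<bar>\<close> on the whole space.  Values of \<open>\<eta>\<close> at negative
  arguments play no role.
\<close>

definition is_weight_source :: "'n::finite itself \<Rightarrow> real \<Rightarrow> (real \<Rightarrow> real) \<Rightarrow> bool" where
  "is_weight_source (_ :: 'n itself) \<mu> \<eta> \<longleftrightarrow>
     smooth_fun (\<lambda>x :: real ^ 'n. \<eta> (norm x)) \<and>
     (\<forall>r\<ge>0. 0 \<le> \<eta> r) \<and>
     (\<forall>r\<in>{0..1}. \<eta> r = 0) \<and>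
     (\<forall>r\<ge>2. \<eta> r = \<mu> * (real CARD('n) - 2 - \<mu>) * r powr (- \<mu> - 2))"

text \<open>The derivative of the double integral; \<open>d\<close> is the space dimension.\<close>

definition weight_slope :: "nat \<Rightarrow> (real \<Rightarrow> real) \<Rightarrow> real \<Rightarrow> real" where
  "weight_slope d \<eta> s =
     1 / s ^ (d - 1) * (LBINT \<rho>:{0..s}. \<rho> ^ (d - 1) * \<eta> \<rho>)"

definition weight_const :: "nat \<Rightarrow> (real \<Rightarrow> real) \<Rightarrow> real" where
  "weight_const d \<eta> = inverse (LBINT s:{0..}. weight_slope d \<eta> s)"

definition weight_of :: "(real \<Rightarrow> real) \<Rightarrow> real ^ 'n::finite \<Rightarrow> real" where
  "weight_of \<eta> x =
     1 - weight_const CARD('n) \<eta> * (LBINT s:{0..norm x}. weight_slope CARD('n) \<eta> s)"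

definition is_weight :: "real \<Rightarrow> (real ^ 'n::finite \<Rightarrow> real) \<Rightarrow> bool" where
  "is_weight \<mu> \<phi> \<longleftrightarrow> (\<exists>\<eta>. is_weight_source TYPE('n) \<mu> \<eta> \<and> \<phi> = weight_of \<eta>)"

definition weighted_L1 ::
  "(real ^ 'n::finite \<Rightarrow> real) \<Rightarrow> (real ^ 'n) set \<Rightarrow> (real ^ 'n \<Rightarrow> real) set" where
  "weighted_L1 \<phi> S =
     {g. L1_loc S g \<and> (\<integral>\<^sup>+x\<in>S. ennreal (\<bar>g x\<bar> * \<phi> x) \<partial>lebesgue) < \<infinity>}"

end

theory Submission
  imports Defs
begin

text \<open>
  Kato's inequality for \<open>z = (u\<^sup>m - v\<^sup>m) / m\<close> gives
  \<open>d/dt \<integral> (u - v)\<^sub>+ \<psi> \<le> \<integral> z\<^sub>+ \<Delta>\<psi>\<close> for test functions \<open>\<psi> \<ge> 0\<close> supported away from the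
  origin.  With the harmonic function \<open>N = |x|\<^bsup>2-n\<^esup>\<close> one has
  \<open>\<Delta>(\<Phi>(N)) = \<Phi>''(N) |\<nabla>N|\<^sup>2\<close>, and the weight is \<open>\<Phi>(N)\<close> with \<open>\<Phi>\<close> concave, nondecreasing
  and vanishing at \<open>0\<close>.  The shift \<open>\<Phi>(N + h) - \<Phi>(h)\<close> is smaller than \<open>\<Phi>(N)\<close>, still
  superharmonic, and has bounded slope, so it decays like \<open>N\<close> at infinity; multiplied by a cutoff
  in \<open>N\<close> it is an admissible \<open>\<psi>\<close> whose Laplacian is positive only on two shells
  \<open>|x| \<sim> R\<close> and \<open>|x| \<sim> 1/R\<close>.  There \<open>z\<^sub>+\<close> is at most \<open>V\<^sup>m / m\<close> for the upper barrier \<open>V\<close>.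
  The inner error is of order \<open>R\<^bsup>\<gamma>m+2-n\<^esup>\<close>; the outer error vanishes as \<open>R \<rightarrow> \<infinity>\<close>, uniformly
  down to time \<open>0\<close>, because the profile tends to \<open>0\<close> at infinity.  Then \<open>R \<rightarrow> \<infinity>\<close> and
  \<open>h \<rightarrow> 0\<close> by Fatou's lemma.
\<close>

subsection \<open>Partial derivatives and Green's identity\<close>

text \<open>The shift repairs a defect of the outer cutoff. The weight decays only like |x|^(-mu),
  so cutting it off directly at |x| ~ R gives a Laplacian of order R^(-mu-2) on a set of volume R^n.
  Uniformly down to t = 0 the barrier offers z <= const |x|^(-gamma m) at best, and n - 2 - mu -
  gamma m may be positive, so this error need not vanish. With decay like N, that is R^(2-n), the
  Laplacian is O(R^(-n)); this cancels the volume exactly, and z -> 0 at infinity suffices without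
  any rate. The cutoff depends on N rather than directly on |x| so that the product with the shifted
  weight is again a function of N: its Laplacian has no first-order term, and the concave factor
  contributes with a sign. On the inner shell the weight is constant in N, so only the second
  derivative of the cutoff survives. Compact support in the punctured space is forced: initial
  values are attained only in L^1 on its compact subsets.\<close>

definition has_partial :: "'n \<Rightarrow> (real ^ 'n::finite \<Rightarrow> real) \<Rightarrow> real \<Rightarrow> real ^ 'n \<Rightarrow> bool" where
  "has_partial i f d x \<longleftrightarrow> ((\<lambda>h. f (x + h *\<^sub>R axis i 1)) has_real_derivative d) (at 0)"

lemma partial_deriv_eq: "has_partial i f d x \<Longrightarrow> partial_deriv i f x = d"
  unfolding has_partial_def partial_deriv_def by (rule DERIV_imp_deriv)

lemma has_partial_at:
  assumes "has_partial i f d (x + s *\<^sub>R axis i 1)"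
  shows "((\<lambda>h. f (x + h *\<^sub>R axis i 1)) has_real_derivative d) (at s)"
proof -
  have "((\<lambda>h. f (x + (s + h) *\<^sub>R axis i 1)) has_real_derivative d) (at 0)"
    using assms by (simp add: has_partial_def algebra_simps)
  then show ?thesis
    using DERIV_shift[of "\<lambda>h. f (x + h *\<^sub>R axis i 1)" d 0 s] by (simp add: add.commute)
qed

lemma has_partial_cong:
  assumes "open S" "x \<in> S" "\<And>y. y \<in> S \<Longrightarrow> f y = g y" "has_partial i f d x"
  shows "has_partial i g d x"
proof -
  have "((\<lambda>h. x + h *\<^sub>R axis i 1) \<longlongrightarrow> x + 0 *\<^sub>R axis i 1) (nhds (0::real))"
    by (intro tendsto_intros filterlim_ident)
  then have "eventually (\<lambda>h. x + h *\<^sub>R axis i 1 \<in> S) (nhds (0::real))"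
    using assms(1,2) by (intro topological_tendstoD) auto
  then have "eventually (\<lambda>h. f (x + h *\<^sub>R axis i 1) = g (x + h *\<^sub>R axis i 1)) (nhds (0::real))"
    by eventually_elim (use assms(3) in auto)
  then show ?thesis
    using assms(4) unfolding has_partial_def by (subst (asm) DERIV_cong_ev) auto
qed

lemma has_partial_chain:
  assumes "has_partial i f d x" "(g has_real_derivative e) (at (f x))"
  shows "has_partial i (\<lambda>y. g (f y)) (e * d) x"
  using assms DERIV_chain2[of g e "\<lambda>h. f (x + h *\<^sub>R axis i 1)" 0 d UNIV]
  by (simp add: has_partial_def)

lemma has_partial_mult:
  "has_partial i f d x \<Longrightarrow> has_partial i g e x \<Longrightarrow> has_partial i (\<lambda>y. f y * g y) (d * g x + f x * e) x"
  unfolding has_partial_def by (auto intro!: derivative_eq_intros)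

lemma has_partial_diff:
  "has_partial i f d x \<Longrightarrow> has_partial i g e x \<Longrightarrow> has_partial i (\<lambda>y. f y - g y) (d - e) x"
  unfolding has_partial_def by (auto intro!: derivative_eq_intros)

text \<open>Mixed second derivatives never enter the argument, so only the pure ones are recorded.\<close>

definition C2_data :: "(real ^ 'n::finite) set \<Rightarrow> (real ^ 'n \<Rightarrow> real) \<Rightarrow>
    ('n \<Rightarrow> real ^ 'n \<Rightarrow> real) \<Rightarrow> ('n \<Rightarrow> real ^ 'n \<Rightarrow> real) \<Rightarrow> bool" where
  "C2_data S f f' f'' \<longleftrightarrow> continuous_on S f \<and>
     (\<forall>i. continuous_on S (f' i) \<and> continuous_on S (f'' i) \<and>
       (\<forall>x\<in>S. has_partial i f (f' i x) x \<and> has_partial i (f' i) (f'' i x) x))"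

lemma C_k_on_2_imp_C2_data:
  assumes "C_k_on 2 S f"
  shows "C2_data S f (\<lambda>i. partial_deriv i f) (\<lambda>i. partial_deriv i (partial_deriv i f))"
proof -
  have *: "C_k_on (Suc (Suc 0)) S f"
    using assms by (simp add: numeral_2_eq_2)
  have "has_partial i g (partial_deriv i g x) x"
    if "(\<lambda>h. g (x + h *\<^sub>R axis i 1)) differentiable (at 0)" for g :: "real ^ 'a \<Rightarrow> real" and i x
    using that unfolding has_partial_def partial_deriv_def
    by (metis DERIV_deriv_iff_real_differentiable)
  then show ?thesis
    using * unfolding C2_data_def by auto
qed

lemma C2_data_pure_partial:
  assumes "C2_data S f f' f''" "open S" "x \<in> S"
  shows "partial_deriv i f x = f' i x" "partial_deriv i (partial_deriv i f) x = f'' i x"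
proof -
  have 1: "partial_deriv i f y = f' i y" if "y \<in> S" for y
    using assms(1) that by (auto simp: C2_data_def intro: partial_deriv_eq)
  then show "partial_deriv i f x = f' i x"
    using assms(3) by auto
  have "has_partial i (partial_deriv i f) (f'' i x) x"
    using has_partial_cong[OF assms(2,3), of "f' i" "partial_deriv i f"] 1 assms
    by (auto simp: C2_data_def)
  then show "partial_deriv i (partial_deriv i f) x = f'' i x"
    by (rule partial_deriv_eq)
qed

lemma C2_data_laplacian:
  "C2_data S f f' f'' \<Longrightarrow> open S \<Longrightarrow> x \<in> S \<Longrightarrow> laplacian f x = (\<Sum>i\<in>UNIV. f'' i x)"
  by (simp add: laplacian_def C2_data_pure_partial)

lemma C2_data_diff:
  "C2_data S f f' f'' \<Longrightarrow> C2_data S g g' g'' \<Longrightarrow>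
   C2_data S (\<lambda>x. f x - g x) (\<lambda>i x. f' i x - g' i x) (\<lambda>i x. f'' i x - g'' i x)"
  unfolding C2_data_def by (auto intro!: continuous_intros has_partial_diff)

lemma C2_data_chain:
  assumes f: "C2_data S f f' f''" and T: "\<And>x. x \<in> S \<Longrightarrow> f x \<in> T"
    and g: "\<And>s. s \<in> T \<Longrightarrow> (g has_real_derivative g' s) (at s)"
    and g': "\<And>s. s \<in> T \<Longrightarrow> (g' has_real_derivative g'' s) (at s)"
    and cont: "continuous_on T g''"
  shows "C2_data S (\<lambda>x. g (f x)) (\<lambda>i x. g' (f x) * f' i x)
           (\<lambda>i x. g'' (f x) * (f' i x)\<^sup>2 + g' (f x) * f'' i x)"
proof -
  have "continuous_on T g" "continuous_on T g'"
    by (rule DERIV_continuous_on[OF has_field_derivative_at_within], erule g g')+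
  then have c: "continuous_on S (\<lambda>x. g (f x))" "continuous_on S (\<lambda>x. g' (f x))"
      "continuous_on S (\<lambda>x. g'' (f x))"
    using f T cont by (auto simp: C2_data_def intro: continuous_on_compose2[of T _ S f])
  have "has_partial i (\<lambda>x. g' (f x) * f' i x) (g'' (f x) * (f' i x)\<^sup>2 + g' (f x) * f'' i x) x"
    if "x \<in> S" for i x
    using has_partial_mult[OF has_partial_chain[of i f "f' i x" x g' "g'' (f x)"], of "f' i" "f'' i x"]
      f T g' that by (auto simp: C2_data_def power2_eq_square mult.assoc)
  then show ?thesis
    using f T c has_partial_chain[OF _ g, of _ f]
    by (auto simp: C2_data_def intro!: continuous_on_mult continuous_on_add continuous_on_power)
qed

lemma C2_data_norm_square:
  "C2_data UNIV (\<lambda>x :: real ^ 'n::finite. x \<bullet> x) (\<lambda>i x. 2 * x $ i) (\<lambda>i x. 2)"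
proof -
  have eq: "x \<bullet> axis i 1 = x $ i" for x :: "real ^ 'n" and i
    by (simp add: inner_axis)
  have "has_partial i (\<lambda>x :: real ^ 'n. x \<bullet> x) (2 * x $ i) x" for i x
  proof -
    have "(x + h *\<^sub>R axis i 1) \<bullet> (x + h *\<^sub>R axis i 1) = x \<bullet> x + 2 * h * x $ i + h\<^sup>2" for h
      by (simp add: inner_add_left inner_add_right eq inner_commute[of "axis i 1"] power2_eq_square
          algebra_simps)
    then show ?thesis
      unfolding has_partial_def by (auto intro!: derivative_eq_intros)
  qed
  moreover have "has_partial i (\<lambda>x :: real ^ 'n. 2 * x $ i) 2 x" for i x
    unfolding has_partial_def by (auto intro!: derivative_eq_intros simp: axis_def)
  ultimately show ?thesis
    unfolding C2_data_def by (auto intro!: continuous_intros)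
qed

text \<open>Translation invariance of Lebesgue measure gives every difference quotient of
  \<open>g\<close> integral 0. The quotients converge to \<open>g'\<close>, and the mean value
  theorem bounds them by the supremum of \<open>g'\<close>. Step sizes are at most 1, so all of them
  vanish outside the ball of radius \<open>R + 1\<close>, which provides the dominating
  function.\<close>

lemma integral_partial_eq_0:
  fixes g g' :: "real ^ 'n::finite \<Rightarrow> real"
  assumes deriv: "\<And>x. has_partial i g (g' x) x"
    and cont: "continuous_on UNIV g" "continuous_on UNIV g'"
    and supp: "\<And>x. x \<notin> cball 0 R \<Longrightarrow> g x = 0" "\<And>x. x \<notin> cball 0 R \<Longrightarrow> g' x = 0"
  shows "integral\<^sup>L lborel g' = 0"
proof -
  define e :: "real ^ 'n" where "e = axis i 1"
  have ne: "norm e = 1" by (simp add: e_def)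
  define s where "s n = inverse (real (Suc n))" for n
  have s: "0 < s n" "s n \<le> 1" for n
    by (auto simp: s_def divide_simps)
  define q where "q n x = (g (x + s n *\<^sub>R e) - g x) / s n" for n x
  have "compact (g' ` cball 0 R)"
    by (intro compact_continuous_image continuous_on_subset[OF cont(2)]) auto
  then obtain B where B: "\<And>x. x \<in> cball 0 R \<Longrightarrow> \<bar>g' x\<bar> \<le> B"
    by (metis compact_imp_bounded bounded_iff imageI real_norm_def)
  have B': "\<bar>g' x\<bar> \<le> max B 0" for x
    using B[of x] supp(2)[of x] by (cases "x \<in> cball 0 R") auto
  have gint: "integrable lborel g"
  proof -
    have "integrable lborel (\<lambda>x. indicator (cball 0 R) x *\<^sub>R g x)"
      by (intro borel_integrable_compact continuous_on_subset[OF cont(1)]) auto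
    moreover have "(\<lambda>x. indicator (cball 0 R) x *\<^sub>R g x) = g"
      using supp(1) by (auto simp: indicator_def fun_eq_iff)
    ultimately show ?thesis by simp
  qed
  have q0: "integral\<^sup>L lborel (q n) = 0" for n
  proof -
    have i1: "integrable lborel (\<lambda>x. g (x + s n *\<^sub>R e))"
      using integrable_distr[of "(+) (s n *\<^sub>R e)" lborel borel g] gint
      by (simp add: lborel_distr_plus add.commute)
    have "integral\<^sup>L lborel (\<lambda>x. g (x + s n *\<^sub>R e)) = integral\<^sup>L lborel g"
      using integral_distr[of "(+) (s n *\<^sub>R e)" lborel borel g] cont(1)
      by (simp add: lborel_distr_plus add.commute borel_measurable_continuous_onI)
    then show ?thesis
      unfolding q_def using i1 gint by simp
  qed
  have "(\<lambda>n. integral\<^sup>L lborel (q n)) \<longlonglongrightarrow> integral\<^sup>L lborel g'"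
  proof (rule integral_dominated_convergence[where w = "\<lambda>x. indicator (cball 0 (R + 1)) x *\<^sub>R max B 0"])
    show "g' \<in> borel_measurable lborel" "\<And>n. q n \<in> borel_measurable lborel"
      unfolding q_def divide_inverse using cont
      by (auto intro!: borel_measurable_continuous_onI continuous_intros
          continuous_on_compose2[OF cont(1)])
    show "integrable lborel (\<lambda>x::real^'n. indicator (cball 0 (R + 1)) x *\<^sub>R max B 0)"
      by (intro borel_integrable_compact) auto
    show "AE x in lborel. (\<lambda>n. q n x) \<longlonglongrightarrow> g' x"
    proof (rule AE_I2)
      fix x
      have "((\<lambda>h. (g (x + h *\<^sub>R e) - g x) / h) \<longlongrightarrow> g' x) (at 0)"
        using deriv[of x] by (simp add: has_partial_def DERIV_def e_def)
      moreover have "filterlim s (at 0) sequentially"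
      proof (rule filterlim_atI)
        show "s \<longlonglongrightarrow> 0"
          unfolding s_def by (rule LIMSEQ_inverse_real_of_nat)
      qed (use s in \<open>auto simp: less_imp_neq[THEN not_sym]\<close>)
      ultimately show "(\<lambda>n. q n x) \<longlonglongrightarrow> g' x"
        unfolding q_def by (rule filterlim_compose)
    qed
    show "AE x in lborel. norm (q n x) \<le> indicator (cball 0 (R + 1)) x *\<^sub>R max B 0" for n
    proof (rule AE_I2)
      fix x
      show "norm (q n x) \<le> indicator (cball 0 (R + 1)) x *\<^sub>R max B 0"
      proof (cases "x \<in> cball 0 (R + 1)")
        case True
        have "\<exists>c. 0 < c \<and> c < s n \<and> g (x + s n *\<^sub>R e) - g (x + 0 *\<^sub>R e) = (s n - 0) * g' (x + c *\<^sub>R e)"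
          using s(1) by (intro MVT2) (auto simp: e_def intro!: has_partial_at deriv)
        then obtain c where "g (x + s n *\<^sub>R e) - g x = s n * g' (x + c *\<^sub>R e)"
          by auto
        then have "q n x = g' (x + c *\<^sub>R e)"
          using s(1)[of n] by (simp add: q_def)
        then show ?thesis
          using True B'[of "x + c *\<^sub>R e"] by simp
      next
        case False
        have "norm x \<le> norm (x + s n *\<^sub>R e) + norm (s n *\<^sub>R e)"
          using norm_triangle_ineq4[of "x + s n *\<^sub>R e" "s n *\<^sub>R e"] by simp
        also have "norm (s n *\<^sub>R e) \<le> 1"
          using s[of n] ne by simp
        finally have "norm (x + s n *\<^sub>R e) > R" "norm x > R"
          using False by auto
        then show ?thesis
          using supp(1) False by (simp add: q_def)
      qed
    qed
  qed
  then show ?thesis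
    unfolding q0 by (simp add: LIMSEQ_const_iff)
qed

text \<open>\<open>S\<close> and the complement of \<open>K\<close> are open and cover the space; on
  the second set the product is 0, whatever the values of \<open>f\<close> off
  \<open>S\<close>.\<close>

lemma continuous_on_mult_compact_support:
  fixes f g :: "'a::t2_space \<Rightarrow> real"
  assumes "open S" "continuous_on S f" "continuous_on UNIV g"
    and K: "compact K" "K \<subseteq> S" "\<And>x. x \<notin> K \<Longrightarrow> g x = 0"
  shows "continuous_on UNIV (\<lambda>x. f x * g x)"
proof -
  have "continuous_on S (\<lambda>x. f x * g x)"
    using assms(2) continuous_on_subset[OF assms(3) subset_UNIV] by (intro continuous_on_mult)
  moreover have "continuous_on (- K) (\<lambda>x. f x * g x)"
    using K(3) by (subst continuous_on_cong[OF refl, of _ _ "\<lambda>_. 0"]) auto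
  ultimately have "continuous_on (S \<union> - K) (\<lambda>x. f x * g x)"
    using assms(1) K(1) by (intro continuous_on_open_Un) (auto simp: compact_imp_closed)
  moreover have "S \<union> - K = UNIV"
    using K(2) by auto
  ultimately show ?thesis by simp
qed

lemma integrable_compact_support:
  fixes g :: "'a::euclidean_space \<Rightarrow> real"
  assumes "continuous_on UNIV g" "compact K" "\<And>x. x \<notin> K \<Longrightarrow> g x = 0"
  shows "integrable lborel g"
proof -
  have "integrable lborel (\<lambda>x. indicator K x *\<^sub>R g x)"
    using assms by (intro borel_integrable_compact continuous_on_subset[OF assms(1)]) auto
  moreover have "(\<lambda>x. indicator K x *\<^sub>R g x) = g"
    using assms(3) by (auto simp: indicator_def fun_eq_iff)
  ultimately show ?thesis by simp
qed

lemma C2_data_continuous: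
  assumes "C2_data S f f' f''"
  shows "continuous_on S f" "continuous_on S (f' i)" "continuous_on S (f'' i)"
  using assms by (auto simp: C2_data_def)

text \<open>In \<open>A * \<psi>' i - A' i * \<psi>\<close> the mixed first-order products cancel
  upon differentiation, leaving \<open>A * \<psi>'' i - A'' i * \<psi>\<close>. This field has
  compact support, so the integral of its derivative vanishes for each direction separately.\<close>

lemma green_identity:
  fixes A \<psi> :: "real ^ 'n::finite \<Rightarrow> real"
  assumes A: "C2_data S A A' A''" and \<psi>: "C2_data UNIV \<psi> \<psi>' \<psi>''" and S: "open S"
    and K: "compact K" "K \<subseteq> S"
    and supp: "\<And>x i. x \<notin> K \<Longrightarrow> \<psi> x = 0 \<and> \<psi>' i x = 0 \<and> \<psi>'' i x = 0"
  shows "integrable lborel (\<lambda>x. A x * (\<Sum>i\<in>UNIV. \<psi>'' i x))"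
    and "integrable lborel (\<lambda>x. (\<Sum>i\<in>UNIV. A'' i x) * \<psi> x)"
    and "(\<integral>x. A x * (\<Sum>i\<in>UNIV. \<psi>'' i x) \<partial>lborel) = (\<integral>x. (\<Sum>i\<in>UNIV. A'' i x) * \<psi> x \<partial>lborel)"
proof -
  note cA = C2_data_continuous[OF A] and c\<psi> = C2_data_continuous[OF \<psi>]
  have c: "continuous_on UNIV (\<lambda>x. A x * \<psi>'' i x)" "continuous_on UNIV (\<lambda>x. A'' i x * \<psi> x)"
    "continuous_on UNIV (\<lambda>x. A x * \<psi>' i x)" "continuous_on UNIV (\<lambda>x. A' i x * \<psi> x)" for i
    using supp by (auto intro!: continuous_on_mult_compact_support[OF S _ _ K] cA c\<psi>)
  have int: "integrable lborel (\<lambda>x. A x * \<psi>'' i x)" "integrable lborel (\<lambda>x. A'' i x * \<psi> x)" for i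
    using supp by (auto intro!: integrable_compact_support[OF _ K(1)] c)
  obtain R where R: "K \<subseteq> cball 0 R"
    using compact_imp_bounded[OF K(1)] by (metis bounded_iff mem_cball_0 subsetI)
  have eq: "(\<integral>x. A x * \<psi>'' i x \<partial>lborel) = (\<integral>x. A'' i x * \<psi> x \<partial>lborel)" for i
  proof -
    have hp: "has_partial i (\<lambda>x. A x * \<psi>' i x - A' i x * \<psi> x) (A x * \<psi>'' i x - A'' i x * \<psi> x) x" for x
    proof (cases "x \<in> S")
      case True
      have "has_partial i (\<lambda>x. A x * \<psi>' i x - A' i x * \<psi> x)
          ((A' i x * \<psi>' i x + A x * \<psi>'' i x) - (A'' i x * \<psi> x + A' i x * \<psi>' i x)) x"
        using A \<psi> True unfolding C2_data_def by (intro has_partial_diff has_partial_mult) auto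
      then show ?thesis by simp
    next
      case False
      then have x: "x \<in> - K" using K by auto
      \<comment> \<open>Off \<open>S\<close> the data of \<open>A\<close> carry no information, but
        \<open>x\<close> has a neighbourhood that misses \<open>K\<close>, and there the expression
        is identically 0.\<close>
      have "has_partial i (\<lambda>x. A x * \<psi>' i x - A' i x * \<psi> x) 0 x"
        by (rule has_partial_cong[OF _ x, of "\<lambda>_. 0"])
          (use supp in \<open>auto simp: K compact_imp_closed open_Compl has_partial_def\<close>)
      then show ?thesis using supp x by auto
    qed
    have "integral\<^sup>L lborel (\<lambda>x. A x * \<psi>'' i x - A'' i x * \<psi> x) = 0"
    proof (rule integral_partial_eq_0[OF hp])
      have "x \<notin> K" if "x \<notin> cball 0 R" for x
        using R that by auto
      then show "A x * \<psi>' i x - A' i x * \<psi> x = 0" "A x * \<psi>'' i x - A'' i x * \<psi> x = 0"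
        if "x \<notin> cball 0 R" for x
        using supp that by simp_all
    qed (intro continuous_intros c)+
    then show ?thesis
      using int by simp
  qed
  show "integrable lborel (\<lambda>x. A x * (\<Sum>i\<in>UNIV. \<psi>'' i x))"
    "integrable lborel (\<lambda>x. (\<Sum>i\<in>UNIV. A'' i x) * \<psi> x)"
    using int by (simp_all add: sum_distrib_left sum_distrib_right)
  show "(\<integral>x. A x * (\<Sum>i\<in>UNIV. \<psi>'' i x) \<partial>lborel) = (\<integral>x. (\<Sum>i\<in>UNIV. A'' i x) * \<psi> x \<partial>lborel)"
    using int eq by (simp add: sum_distrib_left sum_distrib_right)
qed

subsection \<open>Kato's inequality\<close>

text \<open>The upper branch of the hyperbola y (y - s) = e^2 / 4, whose asymptotes are y = 0 and y
  = s. It is smooth and convex on the whole line, so the chain rule for \<open>C2_data\<close>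
  applies and the second derivative has a sign.\<close>

definition soft_pos :: "real \<Rightarrow> real \<Rightarrow> real" where
  "soft_pos e s = (s + sqrt (s\<^sup>2 + e\<^sup>2)) / 2"

definition soft_step :: "real \<Rightarrow> real \<Rightarrow> real" where
  "soft_step e s = (1 + s / sqrt (s\<^sup>2 + e\<^sup>2)) / 2"

context
  fixes e :: real assumes e: "0 < e"
begin

lemma soft_sum_pos: "0 < s\<^sup>2 + e\<^sup>2"
  using e by (intro add_nonneg_pos) auto

lemma abs_le_soft_sqrt: "\<bar>s\<bar> \<le> sqrt (s\<^sup>2 + e\<^sup>2)"
  using real_le_rsqrt[of "\<bar>s\<bar>" "s\<^sup>2 + e\<^sup>2"] by simp

lemma sqrt_square_sum_deriv:
  "((\<lambda>s. sqrt (s\<^sup>2 + e\<^sup>2)) has_real_derivative s / sqrt (s\<^sup>2 + e\<^sup>2)) (at s)"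
proof -
  have "((\<lambda>s. s\<^sup>2 + e\<^sup>2) has_real_derivative 2 * s) (at s)"
    by (auto intro!: derivative_eq_intros)
  from DERIV_chain2[OF DERIV_real_sqrt[OF soft_sum_pos] this] show ?thesis
    by (simp add: field_simps)
qed

lemma soft_pos_deriv: "(soft_pos e has_real_derivative soft_step e s) (at s)"
  unfolding soft_pos_def[abs_def] soft_step_def
  by (rule DERIV_cdivide[OF DERIV_add[OF DERIV_ident sqrt_square_sum_deriv]])

lemma soft_step_deriv:
  "(soft_step e has_real_derivative e\<^sup>2 / (2 * (s\<^sup>2 + e\<^sup>2) * sqrt (s\<^sup>2 + e\<^sup>2))) (at s)"
proof -
  define r where "r = sqrt (s\<^sup>2 + e\<^sup>2)"
  have r: "0 < r" "r\<^sup>2 = s\<^sup>2 + e\<^sup>2" "s\<^sup>2 = r\<^sup>2 - e\<^sup>2"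
    using soft_sum_pos[of s] by (auto simp: r_def)
  have "(soft_step e has_real_derivative (0 + (1 * r - s * (s / r)) / (r * r)) / 2) (at s)"
    unfolding soft_step_def[abs_def] r_def
    using DERIV_cdivide[OF DERIV_add[OF DERIV_const
          DERIV_divide[OF DERIV_ident sqrt_square_sum_deriv[of s]]], of 1 2] r(1) soft_sum_pos[of s] e
    by (simp add: r_def)
  also have "(0 + (1 * r - s * (s / r)) / (r * r)) / 2 = e\<^sup>2 / (2 * r\<^sup>2 * r)"
  proof -
    have "1 * r - s * (s / r) = (r\<^sup>2 - s\<^sup>2) / r"
      using r(1) by (simp add: field_simps power2_eq_square)
    also have "\<dots> = e\<^sup>2 / r"
      using r(3) by simp
    finally show ?thesis
      using r(1) by (simp add: power2_eq_square)
  qed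
  finally show ?thesis
    unfolding r(2) unfolding r_def .
qed

lemma soft_step_deriv_nonneg: "0 \<le> e\<^sup>2 / (2 * (s\<^sup>2 + e\<^sup>2) * sqrt (s\<^sup>2 + e\<^sup>2))"
  using soft_sum_pos[of s] by simp

lemma soft_step_bounds: "0 \<le> soft_step e s" "soft_step e s \<le> 1"
proof -
  have "0 < sqrt (s\<^sup>2 + e\<^sup>2)"
    using soft_sum_pos[of s] by simp
  then have "- 1 \<le> s / sqrt (s\<^sup>2 + e\<^sup>2)" "s / sqrt (s\<^sup>2 + e\<^sup>2) \<le> 1"
    using abs_le_soft_sqrt[of s] by (simp_all only: le_divide_eq_1_pos divide_le_eq_1_pos pos_le_divide_eq)
  then show "0 \<le> soft_step e s" "soft_step e s \<le> 1"
    by (simp_all add: soft_step_def)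
qed

lemma soft_pos_bounds: "0 \<le> soft_pos e s" "soft_pos e s \<le> \<bar>s\<bar> + e"
proof -
  have "\<bar>s\<bar> \<le> sqrt (s\<^sup>2 + e\<^sup>2)"
    by (rule abs_le_soft_sqrt)
  moreover have "sqrt (s\<^sup>2 + e\<^sup>2) \<le> \<bar>s\<bar> + e"
    using sqrt_add_le_add_sqrt[of "s\<^sup>2" "e\<^sup>2"] e by simp
  ultimately have "0 \<le> (s + sqrt (s\<^sup>2 + e\<^sup>2)) / 2 \<and> (s + sqrt (s\<^sup>2 + e\<^sup>2)) / 2 \<le> \<bar>s\<bar> + e"
    using e by (auto simp: abs_if split: if_splits)
  then show "0 \<le> soft_pos e s" "soft_pos e s \<le> \<bar>s\<bar> + e"
    by (auto simp: soft_pos_def)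
qed

end

text \<open>The step functions equal 1/2 at 0 for every parameter, which is why the limit is (1 +
  sgn s) / 2 and not an indicator. Keeping this exact pointwise limit avoids any discussion of the
  zero set of \<open>s\<close>.\<close>

lemma soft_limits:
  assumes "e \<longlonglongrightarrow> 0"
  shows "(\<lambda>n. soft_pos (e n) s) \<longlonglongrightarrow> max s 0" "(\<lambda>n. soft_step (e n) s) \<longlonglongrightarrow> (1 + sgn s) / 2"
proof -
  have *: "(\<lambda>n. sqrt (s\<^sup>2 + (e n)\<^sup>2)) \<longlonglongrightarrow> sqrt (s\<^sup>2 + 0\<^sup>2)"
    by (intro tendsto_intros assms)
  have "(\<lambda>n. soft_pos (e n) s) \<longlonglongrightarrow> (s + sqrt (s\<^sup>2 + 0\<^sup>2)) / 2"
    unfolding soft_pos_def by (intro tendsto_intros assms) auto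
  then show "(\<lambda>n. soft_pos (e n) s) \<longlonglongrightarrow> max s 0"
    by (auto simp: max_def abs_if split: if_splits)
  show "(\<lambda>n. soft_step (e n) s) \<longlonglongrightarrow> (1 + sgn s) / 2"
  proof (cases "s = 0")
    case False
    have "(\<lambda>n. soft_step (e n) s) \<longlonglongrightarrow> (1 + s / sqrt (s\<^sup>2 + 0\<^sup>2)) / 2"
      unfolding soft_step_def using False by (intro tendsto_intros assms) auto
    then show ?thesis
      using False by (simp add: sgn_real_def abs_if split: if_splits)
  qed (simp add: soft_step_def)
qed

lemma LIMSEQ_inverse_Suc: "(\<lambda>n. inverse (real (Suc n))) \<longlonglongrightarrow> 0"
  by (rule LIMSEQ_inverse_real_of_nat)

text \<open>For convex P, the Laplacian of P(z) is P''(z) |grad z|^2 + P'(z) times the Laplacian of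
  z, and the first term may be dropped. Test with \<open>\<psi> \<ge> 0\<close>, move the Laplacian
  of P(z) onto \<open>\<psi>\<close> by Green's identity, and let P run through the functions
  \<open>soft_pos (e n)\<close>. Compact support supplies the majorants for both limits.\<close>

lemma kato_inequality:
  fixes z \<psi> :: "real ^ 'n::finite \<Rightarrow> real"
  assumes z: "C2_data S z z' z''" and \<psi>: "C2_data UNIV \<psi> \<psi>' \<psi>''" and S: "open S"
    and K: "compact K" "K \<subseteq> S"
    and supp: "\<And>x i. x \<notin> K \<Longrightarrow> \<psi> x = 0 \<and> \<psi>' i x = 0 \<and> \<psi>'' i x = 0"
    and nonneg: "\<And>x. 0 \<le> \<psi> x"
  shows "(\<integral>x. (1 + sgn (z x)) / 2 * ((\<Sum>i\<in>UNIV. z'' i x) * \<psi> x) \<partial>lborel)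
     \<le> (\<integral>x. max (z x) 0 * (\<Sum>i\<in>UNIV. \<psi>'' i x) \<partial>lborel)"
proof -
  define e where "e n = inverse (real (Suc n))" for n
  have e: "0 < e n" "e n \<le> 1" "e \<longlonglongrightarrow> 0" for n
    using LIMSEQ_inverse_Suc by (auto simp: e_def[abs_def] divide_simps)
  note cz = C2_data_continuous[OF z] and c\<psi> = C2_data_continuous[OF \<psi>]
  define D where "D x = (\<Sum>i\<in>UNIV. z'' i x)" for x
  define L where "L x = (\<Sum>i\<in>UNIV. \<psi>'' i x)" for x
  have cD: "continuous_on S D" and cL: "continuous_on UNIV L"
    unfolding D_def L_def by (intro continuous_intros cz c\<psi>)+
  have L0: "L x = 0" if "x \<notin> K" for x
    using supp that by (simp add: L_def)
  have step_cont: "continuous_on S (\<lambda>x. soft_step (e n) (z x))" for n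
    by (rule continuous_on_compose2[OF DERIV_continuous_on[OF has_field_derivative_at_within]
          cz(1) subset_UNIV])
       (rule soft_step_deriv[OF e(1)])
  have pos_cont: "continuous_on S (\<lambda>x. soft_pos (e n) (z x))" for n
    by (rule continuous_on_compose2[OF DERIV_continuous_on[OF has_field_derivative_at_within]
          cz(1) subset_UNIV])
       (rule soft_pos_deriv[OF e(1)])
  have int1: "integrable lborel (\<lambda>x. soft_step (e n) (z x) * (D x * \<psi> x))" for n
    unfolding mult.assoc[symmetric]
    by (intro integrable_compact_support[OF _ K(1)] continuous_on_mult_compact_support[OF S _ _ K]
        continuous_intros step_cont cD c\<psi>) (use supp in auto)
  have int1': "integrable lborel (\<lambda>x. D x * \<psi> x)"
    by (intro integrable_compact_support[OF _ K(1)] continuous_on_mult_compact_support[OF S _ _ K]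
        continuous_intros cD c\<psi>) (use supp in auto)
  have int2: "integrable lborel (\<lambda>x. soft_pos (e n) (z x) * L x)" for n
    by (intro integrable_compact_support[OF _ K(1)] continuous_on_mult_compact_support[OF S _ _ K]
        continuous_intros pos_cont cL) (use L0 in auto)
  have int2': "integrable lborel (\<lambda>x. z x * L x)" "integrable lborel L"
    by (intro integrable_compact_support[OF _ K(1)] continuous_on_mult_compact_support[OF S _ _ K]
        continuous_intros cz cL; use L0 in auto)+
  have "(\<integral>x. soft_step (e n) (z x) * (D x * \<psi> x) \<partial>lborel) \<le> (\<integral>x. soft_pos (e n) (z x) * L x \<partial>lborel)"
    for n
  proof -
    define p' where "p' s = (e n)\<^sup>2 / (2 * (s\<^sup>2 + (e n)\<^sup>2) * sqrt (s\<^sup>2 + (e n)\<^sup>2))" for s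
    have cp: "continuous_on UNIV p'"
    proof -
      have "2 * (s\<^sup>2 + (e n)\<^sup>2) * sqrt (s\<^sup>2 + (e n)\<^sup>2) \<noteq> 0" for s
        using soft_sum_pos[OF e(1)[of n], of s] by (metis less_irrefl mult_eq_0_iff real_sqrt_eq_zero_cancel_iff zero_neq_numeral)
      then show ?thesis
        unfolding p'_def by (intro continuous_intros) auto
    qed
    have P: "C2_data S (\<lambda>x. soft_pos (e n) (z x)) (\<lambda>i x. soft_step (e n) (z x) * z' i x)
           (\<lambda>i x. p' (z x) * (z' i x)\<^sup>2 + soft_step (e n) (z x) * z'' i x)"
      by (rule C2_data_chain[OF z UNIV_I _ _ cp])
         (unfold p'_def, rule soft_pos_deriv[OF e(1)], rule soft_step_deriv[OF e(1)])
    have "soft_step (e n) (z x) * (D x * \<psi> x)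
        \<le> (\<Sum>i\<in>UNIV. p' (z x) * (z' i x)\<^sup>2 + soft_step (e n) (z x) * z'' i x) * \<psi> x" for x
    proof -
      have "0 \<le> p' (z x) * (z' i x)\<^sup>2" for i
        using soft_step_deriv_nonneg[OF e(1)[of n], of "z x"] by (simp add: p'_def)
      then have "soft_step (e n) (z x) * D x
          \<le> (\<Sum>i\<in>UNIV. p' (z x) * (z' i x)\<^sup>2 + soft_step (e n) (z x) * z'' i x)"
        unfolding D_def sum_distrib_left by (intro sum_mono) simp
      from mult_right_mono[OF this nonneg[of x]] show ?thesis
        by (simp add: mult.assoc)
    qed
    then have "(\<integral>x. soft_step (e n) (z x) * (D x * \<psi> x) \<partial>lborel)
       \<le> (\<integral>x. (\<Sum>i\<in>UNIV. p' (z x) * (z' i x)\<^sup>2 + soft_step (e n) (z x) * z'' i x) * \<psi> x \<partial>lborel)"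
      by (intro integral_mono int1 green_identity(2)[OF P \<psi> S K supp]) auto
    also have "\<dots> = (\<integral>x. soft_pos (e n) (z x) * L x \<partial>lborel)"
      unfolding L_def by (rule green_identity(3)[OF P \<psi> S K supp, symmetric])
    finally show ?thesis .
  qed
  moreover have "(\<lambda>n. \<integral>x. soft_step (e n) (z x) * (D x * \<psi> x) \<partial>lborel)
      \<longlonglongrightarrow> (\<integral>x. (1 + sgn (z x)) / 2 * (D x * \<psi> x) \<partial>lborel)"
  proof (rule integral_dominated_convergence[where w = "\<lambda>x. \<bar>D x * \<psi> x\<bar>"])
    show lim: "AE x in lborel. (\<lambda>n. soft_step (e n) (z x) * (D x * \<psi> x))
        \<longlonglongrightarrow> (1 + sgn (z x)) / 2 * (D x * \<psi> x)"
      by (intro AE_I2 tendsto_intros soft_limits e)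
    show "(\<lambda>x. (1 + sgn (z x)) / 2 * (D x * \<psi> x)) \<in> borel_measurable lborel"
    proof (rule borel_measurable_LIMSEQ_real)
      show "(\<lambda>n. soft_step (e n) (z x) * (D x * \<psi> x)) \<longlonglongrightarrow> (1 + sgn (z x)) / 2 * (D x * \<psi> x)" for x
        by (intro tendsto_intros soft_limits e)
    qed (use int1 in auto)
    show "AE x in lborel. norm (soft_step (e n) (z x) * (D x * \<psi> x)) \<le> \<bar>D x * \<psi> x\<bar>" for n
      using soft_step_bounds[OF e(1)] by (auto simp: abs_mult intro!: mult_left_le_one_le)
  qed (use int1 int1' in auto)
  moreover have "(\<lambda>n. \<integral>x. soft_pos (e n) (z x) * L x \<partial>lborel) \<longlonglongrightarrow> (\<integral>x. max (z x) 0 * L x \<partial>lborel)"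
  proof (rule integral_dominated_convergence[where w = "\<lambda>x. \<bar>z x * L x\<bar> + \<bar>L x\<bar>"])
    show lim: "AE x in lborel. (\<lambda>n. soft_pos (e n) (z x) * L x) \<longlonglongrightarrow> max (z x) 0 * L x"
      by (intro AE_I2 tendsto_intros soft_limits e)
    show "(\<lambda>x. max (z x) 0 * L x) \<in> borel_measurable lborel"
      by (rule borel_measurable_LIMSEQ_real[of _ "\<lambda>n x. soft_pos (e n) (z x) * L x"])
        (use int2 in \<open>auto intro!: tendsto_intros soft_limits e\<close>)
    have "\<bar>soft_pos (e n) s\<bar> * \<bar>l\<bar> \<le> \<bar>s * l\<bar> + \<bar>l\<bar>" for n s l
    proof -
      have "\<bar>soft_pos (e n) s\<bar> \<le> \<bar>s\<bar> + 1"
        using soft_pos_bounds[OF e(1)[of n], of s] e(2)[of n] by auto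
      from mult_right_mono[OF this abs_ge_zero[of l]] show ?thesis
        by (simp add: abs_mult algebra_simps)
    qed
    then show "AE x in lborel. norm (soft_pos (e n) (z x) * L x) \<le> \<bar>z x * L x\<bar> + \<bar>L x\<bar>" for n
      by (auto simp: abs_mult)
  qed (use int2 int2' in auto)
  ultimately show ?thesis
    unfolding D_def L_def by (intro LIMSEQ_le) auto
qed

text \<open>The positive part of \<open>w\<close> need not be differentiable at zeros of
  \<open>w\<close>, so the fundamental theorem is applied to \<open>soft_pos (e n) (w t)\<close> and
  the limit taken afterwards. This yields the same factor, with value 1/2 at zeros, as in Kato's
  inequality, so the two results fit together without exceptional sets.\<close>

lemma positive_part_increment:
  fixes w w' :: "real \<Rightarrow> real"
  assumes "a \<le> b"
    and deriv: "\<And>t. t \<in> {a..b} \<Longrightarrow> (w has_real_derivative w' t) (at t)"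
    and cont: "continuous_on {a..b} w'"
  shows "(\<integral>t. indicator {a..b} t * ((1 + sgn (w t)) / 2 * w' t) \<partial>lborel) = max (w b) 0 - max (w a) 0"
proof -
  define e where "e n = inverse (real (Suc n))" for n
  have e: "0 < e n" "e \<longlonglongrightarrow> 0" for n
    using LIMSEQ_inverse_Suc by (auto simp: e_def[abs_def])
  have cw: "continuous_on {a..b} w"
    by (rule DERIV_continuous_on[OF has_field_derivative_at_within], rule deriv)
  have int': "integrable lborel (\<lambda>t. indicator {a..b} t * w' t)"
    using borel_integrable_compact[OF compact_Icc cont] by simp
  have cs: "continuous_on {a..b} (\<lambda>t. soft_step (e n) (w t) * w' t)" for n
    by (intro continuous_on_mult cont continuous_on_compose2[OF DERIV_continuous_on[OF has_field_derivative_at_within]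
          cw subset_UNIV])
       (rule soft_step_deriv[OF e(1)])
  have int: "integrable lborel (\<lambda>t. indicator {a..b} t * (soft_step (e n) (w t) * w' t))" for n
    using borel_integrable_compact[OF compact_Icc cs] by simp
  have "(\<integral>t. indicator {a..b} t *\<^sub>R (soft_step (e n) (w t) * w' t) \<partial>lborel)
      = soft_pos (e n) (w b) - soft_pos (e n) (w a)" for n
    by (rule integral_FTC_Icc[OF \<open>a \<le> b\<close> _ cs])
      (auto simp: has_real_derivative_iff_has_vector_derivative[symmetric]
        intro!: has_field_derivative_at_within DERIV_chain2[OF soft_pos_deriv[OF e(1)]] deriv)
  then have "(\<lambda>n. soft_pos (e n) (w b) - soft_pos (e n) (w a))
      \<longlonglongrightarrow> (\<integral>t. indicator {a..b} t * ((1 + sgn (w t)) / 2 * w' t) \<partial>lborel)"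
  proof (subst (asm) eq_commute, simp only: real_scaleR_def,
      intro integral_dominated_convergence[where w = "\<lambda>t. \<bar>indicator {a..b} t * w' t\<bar>"])
    show "AE t in lborel. (\<lambda>n. indicator {a..b} t * (soft_step (e n) (w t) * w' t))
        \<longlonglongrightarrow> indicator {a..b} t * ((1 + sgn (w t)) / 2 * w' t)"
      by (intro AE_I2 tendsto_intros soft_limits e)
    show "(\<lambda>t. indicator {a..b} t * ((1 + sgn (w t)) / 2 * w' t)) \<in> borel_measurable lborel"
    proof (rule borel_measurable_LIMSEQ_real)
      show "(\<lambda>n. indicator {a..b} t * (soft_step (e n) (w t) * w' t))
        \<longlonglongrightarrow> indicator {a..b} t * ((1 + sgn (w t)) / 2 * w' t)" for t
        by (intro tendsto_intros soft_limits e)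
    qed (use int in auto)
    show "AE t in lborel. norm (indicator {a..b} t * (soft_step (e n) (w t) * w' t)) \<le> \<bar>indicator {a..b} t * w' t\<bar>" for n
      using soft_step_bounds[OF e(1)]
      by (auto simp: abs_mult indicator_def intro!: mult_left_le_one_le)
  qed (use int int' in auto)
  moreover have "(\<lambda>n. soft_pos (e n) (w b) - soft_pos (e n) (w a)) \<longlonglongrightarrow> max (w b) 0 - max (w a) 0"
    by (intro tendsto_diff soft_limits e)
  ultimately show ?thesis
    by (rule LIMSEQ_unique)
qed

text \<open>Integrates the increment for fixed \<open>x\<close> against \<open>\<psi>\<close> and
  exchanges the integrals, so that a bound on the spatial integral at each fixed time becomes a
  bound on the increment. No differentiation under the integral sign is involved.\<close>

lemma weighted_positive_part_increment:
  fixes w w' :: "'a::euclidean_space \<Rightarrow> real \<Rightarrow> real"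
  assumes ab: "a \<le> b" and K: "compact K"
    and w: "continuous_on (K \<times> {a..b}) (\<lambda>(x, t). w x t)"
    and w': "continuous_on (K \<times> {a..b}) (\<lambda>(x, t). w' x t)"
    and deriv: "\<And>x t. x \<in> K \<Longrightarrow> t \<in> {a..b} \<Longrightarrow> (w x has_real_derivative w' x t) (at t)"
    and \<psi>: "continuous_on UNIV \<psi>" "\<And>x. x \<notin> K \<Longrightarrow> \<psi> x = 0"
    and E: "\<And>t. t \<in> {a..b} \<Longrightarrow> (\<integral>x. (1 + sgn (w x t)) / 2 * (w' x t * \<psi> x) \<partial>lborel) \<le> E"
  shows "(\<integral>x. max (w x b) 0 * \<psi> x \<partial>lborel) - (\<integral>x. max (w x a) 0 * \<psi> x \<partial>lborel) \<le> E * (b - a)"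
proof -
  have slice: "continuous_on K (\<lambda>x. w x t)" if "t \<in> {a..b}" for t
    using that by (intro continuous_on_compose2[OF w, of K "\<lambda>x. (x, t)", simplified]) (auto intro!: continuous_intros)
  have pos_int: "integrable lborel (\<lambda>x. max (w x t) 0 * \<psi> x)" if "t \<in> {a..b}" for t
  proof -
    have "integrable lborel (\<lambda>x. indicator K x *\<^sub>R (max (w x t) 0 * \<psi> x))"
      by (intro borel_integrable_compact K continuous_intros slice that continuous_on_subset[OF \<psi>(1)]) auto
    moreover have "(\<lambda>x. indicator K x *\<^sub>R (max (w x t) 0 * \<psi> x)) = (\<lambda>x. max (w x t) 0 * \<psi> x)"
      using \<psi>(2) by (auto simp: indicator_def fun_eq_iff)
    ultimately show ?thesis by simp
  qed
  define g where "g p = indicator (K \<times> {a..b}) p *\<^sub>R (case p of (x, t) \<Rightarrow> w' x t * \<psi> x)" for p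
  \<comment> \<open>The sign factor is discontinuous where \<open>w\<close> vanishes. Only its Borel
    measurability and the bound 1 are needed, since the compactly supported factor \<open>g\<close>
    supplies integrability on the product. Extension by zero makes both factors global
    functions.\<close>
  define h where "h p = (1 + sgn (indicator (K \<times> {a..b}) p *\<^sub>R (case p of (x, t) \<Rightarrow> w x t))) / 2" for p
  have comp: "compact (K \<times> {a..b})"
    using K by (intro compact_Times) auto
  have "continuous_on (K \<times> {a..b}) (\<lambda>(x, t). w' x t * \<psi> x)"
    using w' by (auto simp: case_prod_unfold intro!: continuous_intros continuous_on_compose2[OF \<psi>(1)])
  then have gint: "integrable lborel g"
    unfolding g_def by (rule borel_integrable_compact[OF comp])
  have hm: "h \<in> borel_measurable lborel"
    using borel_measurable_continuous_on_indicator[OF _ w] compact_imp_closed[OF comp]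
    unfolding h_def by (auto intro!: borel_measurable_divide borel_measurable_add borel_measurable_sgn)
  have "\<bar>h p\<bar> \<le> 1" for p
    by (auto simp: h_def sgn_if)
  then have "\<bar>h p * g p\<bar> \<le> \<bar>g p\<bar>" for p
    by (simp add: abs_mult mult_left_le_one_le)
  then have "integrable lborel (\<lambda>p. h p * g p)"
    by (intro Bochner_Integration.integrable_bound[OF gint] borel_measurable_times hm)
       (use gint in auto)
  then have hg: "integrable (lborel \<Otimes>\<^sub>M lborel) (\<lambda>(x, t). h (x, t) * g (x, t))"
    by (simp add: lborel_prod case_prod_unfold)
  have eq: "h (x, t) * g (x, t) = indicator {a..b} t * ((1 + sgn (w x t)) / 2 * (w' x t * \<psi> x))" for x t
    using \<psi>(2)[of x] by (auto simp: h_def g_def indicator_def)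
  have "(\<integral>x. max (w x b) 0 * \<psi> x \<partial>lborel) - (\<integral>x. max (w x a) 0 * \<psi> x \<partial>lborel)
      = (\<integral>x. (max (w x b) 0 - max (w x a) 0) * \<psi> x \<partial>lborel)"
    using pos_int ab by (simp add: left_diff_distrib)
  also have "\<dots> = (\<integral>x. (\<integral>t. h (x, t) * g (x, t) \<partial>lborel) \<partial>lborel)"
  proof (intro Bochner_Integration.integral_cong refl)
    fix x
    show "(max (w x b) 0 - max (w x a) 0) * \<psi> x = (\<integral>t. h (x, t) * g (x, t) \<partial>lborel)"
    proof (cases "x \<in> K")
      case True
      have "continuous_on {a..b} (w' x)"
        using True by (intro continuous_on_compose2[OF w', of "{a..b}" "\<lambda>t. (x, t)", simplified]) (auto intro!: continuous_intros)
      from positive_part_increment[OF ab deriv[OF True] this]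
      have "(max (w x b) 0 - max (w x a) 0) * \<psi> x
         = (\<integral>t. indicator {a..b} t * ((1 + sgn (w x t)) / 2 * w' x t) * \<psi> x \<partial>lborel)"
        by simp
      then show ?thesis
        by (simp add: eq mult.assoc)
    qed (simp add: eq \<psi>(2))
  qed
  also have "\<dots> = (\<integral>t. (\<integral>x. h (x, t) * g (x, t) \<partial>lborel) \<partial>lborel)"
    by (rule lborel_pair.Fubini_integral[OF hg, symmetric])
  also have "\<dots> \<le> (\<integral>t. indicator {a..b} t * E \<partial>lborel)"
  proof (rule integral_mono)
    show "integrable lborel (\<lambda>t. \<integral>x. h (x, t) * g (x, t) \<partial>lborel)"
      using lborel_pair.integrable_snd[OF hg] by simp
    show "integrable lborel (\<lambda>t::real. indicator {a..b} t * E)"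
      using borel_integrable_compact[OF compact_Icc continuous_on_const[of "{a..b}" E]] by simp
    show "(\<integral>x. h (x, t) * g (x, t) \<partial>lborel) \<le> indicator {a..b} t * E" for t
      using E[of t] by (auto simp: eq indicator_def)
  qed
  also have "\<dots> = E * (b - a)"
    using ab by simp
  finally show ?thesis .
qed

subsection \<open>Radial functions and the decay of the profile\<close>

lemma C2_data_norm:
  "C2_data (punctured :: (real ^ 'n::finite) set) norm (\<lambda>i x. x $ i / norm x)
     (\<lambda>i x. 1 / norm x - (x $ i)\<^sup>2 / norm x ^ 3)"
proof -
  define g' g'' where "g' s = 1 / (2 * sqrt s)" and "g'' s = - 1 / (4 * s * sqrt s)" for s :: real
  have s: "((\<lambda>s. inverse (2 * sqrt s)) has_real_derivative - (2 * (inverse (sqrt t) / 2)) / (2 * sqrt t)^2) (at t)"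
    if "0 < t" for t
    using that by (auto intro!: derivative_eq_intros simp: field_simps power2_eq_square)
  have 1: "C2_data (punctured :: (real ^ 'n) set) (\<lambda>x. x \<bullet> x) (\<lambda>i x. 2 * x $ i) (\<lambda>i x. 2)"
    using C2_data_norm_square continuous_on_subset unfolding C2_data_def by blast
  have "C2_data (punctured :: (real ^ 'n) set) (\<lambda>x. sqrt (x \<bullet> x)) (\<lambda>i x. g' (x \<bullet> x) * (2 * x $ i))
     (\<lambda>i x. g'' (x \<bullet> x) * (2 * x $ i)\<^sup>2 + g' (x \<bullet> x) * 2)"
  proof (rule C2_data_chain[OF 1, of "{0<..}"])
    show "(sqrt has_real_derivative g' s) (at s)" if "s \<in> {0<..}" for s
      using DERIV_real_sqrt[of s] that by (simp add: g'_def field_simps)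
    show "(g' has_real_derivative g'' t) (at t)" if "t \<in> {0<..}" for t
    proof -
      have "- (2 * (inverse (sqrt t) / 2)) / (2 * sqrt t)\<^sup>2 = g'' t"
        using that by (simp add: g''_def power_mult_distrib field_simps)
      then show ?thesis
        using s[of t] that by (simp add: g'_def[abs_def] inverse_eq_divide)
    qed
    show "continuous_on {0<..} g''"
      unfolding g''_def by (intro continuous_intros) auto
  qed auto
  moreover have "(\<lambda>x :: real ^ 'n. sqrt (x \<bullet> x)) = norm"
    by (simp add: norm_eq_sqrt_inner fun_eq_iff)
  moreover have "(\<lambda>i (x :: real ^ 'n). g' (x \<bullet> x) * (2 * x $ i)) = (\<lambda>i x. x $ i / norm x)"
    by (simp add: g'_def norm_eq_sqrt_inner fun_eq_iff)
  moreover have "(\<lambda>i (x :: real ^ 'n). g'' (x \<bullet> x) * (2 * x $ i)\<^sup>2 + g' (x \<bullet> x) * 2)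
      = (\<lambda>i x. 1 / norm x - (x $ i)\<^sup>2 / norm x ^ 3)"
    by (simp add: g'_def g''_def norm_eq_sqrt_inner fun_eq_iff power3_eq_cube power2_eq_square)
  ultimately show ?thesis
    by simp
qed

text \<open>The last two clauses serve gluing: where the derivatives of the profile vanish, so do
  the partial derivatives, and a radial function can be continued by zero across the boundary of its
  support.\<close>

lemma C2_data_radial:
  fixes k k' k'' :: "real \<Rightarrow> real"
  assumes "\<And>r. 0 < r \<Longrightarrow> (k has_real_derivative k' r) (at r)"
    and "\<And>r. 0 < r \<Longrightarrow> (k' has_real_derivative k'' r) (at r)"
    and "continuous_on {0<..} k''"
  obtains g' g'' where
    "C2_data (punctured :: (real ^ 'n::finite) set) (\<lambda>x. k (norm x)) g' g''"
    "\<And>x. x \<noteq> 0 \<Longrightarrow> (\<Sum>i\<in>UNIV. g'' i x) = k'' (norm x) + (real CARD('n) - 1) / norm x * k' (norm x)"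
    "\<And>x i. x \<noteq> 0 \<Longrightarrow> k' (norm x) = 0 \<Longrightarrow> g' i x = 0"
    "\<And>x i. x \<noteq> 0 \<Longrightarrow> k' (norm x) = 0 \<Longrightarrow> k'' (norm x) = 0 \<Longrightarrow> g'' i x = 0"
proof
  let ?g' = "\<lambda>i (x :: real ^ 'n). k' (norm x) * (x $ i / norm x)"
  let ?g'' = "\<lambda>i (x :: real ^ 'n). k'' (norm x) * (x $ i / norm x)\<^sup>2
     + k' (norm x) * (1 / norm x - (x $ i)\<^sup>2 / norm x ^ 3)"
  show "C2_data punctured (\<lambda>x. k (norm x)) ?g' ?g''"
    by (rule C2_data_chain[OF C2_data_norm, of "{0<..}"]) (use assms in auto)
  show "(\<Sum>i\<in>UNIV. ?g'' i x) = k'' (norm x) + (real CARD('n) - 1) / norm x * k' (norm x)"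
    if "x \<noteq> 0" for x
  proof -
    have n: "norm x \<noteq> 0" using that by simp
    have sq: "(\<Sum>i\<in>UNIV. (x $ i)\<^sup>2) = (norm x)\<^sup>2"
      by (simp add: norm_vec_def L2_set_def sum_nonneg)
    have "?g'' i x = (k'' (norm x) / (norm x)\<^sup>2 - k' (norm x) / norm x ^ 3) * (x $ i)\<^sup>2 + k' (norm x) / norm x" for i
      by (simp add: power_divide algebra_simps)
    then have "(\<Sum>i\<in>UNIV. ?g'' i x) = (\<Sum>i\<in>UNIV. (k'' (norm x) / (norm x)\<^sup>2 - k' (norm x) / norm x ^ 3) * (x $ i)\<^sup>2
         + k' (norm x) / norm x)"
      by (intro sum.cong refl)
    also have "\<dots> = (k'' (norm x) / (norm x)\<^sup>2 - k' (norm x) / norm x ^ 3) * (norm x)\<^sup>2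
       + real CARD('n) * (k' (norm x) / norm x)"
      by (simp add: sum.distrib sum_distrib_left[symmetric] sq)
    also have "\<dots> = k'' (norm x) + (real CARD('n) - 1) / norm x * k' (norm x)"
      using n by (simp add: field_simps power2_eq_square power3_eq_cube)
    finally show ?thesis .
  qed
qed auto

text \<open>In radial form the profile equation says that \<open>G = r\<^sup>j (k\<^sup>m / m)'\<close> satisfies
  \<open>G' = -\<beta> r\<^sup>j (\<gamma> k + r k')\<close>, where \<open>j\<close> is the dimension minus one and \<open>b = -\<beta>\<close>.\<close>

locale radial_profile =
  fixes k k' p p' :: "real \<Rightarrow> real" and b \<gamma> m :: real and j :: nat
  assumes b: "0 < b" and \<gamma>: "0 < \<gamma>" and m: "m < 1"
    and pos: "\<And>r. 0 < r \<Longrightarrow> 0 < k r"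
    and k': "\<And>r. 0 < r \<Longrightarrow> (k has_real_derivative k' r) (at r)"
    and p: "\<And>r. 0 < r \<Longrightarrow> p r = k r powr (m - 1) * k' r"
    and p': "\<And>r. 0 < r \<Longrightarrow> (p has_real_derivative p' r) (at r)"
    and ode: "\<And>r. 0 < r \<Longrightarrow> p' r + real j / r * p r = b * (\<gamma> * k r + r * k' r)"
begin

definition G :: "real \<Rightarrow> real" where "G r = r ^ j * p r"

lemma G_deriv:
  assumes "0 < r"
  shows "(G has_real_derivative b * r ^ j * (\<gamma> * k r + r * k' r)) (at r)"
proof -
  have "(G has_real_derivative real j * r ^ (j - Suc 0) * p r + p' r * r ^ j) (at r)"
    unfolding G_def[abs_def] using assms by (auto intro!: derivative_eq_intros p')
  also have "real j * r ^ (j - Suc 0) * p r + p' r * r ^ j = r ^ j * (p' r + real j / r * p r)"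
    using assms by (cases j) (auto simp: field_simps)
  also have "\<dots> = b * r ^ j * (\<gamma> * k r + r * k' r)"
    by (subst ode[OF assms]) simp
  finally show ?thesis .
qed

lemma G_sign: "0 < r \<Longrightarrow> 0 \<le> G r \<longleftrightarrow> 0 \<le> k' r"
proof -
  assume "0 < r"
  then have "0 < r ^ j * k r powr (m - 1)" "G r = r ^ j * k r powr (m - 1) * k' r"
    using pos[of r] by (auto simp: G_def p)
  then show ?thesis
    by (metis mult_nonneg_nonneg less_imp_le not_le mult_pos_neg)
qed

text \<open>Otherwise consider the last point \<open>s\<close> before \<open>r\<close> with
  \<open>G s \<ge> 0\<close>. There \<open>k' s \<ge> 0\<close>, hence the derivative of
  \<open>G\<close> is strictly positive because of the term \<open>\<gamma> * k s\<close>, and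
  \<open>G\<close> stays nonnegative slightly beyond \<open>s\<close>.\<close>

lemma increasing_forever:
  assumes "0 < a" "0 \<le> k' a" "a \<le> r"
  shows "0 \<le> k' r"
proof (rule ccontr)
  assume neg: "\<not> 0 \<le> k' r"
  define S where "S = {x \<in> {a..r}. 0 \<le> G x}"
  have cont: "continuous_on {a..r} G"
    using assms by (intro DERIV_continuous_on[OF has_field_derivative_at_within[OF G_deriv]]) auto
  have "closed S"
    unfolding S_def using continuous_on_closed_Collect_le[OF continuous_on_const cont] by auto
  then have "compact S"
    by (metis (no_types, lifting) S_def compact_Icc compact_Int_closed inf.absorb2 mem_Collect_eq subsetI)
  moreover have "a \<in> S"
    using assms G_sign[of a] by (auto simp: S_def)
  ultimately obtain s where s: "s \<in> S" "\<And>x. x \<in> S \<Longrightarrow> x \<le> s"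
    using compact_attains_sup[of S] by auto
  have s0: "0 < s" "a \<le> s" "s \<le> r" "0 \<le> G s"
    using s(1) assms by (auto simp: S_def)
  have "s \<noteq> r"
    using s0 neg G_sign[of r] by auto
  have "0 < b * s ^ j * (\<gamma> * k s + s * k' s)"
    using s0 G_sign[of s] b \<gamma> pos[of s] by (intro mult_pos_pos add_pos_nonneg) auto
  then obtain d where d: "0 < d" "\<And>h. 0 < h \<Longrightarrow> h < d \<Longrightarrow> G s < G (s + h)"
    using DERIV_pos_inc_right[OF G_deriv[OF s0(1)]] by auto
  define h where "h = min (d / 2) (r - s)"
  have h: "0 < h" "h < d" "s + h \<le> r"
    using d(1) s0 \<open>s \<noteq> r\<close> by (auto simp: h_def)
  then have "s + h \<in> S"
    using d(2)[of h] s0 by (auto simp: S_def)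
  then show False
    using s(2)[of "s + h"] h by simp
qed

text \<open>If \<open>k\<close> ever increases, then \<open>G\<close> eventually dominates a multiple of \<open>r\<^sup>j\<^sup>+\<^sup>1 k\<close>; hence
  \<open>k\<^bsup>m-1\<^esup>\<close> falls at least linearly and becomes negative.\<close>

lemma not_increasing:
  assumes a: "0 < a"
  shows "k' a < 0"
proof (rule ccontr)
  assume "\<not> k' a < 0"
  then have k'_nonneg: "0 \<le> k' r" if "a \<le> r" for r
    using increasing_forever[OF a] that by simp
  have k_mono: "k a \<le> k r" if "a \<le> r" for r
    using a k' k'_nonneg
    by (intro DERIV_nonneg_imp_nondecreasing[OF that]) (meson less_le_trans)
  \<comment> \<open>The largest value for which both coefficients in the derivative of
    \<open>J\<close> are nonnegative, namely theta <= b and theta (j + 1) <= b gamma.\<close>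
  define \<theta> where "\<theta> = b * min 1 (\<gamma> / real (Suc j))"
  have "\<theta> \<le> b * (\<gamma> / real (Suc j))"
    unfolding \<theta>_def using b by (intro mult_left_mono) auto
  then have \<theta>: "0 < \<theta>" "\<theta> \<le> b" "\<theta> * real (Suc j) \<le> b * \<gamma>"
    using b \<gamma> by (auto simp: \<theta>_def pos_le_divide_eq)
  define J where "J r = G r - \<theta> * (r ^ Suc j * k r)" for r
  have J_deriv: "(J has_real_derivative r ^ j * k r * (b * \<gamma> - \<theta> * real (Suc j)) + r ^ Suc j * k' r * (b - \<theta>)) (at r)"
    if "0 < r" for r
    unfolding J_def[abs_def]
    by (rule derivative_eq_intros G_deriv k' refl that)+ (simp add: algebra_simps)
  have J_mono: "J a \<le> J r" if "a \<le> r" for r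
  proof (rule DERIV_nonneg_imp_nondecreasing[OF that])
    fix x assume x: "a \<le> x" "x \<le> r"
    have "0 \<le> x ^ j * k x * (b * \<gamma> - \<theta> * real (Suc j)) + x ^ Suc j * k' x * (b - \<theta>)"
      using x a \<theta> k'_nonneg[of x] pos[of x] by (intro add_nonneg_nonneg mult_nonneg_nonneg) auto
    then show "\<exists>y. DERIV J x :> y \<and> 0 \<le> y"
      using J_deriv[of x] x a by auto
  qed
  define C where "C = - J a"
  \<comment> \<open>Beyond \<open>s\<close> the constant \<open>C\<close> is at most half of
    \<open>\<theta> * (r ^ Suc j * k r)\<close>, so \<open>G\<close> retains the other half. The
    bound \<open>1 \<le> s\<close> lets r^(j+1) dominate r and lets a factor r be dropped
    later.\<close>
  define s where "s = max (max a 1) (2 * C / (\<theta> * k a))"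
  have s: "a \<le> s" "1 \<le> s" "2 * C / (\<theta> * k a) \<le> s"
    by (auto simp: s_def)
  define c where "c = (1 - m) * \<theta> / 2"
  have c: "0 < c"
    using m \<theta> by (simp add: c_def)
  \<comment> \<open>That \<open>y\<close> is nonincreasing expresses that k^(m-1) falls with slope
    at most -c.\<close>
  define y where "y r = k r powr (m - 1) + c * r" for r
  have y_deriv: "(y has_real_derivative (m - 1) * k r powr (m - 2) * k' r + c) (at r)" if "0 < r" for r
  proof -
    have "((\<lambda>r. k r powr (m - 1)) has_real_derivative ((m - 1) * k r powr (m - 1 - 1)) * k' r) (at r)"
      by (rule DERIV_chain2[OF has_real_derivative_powr k']) (use pos that in auto)
    from DERIV_add[OF this DERIV_cmult_Id[of c]] show ?thesis
      by (simp add: y_def[abs_def])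
  qed
  have y_mono: "y r \<le> y s" if "s \<le> r" for r
  proof (rule DERIV_nonpos_imp_nonincreasing[OF that])
    fix x assume x: "s \<le> x" "x \<le> r"
    have x0: "0 < x" "1 \<le> x" "a \<le> x" and kx: "0 < k x"
      using x s a pos[of x] by auto
    have "2 * C \<le> \<theta> * k a * s"
      using s(3) \<theta>(1) pos[OF a] by (simp add: divide_le_eq mult.commute)
    also have "\<dots> \<le> \<theta> * k x * x"
      using x s k_mono[OF x0(3)] \<theta>(1) pos[OF a] by (intro mult_mono) auto
    also have "\<dots> \<le> \<theta> * k x * x ^ Suc j"
      using x0 \<theta>(1) kx power_increasing[of 1 "Suc j" x] by (intro mult_left_mono) auto
    finally have "2 * C \<le> \<theta> * (x ^ Suc j * k x)"
      by (simp add: mult.assoc mult.commute[of "k x"])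
    moreover have "\<theta> * (x ^ Suc j * k x) - C \<le> G x"
      using J_mono[OF x0(3)] by (simp add: J_def C_def)
    ultimately have "x ^ j * (\<theta> / 2 * x * k x) \<le> x ^ j * p x"
      by (simp add: G_def algebra_simps)
    then have "\<theta> / 2 * x * k x \<le> p x"
      using x0 by (simp add: mult_le_cancel_left)
    moreover have "\<theta> / 2 * k x \<le> \<theta> / 2 * x * k x"
      using x0 kx \<theta>(1) by simp
    ultimately have "\<theta> / 2 * k x \<le> k x powr (m - 1) * k' x"
      using p[OF x0(1)] by simp
    also have "k x powr (m - 1) = k x powr (m - 2) * k x"
      using powr_add[of "k x" "m - 2" 1] kx by simp
    finally have "\<theta> / 2 * k x \<le> (k x powr (m - 2) * k' x) * k x"
      by (simp add: mult_ac)
    then have "\<theta> / 2 \<le> k x powr (m - 2) * k' x"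
      using kx by (metis mult_le_cancel_right not_less_iff_gr_or_eq)
    then have "(1 - m) * (\<theta> / 2) \<le> (1 - m) * (k x powr (m - 2) * k' x)"
      using m by (intro mult_left_mono) auto
    then have "(m - 1) * k x powr (m - 2) * k' x + c \<le> 0"
      by (simp add: c_def algebra_simps)
    then show "\<exists>d. DERIV y x :> d \<and> d \<le> 0"
      using y_deriv[OF x0(1)] by auto
  qed
  \<comment> \<open>The zero of the line of slope -c that starts at height k(s)^(m-1) over
    \<open>s\<close>.\<close>
  define r where "r = s + k s powr (m - 1) / c"
  have "s \<le> r" "0 < r"
    using c s by (auto simp: r_def intro!: add_pos_nonneg)
  have "c * r = c * s + k s powr (m - 1)"
    using c by (simp add: r_def distrib_left)
  then have "k r powr (m - 1) \<le> 0"
    using y_mono[OF \<open>s \<le> r\<close>] by (simp add: y_def)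
  then show False
    using pos[OF \<open>0 < r\<close>] by simp
qed

text \<open>If the decreasing function \<open>k\<close> had a limit \<open>L > 0\<close>, then \<open>G\<close>, which is negative, would grow
  like \<open>b (\<gamma> / (j + 1)) L r\<^sup>j\<^sup>+\<^sup>1\<close>.\<close>

lemma tends_to_0: "(k \<longlongrightarrow> 0) at_top"
proof (rule ccontr)
  have anti: "k y \<le> k x" if "0 < x" "x \<le> y" for x y
    using that(1) k' not_increasing
    by (intro DERIV_nonpos_imp_nonincreasing[OF that(2)]) (meson less_le_trans less_imp_le)
  assume not: "\<not> (k \<longlongrightarrow> 0) at_top"
  have "\<exists>e>0. \<forall>r>0. e \<le> k r"
  proof (rule ccontr)
    assume "\<not> ?thesis"
    then have small: "\<exists>r>0. k r < e" if "0 < e" for e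
      using that by (meson not_le)
    have "(k \<longlongrightarrow> 0) at_top"
    proof (rule tendstoI)
      fix e :: real assume "0 < e"
      then obtain r where r: "0 < r" "k r < e"
        using small by auto
      show "eventually (\<lambda>x. dist (k x) 0 < e) at_top"
        using eventually_ge_at_top[of r]
      proof eventually_elim
        case (elim x)
        then show ?case
          using anti[OF r(1) elim] r pos[of x] by simp
      qed
    qed
    then show False using not by simp
  qed
  then obtain e where e: "0 < e" "\<And>r. 0 < r \<Longrightarrow> e \<le> k r"
    by auto
  define L where "L = Inf (k ` {0<..})"
  have bdd: "bdd_below (k ` {0<..})"
    using e(2) by (auto intro!: bdd_belowI[of _ e])
  have L: "L \<le> k r" if "0 < r" for r
    unfolding L_def using that bdd by (intro cInf_lower) auto
  have "e \<le> L"
    unfolding L_def using e(2) by (intro cInf_greatest) auto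
  then have L0: "0 < L" using e by simp
  \<comment> \<open>The derivative of \<open>J\<close> is b r^j times (gamma - (j+1)) k + (j+1) d
    L'. If gamma < j + 1 the first summand is negative, and this \<open>d\<close> is the least one
    compensating it for all k <= L'; otherwise nothing has to be compensated and d = 0.\<close>
  define d where "d = max (1 - \<gamma> / real (Suc j)) 0"
  have "real (Suc j) * (1 - \<gamma> / real (Suc j)) \<le> real (Suc j) * d"
    by (intro mult_left_mono) (auto simp: d_def)
  then have d: "0 \<le> d" "d < 1" "real (Suc j) - \<gamma> \<le> real (Suc j) * d"
    using \<gamma> by (auto simp: d_def right_diff_distrib)
  \<comment> \<open>Chosen strictly above \<open>L\<close> and with d L' < L, which is possible
    because d < 1. The first property provides a point \<open>a\<close> with
    \<open>k a < L'\<close>, the second makes the growth constant \<open>\<delta>\<close>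
    positive.\<close>
  define L' where "L' = 2 * L / (1 + d)"
  have L': "L < L'" "d * L' < L"
    using d L0 by (auto simp: L'_def field_simps)
  have "\<exists>y\<in>k ` {0<..}. y < L'"
    using L' bdd cInf_less_iff[of "k ` {0<..}" L'] by (auto simp: L_def)
  then obtain a where a: "0 < a" "k a < L'"
    by auto
  define J where "J r = G r - b * (r ^ Suc j * k r) + b * (d * L' * r ^ Suc j)" for r
  have J_deriv: "(J has_real_derivative b * r ^ j * ((\<gamma> - real (Suc j)) * k r + real (Suc j) * d * L')) (at r)"
    if "0 < r" for r
    unfolding J_def[abs_def]
    by (rule derivative_eq_intros G_deriv k' refl that)+ (simp add: algebra_simps)
  have J_mono: "J a \<le> J r" if "a \<le> r" for r
  proof (rule DERIV_nonneg_imp_nondecreasing[OF that])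
    fix x assume x: "a \<le> x" "x \<le> r"
    have "(real (Suc j) - \<gamma>) * k x \<le> real (Suc j) * d * k x"
      using x a pos[of x] d(3) by (intro mult_right_mono) auto
    also have "\<dots> \<le> real (Suc j) * d * L'"
      using anti[of a x] x a d by (intro mult_left_mono) auto
    finally have "0 \<le> (\<gamma> - real (Suc j)) * k x + real (Suc j) * d * L'"
      by (simp add: algebra_simps)
    then have "0 \<le> b * x ^ j * ((\<gamma> - real (Suc j)) * k x + real (Suc j) * d * L')"
      using x a b by (intro mult_nonneg_nonneg) auto
    then show "\<exists>y. DERIV J x :> y \<and> 0 \<le> y"
      using J_deriv[of x] x a by auto
  qed
  define \<delta> where "\<delta> = b * (L - d * L')"
  have \<delta>: "0 < \<delta>"
    using b L' by (simp add: \<delta>_def)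
  have ub: "\<delta> * r ^ Suc j \<le> - J a" if "a \<le> r" for r
  proof -
    have "0 < r" using that a by simp
    have "\<not> 0 \<le> G r"
      using not_increasing[OF \<open>0 < r\<close>] G_sign[OF \<open>0 < r\<close>] by simp
    moreover have "r ^ Suc j * L \<le> r ^ Suc j * k r"
      using L[OF \<open>0 < r\<close>] \<open>0 < r\<close> by (intro mult_left_mono) auto
    then have "b * (r ^ Suc j * L) \<le> b * (r ^ Suc j * k r)"
      using b by (rule mult_left_mono[OF _ less_imp_le])
    ultimately show ?thesis
      using J_mono[OF that] by (simp add: J_def \<delta>_def algebra_simps)
  qed
  define r where "r = max (max a 1) (- J a / \<delta> + 1)"
  have r: "a \<le> r" "1 \<le> r" "- J a / \<delta> < r"
    by (auto simp: r_def)
  have "- J a < \<delta> * r"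
    using r(3) pos_divide_less_eq[OF \<delta>] by (metis mult.commute)
  also have "\<dots> \<le> \<delta> * r ^ Suc j"
    using r \<delta> power_increasing[of 1 "Suc j" r] by (intro mult_left_mono) auto
  finally show False
    using ub[OF r(1)] by simp
qed

end

lemma radially_symmetric_eq:
  assumes "radially_symmetric f"
  shows "f x = f (norm x *\<^sub>R axis i 1)"
proof -
  have "norm x = norm (norm x *\<^sub>R (axis i 1 :: real ^ 'a))"
    by simp
  then show ?thesis
    using assms unfolding radially_symmetric_def by blast
qed

text \<open>On the ray through a coordinate vector the partial derivative in that direction is the
  radial derivative, so radial symmetry turns the elliptic equation into the ordinary one of
  \<open>radial_profile\<close>, with \<open>- \<beta>\<close> in the role of the positive
  constant.\<close>

lemma profile_tends_to_0:
  fixes f :: "real ^ 'n::finite \<Rightarrow> real"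
  assumes f: "is_profile m \<alpha> \<beta> l f" and par: "0 < m" "m < 1" "\<beta> < 0" "0 < \<alpha> / \<beta>"
  shows "((\<lambda>r. f (r *\<^sub>R axis i 1)) \<longlongrightarrow> 0) at_top"
proof -
  define e :: "real ^ 'n" where "e = axis i 1"
  define k where "k r = f (r *\<^sub>R e)" for r
  define k' where "k' r = partial_deriv i f (r *\<^sub>R e)" for r
  define k'' where "k'' r = partial_deriv i (partial_deriv i f) (r *\<^sub>R e)" for r
  have e: "norm e = 1" "r *\<^sub>R e \<in> punctured" if "0 < r" for r
    using that by (auto simp: e_def axis_eq_0_iff)
  have pos: "0 < k r" if "0 < r" for r
    using f e[OF that] by (auto simp: is_profile_def k_def)
  have C2: "C2_data punctured f (\<lambda>i. partial_deriv i f) (\<lambda>i. partial_deriv i (partial_deriv i f))"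
    using f by (intro C_k_on_2_imp_C2_data) (auto simp: is_profile_def)
  have k': "(k has_real_derivative k' r) (at r)" if "0 < r" for r
    using has_partial_at[of i f "k' r" 0 r] C2 e[OF that]
    by (auto simp: C2_data_def k_def[abs_def] k'_def e_def)
  have k'': "(k' has_real_derivative k'' r) (at r)" if "0 < r" for r
    using has_partial_at[of i "partial_deriv i f" "k'' r" 0 r] C2 e[OF that]
    by (auto simp: C2_data_def k''_def k'_def[abs_def] e_def)
  have ck'': "continuous_on {0<..} k''"
    unfolding k''_def
    by (rule continuous_on_compose2[OF C2_data_continuous(3)[OF C2]]) (auto intro!: continuous_intros e)
  define p where "p r = k r powr (m - 1) * k' r" for r
  define p' where "p' r = (m - 1) * k r powr (m - 1 - 1) * k' r * k' r + k'' r * k r powr (m - 1)" for r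
  have powr_deriv: "((\<lambda>r. k r powr q) has_real_derivative q * k r powr (q - 1) * k' r) (at r)"
    if "0 < r" for r q
    by (rule DERIV_chain2[OF has_real_derivative_powr k']) (use pos that in auto)
  have F: "((\<lambda>r. k r powr m / m) has_real_derivative p r) (at r)" if "0 < r" for r
    using DERIV_cdivide[OF powr_deriv[OF that, of m], of m] par by (simp add: p_def)
  have p': "(p has_real_derivative p' r) (at r)" if "0 < r" for r
    unfolding p_def[abs_def] p'_def by (rule DERIV_mult[OF powr_deriv k''] that)+
  have kc: "continuous_on {0<..} k" "continuous_on {0<..} k'"
    using DERIV_isCont[OF k'] DERIV_isCont[OF k''] by (simp_all add: continuous_at_imp_continuous_on)
  have cp': "continuous_on {0<..} p'"
    unfolding p'_def by (intro continuous_intros kc ck'') (use pos in force)+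
  obtain g' g'' where g: "C2_data (punctured :: (real ^ 'n) set) (\<lambda>x. k (norm x) powr m / m) g' g''"
    "\<And>x. x \<noteq> 0 \<Longrightarrow> (\<Sum>i\<in>UNIV. g'' i x) = p' (norm x) + (real CARD('n) - 1) / norm x * p (norm x)"
    by (rule C2_data_radial[OF F p' cp', where 'n = 'n]) (assumption, assumption, rule that)
  have fk: "f y = k (norm y)" for y
    using f radially_symmetric_eq[of f y i] by (simp add: k_def e_def is_profile_def)
  have lap: "laplacian (\<lambda>y. f y powr m / m) (r *\<^sub>R e) = p' r + (real CARD('n) - 1) / r * p r" if "0 < r" for r
    using C2_data_laplacian[OF g(1) open_delete[OF open_UNIV] e(2)[OF that]] g(2)[of "r *\<^sub>R e"] e[OF that] that
    by (simp add: fk)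
  have grad: "(r *\<^sub>R e) \<bullet> gradient f (r *\<^sub>R e) = r * k' r" for r
    by (simp add: gradient_def k'_def e_def inner_axis' )
  have "radial_profile k k' p p' (- \<beta>) (\<alpha> / \<beta>) m (CARD('n) - 1)"
  proof
    show "p' r + real (CARD('n) - 1) / r * p r = - \<beta> * (\<alpha> / \<beta> * k r + r * k' r)" if "0 < r" for r
    proof -
      have "laplacian (\<lambda>y. f y powr m / m) (r *\<^sub>R e) + \<alpha> * k r + \<beta> * (r * k' r) = 0"
        using f e(2)[OF that] unfolding is_profile_def k_def grad[symmetric] by blast
      then show ?thesis
        using lap[OF that] par by (simp add: of_nat_diff Suc_leI algebra_simps)
    qed
  qed (use par pos k' p' in \<open>auto simp: p_def\<close>)
  from radial_profile.tends_to_0[OF this] show ?thesis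
    by (simp add: k_def[abs_def] e_def)
qed

subsection \<open>The weight as a concave function of a harmonic function\<close>

text \<open>The integral over \<open>{0..x}\<close> is 0 for negative \<open>x\<close>. As
  \<open>g\<close> vanishes there too, the lower endpoint can be moved to a point left of both 0 and
  \<open>x\<close>, which gives the two-sided derivative also at and below 0.\<close>

lemma LBINT_has_derivative:
  fixes g :: "real \<Rightarrow> real"
  assumes cont: "continuous_on UNIV g" and zero: "\<And>x. x \<le> 0 \<Longrightarrow> g x = 0"
  shows "((\<lambda>x. LBINT s:{0..x}. g s) has_real_derivative g x) (at x)"
proof -
  define a where "a = min 0 x - 1"
  have a: "a < x" "a \<le> 0" by (auto simp: a_def)
  have "((\<lambda>y. integral {a..y} g) has_real_derivative g x) (at x within {a..x + 1})"
    using a by (intro integral_has_real_derivative continuous_on_subset[OF cont]) auto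
  then have "((\<lambda>y. integral {a..y} g) has_real_derivative g x) (at x)"
    using a by (simp add: at_within_Icc_at)
  moreover have "integral {a..y} g = (LBINT s:{0..y}. g s)" if "y \<in> {a<..}" for y
  proof -
    have "set_integrable lborel {a..y} g"
      by (rule borel_integrable_atLeastAtMost') (intro continuous_on_subset[OF cont] subset_UNIV)
    then have "integral {a..y} g = (LBINT s:{a..y}. g s)"
      by (simp add: set_borel_integral_eq_integral)
    also have "\<dots> = (LBINT s:{0..y}. g s)"
      unfolding set_lebesgue_integral_def
      using a zero by (intro Bochner_Integration.integral_cong) (auto simp: indicator_def)
    finally show ?thesis .
  qed
  ultimately show ?thesis
    using has_field_derivative_transform_within_open[of "\<lambda>y. integral {a..y} g" "g x" x "{a<..}"] a
    by auto
qed

lemma integral_atLeast_eq_limit: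
  fixes f F :: "real \<Rightarrow> real"
  assumes "continuous_on UNIV f" "\<And>x. a \<le> x \<Longrightarrow> DERIV F x :> f x" "\<And>x. a \<le> x \<Longrightarrow> 0 \<le> f x"
    "(F \<longlongrightarrow> T) at_top" "F a \<le> T"
  shows "(LBINT x:{a..}. f x) = T - F a"
proof -
  have "(\<integral>\<^sup>+x. ennreal (f x) * indicator {a..} x \<partial>lborel) = T - F a"
    by (rule nn_integral_FTC_atLeast) (use assms in \<open>auto intro: borel_measurable_continuous_onI\<close>)
  moreover have "ennreal (f x) * indicator {a..} x = ennreal (indicator {a..} x * f x)" for x
    by (auto simp: indicator_def)
  moreover have "f \<in> borel_measurable borel"
    using assms(1) by (rule borel_measurable_continuous_onI)
  then have "(LBINT x:{a..}. f x) = enn2real (\<integral>\<^sup>+x. ennreal (indicator {a..} x * f x) \<partial>lborel)"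
    unfolding set_lebesgue_integral_def real_scaleR_def
    using assms by (intro integral_eq_nn_integral) (auto simp: indicator_def)
  ultimately show ?thesis
    using assms by simp
qed

text \<open>Let r = s^(-1/q) with q = n - 2. Differentiating 1 - W(r)/T in s produces w(r) r^(q+1) /
  (q T), and the power r^(n-1) cancels the one in the slope w, leaving M(r) / (q T). Since M is
  nondecreasing and r decreases in s, this is nonincreasing: hence concavity. It vanishes for s >= 1
  because eta vanishes on [0, 1], and the limit at 0 is 0 because W tends to T.\<close>

lemma weight_concave_profile:
  fixes \<phi> :: "real ^ 'n::finite \<Rightarrow> real"
  assumes w: "is_weight \<mu> \<phi>" and n: "3 \<le> CARD('n)" and \<mu>: "0 < \<mu>" "\<mu> < real CARD('n) - 2"
  obtains \<Phi> \<Phi>' \<Phi>'' :: "real \<Rightarrow> real" where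
    "\<And>x. x \<noteq> 0 \<Longrightarrow> \<phi> x = \<Phi> (norm x powr - (real CARD('n) - 2))"
    "\<And>s. 0 < s \<Longrightarrow> (\<Phi> has_real_derivative \<Phi>' s) (at s)"
    "\<And>s. 0 < s \<Longrightarrow> (\<Phi>' has_real_derivative \<Phi>'' s) (at s)"
    "continuous_on {0<..} \<Phi>''"
    "\<And>s. 0 < s \<Longrightarrow> 0 \<le> \<Phi>' s" "\<And>s. 0 < s \<Longrightarrow> \<Phi>'' s \<le> 0" "\<And>s. 1 \<le> s \<Longrightarrow> \<Phi>' s = 0"
    "(\<Phi> \<longlongrightarrow> 0) (at_right 0)" "\<And>s. 0 < s \<Longrightarrow> \<Phi> s \<le> 1"
proof -
  define n where "n = CARD('n)"
  define q where "q = real n - 2"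
  have q: "1 \<le> q" "0 < q" "\<mu> < q" and n3: "3 \<le> n" "real n = q + 2" and n2: "n - Suc 0 = Suc (n - 2)"
    using n \<mu> by (auto simp: q_def n_def)
  from w obtain \<eta> where \<eta>: "is_weight_source TYPE('n) \<mu> \<eta>" and \<phi>: "\<phi> = weight_of \<eta>"
    by (auto simp: is_weight_def)
  have \<eta>_nonneg: "0 \<le> \<eta> r" if "0 \<le> r" for r
    using \<eta> that by (auto simp: is_weight_source_def)
  have \<eta>_0: "\<eta> r = 0" if "0 \<le> r" "r \<le> 1" for r
    using \<eta> that by (auto simp: is_weight_source_def)
  have \<eta>_tail: "\<eta> r = \<mu> * (q - \<mu>) * r powr (- \<mu> - 2)" if "2 \<le> r" for r
    using \<eta> that by (auto simp: is_weight_source_def q_def n_def)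
  have \<eta>_cont: "continuous_on {0..} \<eta>"
  proof -
    have "C_k_on 0 UNIV (\<lambda>x :: real ^ 'n. \<eta> (norm x))"
      using \<eta> unfolding is_weight_source_def smooth_fun_def by blast
    then have "continuous_on {0..} (\<lambda>r. \<eta> (norm (r *\<^sub>R axis undefined 1 :: real ^ 'n)))"
      by (intro continuous_on_compose2[of UNIV "\<lambda>x :: real ^ 'n. \<eta> (norm x)" "{0..}"
            "\<lambda>r. r *\<^sub>R axis undefined 1"]) (auto intro!: continuous_intros)
    then show ?thesis
      by (subst (asm) continuous_on_cong[OF refl, of _ _ \<eta>]) auto
  qed
  \<comment> \<open>On the half line this is the integrand in \<open>weight_slope\<close>. The
    explicit zero discards the values of \<open>\<eta>\<close> at negative arguments and makes the
    function continuous on the whole line.\<close>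
  define g where "g r = (if r \<le> 1 then 0 else r ^ (n - 1) * \<eta> r)" for r
  define M where "M r = (LBINT s:{0..r}. g s)" for r
  have g_cont: "continuous_on UNIV g"
  proof -
    have "continuous_on ({..1} \<union> {1..}) g"
      unfolding g_def
      by (intro continuous_on_cases continuous_intros continuous_on_subset[OF \<eta>_cont]) (auto simp: \<eta>_0)
    moreover have "{..1} \<union> {1..} = (UNIV :: real set)" by auto
    ultimately show ?thesis by simp
  qed
  have M': "(M has_real_derivative g r) (at r)" for r
    unfolding M_def[abs_def] by (rule LBINT_has_derivative[OF g_cont]) (simp add: g_def)
  have g_nonneg: "0 \<le> g r" for r
    using \<eta>_nonneg by (simp add: g_def)
  have M_mono: "M r \<le> M s" if "r \<le> s" for r s
    using that M' g_nonneg by (intro DERIV_nonneg_imp_nondecreasing[OF that]) blast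
  have M_0: "M r = 0" if "r \<le> 1" for r
  proof -
    have "M r = (LBINT s:{0..r}. 0)"
      unfolding M_def using that by (intro set_lebesgue_integral_cong) (auto simp: g_def)
    then show ?thesis by (simp add: set_lebesgue_integral_def)
  qed
  have M_nonneg: "0 \<le> M r" for r
    using M_mono[of 1 r] M_0 by (cases "r \<le> 1") auto
  \<comment> \<open>\<open>M\<close> vanishes up to 1, so the zero branch changes no value; it
    removes the quotient 0/0 at the origin.\<close>
  define w where "w s = (if s \<le> 1 then 0 else M s / s ^ (n - 1))" for s
  define W where "W r = (LBINT s:{0..r}. w s)" for r
  have w_slope: "weight_slope n \<eta> s = w s" for s
  proof -
    have "(LBINT \<rho>:{0..s}. \<rho> ^ (n - 1) * \<eta> \<rho>) = M s"
      unfolding M_def by (intro set_lebesgue_integral_cong) (auto simp: g_def \<eta>_0)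
    then show ?thesis
      using M_0[of s] by (auto simp: weight_slope_def w_def)
  qed
  have M_cont: "continuous_on UNIV M"
    using DERIV_isCont[OF M'] by (simp add: continuous_at_imp_continuous_on)
  have w_cont: "continuous_on UNIV w"
  proof -
    have "continuous_on ({..1} \<union> {1..}) w"
      unfolding w_def
      by (intro continuous_on_cases continuous_intros continuous_on_subset[OF M_cont]) (auto simp: M_0)
    moreover have "{..1} \<union> {1..} = (UNIV :: real set)" by auto
    ultimately show ?thesis by simp
  qed
  have W': "(W has_real_derivative w r) (at r)" for r
    unfolding W_def[abs_def] by (rule LBINT_has_derivative[OF w_cont]) (simp add: w_def)
  have w_nonneg: "0 \<le> w r" for r
    using M_nonneg by (simp add: w_def)
  have W_mono: "W r \<le> W s" if "r \<le> s" for r s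
    using that W' w_nonneg by (intro DERIV_nonneg_imp_nondecreasing[OF that]) blast
  have W_0: "W r = 0" if "r \<le> 1" for r
  proof -
    have "W r = (LBINT s:{0..r}. 0)"
      unfolding W_def using that by (intro set_lebesgue_integral_cong) (auto simp: w_def)
    then show ?thesis by (simp add: set_lebesgue_integral_def)
  qed
  \<comment> \<open>A common decay exponent. The slope has one part of order r^(-mu-1) and one of
    order r^(-q-1), and both are at most r^(-epsilon-1) since epsilon <= mu and epsilon <= 1 <=
    q.\<close>
  define \<epsilon> where "\<epsilon> = min \<mu> 1"
  have \<epsilon>: "0 < \<epsilon>" "\<epsilon> \<le> \<mu>" "\<epsilon> \<le> 1"
    using \<mu> by (auto simp: \<epsilon>_def)
  have powr_nat: "r ^ (n - 1) = r powr (q + 1)" if "0 < r" for r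
    using that n3 powr_realpow[of r "n - 1"] by (simp add: of_nat_diff add.commute)
  have M_bound: "M r \<le> \<mu> * r powr (q - \<mu>) + M 2" if "2 \<le> r" for r
  proof -
    have "M r - \<mu> * r powr (q - \<mu>) \<le> M 2 - \<mu> * 2 powr (q - \<mu>)"
    proof (rule DERIV_nonpos_imp_nonincreasing[OF that])
      fix x :: real assume x: "2 \<le> x" "x \<le> r"
      have "((\<lambda>x. M x - \<mu> * x powr (q - \<mu>)) has_real_derivative g x - \<mu> * ((q - \<mu>) * x powr (q - \<mu> - 1))) (at x)"
        using x by (intro DERIV_diff M' DERIV_cmult has_real_derivative_powr) auto
      moreover have "x powr (q + 1) * x powr (- \<mu> - 2) = x powr (q - \<mu> - 1)"
        by (simp add: powr_add[symmetric] algebra_simps)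
      then have "g x = \<mu> * ((q - \<mu>) * x powr (q - \<mu> - 1))"
        using x by (simp add: g_def \<eta>_tail powr_nat[simplified] mult.left_commute)
      ultimately show "\<exists>y. ((\<lambda>x. M x - \<mu> * x powr (q - \<mu>)) has_real_derivative y) (at x) \<and> y \<le> 0"
        by auto
    qed
    moreover have "0 \<le> \<mu> * 2 powr (q - \<mu>)"
      using \<mu> by simp
    ultimately show ?thesis
      by simp
  qed
  define C where "C = \<mu> + M 2"
  have w_bound: "w r \<le> C * r powr (- \<epsilon> - 1)" if "2 \<le> r" for r
  proof -
    have r: "1 \<le> r" "0 < r" using that by auto
    have "w r = M r * r powr (- q - 1)"
      using that powr_minus_divide[of r "q + 1"] by (simp add: w_def powr_nat[simplified])
    also have "\<dots> \<le> (\<mu> * r powr (q - \<mu>) + M 2) * r powr (- q - 1)"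
      using M_bound[OF that] by (intro mult_right_mono) auto
    also have "\<dots> = \<mu> * r powr (- \<mu> - 1) + M 2 * r powr (- q - 1)"
      by (simp add: distrib_right mult.assoc powr_add[symmetric])
    also have "\<dots> \<le> \<mu> * r powr (- \<epsilon> - 1) + M 2 * r powr (- \<epsilon> - 1)"
      using \<mu> \<epsilon> q r M_nonneg by (intro add_mono mult_left_mono powr_mono) auto
    finally show ?thesis
      by (simp add: C_def distrib_right)
  qed
  have W_bound: "W r \<le> W 2 + C / \<epsilon> * 2 powr - \<epsilon>" for r
  proof (cases "2 \<le> r")
    case True
    have "W r + C / \<epsilon> * r powr - \<epsilon> \<le> W 2 + C / \<epsilon> * 2 powr - \<epsilon>"
    proof (rule DERIV_nonpos_imp_nonincreasing[OF True])
      fix x assume x: "2 \<le> x" "x \<le> r"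
      have "((\<lambda>x. W x + C / \<epsilon> * x powr - \<epsilon>) has_real_derivative w x + C / \<epsilon> * ((- \<epsilon>) * x powr (- \<epsilon> - 1))) (at x)"
        using x by (intro DERIV_add W' DERIV_cmult has_real_derivative_powr) auto
      moreover have "w x + C / \<epsilon> * ((- \<epsilon>) * x powr (- \<epsilon> - 1)) \<le> 0"
        using w_bound[OF x(1)] \<epsilon> by (simp add: algebra_simps)
      ultimately show "\<exists>y. ((\<lambda>x. W x + C / \<epsilon> * x powr - \<epsilon>) has_real_derivative y) (at x) \<and> y \<le> 0"
        by blast
    qed
    moreover have "0 \<le> C / \<epsilon> * r powr - \<epsilon>"
      using \<epsilon> \<mu> M_nonneg by (simp add: C_def)
    ultimately show ?thesis by simp
  next
    case False
    moreover have "0 \<le> C / \<epsilon> * 2 powr - \<epsilon>"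
      using \<epsilon> \<mu> M_nonneg by (simp add: C_def)
    ultimately show ?thesis using W_mono[of r 2] by simp
  qed
  define T where "T = (SUP r. W r)"
  have bdd: "bdd_above (range W)"
    using W_bound by (intro bdd_aboveI) auto
  have W_le: "W r \<le> T" for r
    unfolding T_def by (rule cSUP_upper[OF _ bdd]) auto
  have W_lim: "(W \<longlongrightarrow> T) at_top"
  proof (rule order_tendstoI)
    fix a assume "T < a"
    then show "eventually (\<lambda>r. W r < a) at_top"
      using W_le by (auto intro!: always_eventually intro: le_less_trans)
  next
    fix a assume "a < T"
    then obtain r where "a < W r"
      unfolding T_def using less_cSUP_iff[OF _ bdd] by auto
    then have "a < W x" if "r \<le> x" for x
      using W_mono[OF that] by simp
    then show "eventually (\<lambda>r. a < W r) at_top"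
      using eventually_at_top_linorder by blast
  qed
  \<comment> \<open>The prescribed tail of \<open>\<eta>\<close> is positive on [2, 3]. This yields
    T > 0, so that the \<open>inverse\<close> in \<open>weight_const\<close> is a true reciprocal
    and not the default value 0.\<close>
  have "0 < M 3"
  proof -
    have "M 2 < M 3"
    proof (rule DERIV_pos_imp_increasing[of 2 3 M])
      fix x :: real assume x: "2 \<le> x" "x \<le> 3"
      then have "0 < g x"
        using \<mu> q \<eta>_tail[of x] by (simp add: g_def)
      then show "\<exists>y. DERIV M x :> y \<and> 0 < y"
        using M' by blast
    qed simp
    then show ?thesis using M_nonneg[of 2] by simp
  qed
  have "0 < T"
  proof -
    have "W 3 < W 4"
    proof (rule DERIV_pos_imp_increasing[of 3 4 W])
      fix x :: real assume x: "3 \<le> x" "x \<le> 4"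
      then have "0 < w x"
        using M_mono[of 3 x] \<open>0 < M 3\<close> by (simp add: w_def)
      then show "\<exists>y. DERIV W x :> y \<and> 0 < y"
        using W' by blast
    qed simp
    then show ?thesis using W_le[of 4] W_mono[of 0 3] W_0[of 0] by simp
  qed
  have const: "weight_const n \<eta> = 1 / T"
  proof -
    have "(LBINT s:{0..}. weight_slope n \<eta> s) = (LBINT s:{0..}. w s)"
      by (simp add: w_slope)
    also have "\<dots> = T - W 0"
      using W_le by (intro integral_atLeast_eq_limit w_cont W' w_nonneg W_lim)
    finally show ?thesis
      by (simp add: weight_const_def W_0 inverse_eq_divide)
  qed
  have \<phi>_eq: "\<phi> x = 1 - W (norm x) / T" for x
    using const by (simp add: \<phi> weight_of_def n_def[symmetric] w_slope W_def[symmetric])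
  \<comment> \<open>The radius at which the harmonic function r^(-q) takes the value
    \<open>s\<close>.\<close>
  define \<rho> where "\<rho> s = s powr (- 1 / q)" for s :: real
  have \<rho>: "0 < \<rho> s" if "0 < s" for s
    using that by (simp add: \<rho>_def)
  have \<rho>_power: "\<rho> s powr a = s powr (- a / q)" if "0 < s" for s a
    using that by (simp add: \<rho>_def powr_powr)
  have \<rho>': "(\<rho> has_real_derivative - (\<rho> s powr (q + 1)) / q) (at s)" if "0 < s" for s
  proof -
    have "(\<rho> has_real_derivative (- 1 / q) * s powr (- 1 / q - 1)) (at s)"
      unfolding \<rho>_def[abs_def] by (rule has_real_derivative_powr[OF that])
    moreover have "- 1 / q - 1 = - (q + 1) / q"
      using q by (simp add: field_simps)
    ultimately show ?thesis
      by (simp only: \<rho>_power[OF that]) simp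
  qed
  define \<Phi> where "\<Phi> s = 1 - W (\<rho> s) / T" for s
  define \<Phi>' where "\<Phi>' s = M (\<rho> s) / (q * T)" for s
  define \<Phi>'' where "\<Phi>'' s = g (\<rho> s) * (- (\<rho> s powr (q + 1)) / q) / (q * T)" for s
  have w_eq: "w r * r powr (q + 1) = M r" if "0 < r" for r
    using that M_0[of r] by (auto simp: w_def powr_nat[simplified])
  show thesis
  proof (rule that)
    show "\<phi> x = \<Phi> (norm x powr - (real CARD('n) - 2))" if "x \<noteq> 0" for x
    proof -
      have "\<rho> (norm x powr - q) = norm x"
        using that q by (simp add: \<rho>_def powr_powr)
      then show ?thesis
        by (simp add: \<phi>_eq \<Phi>_def q_def n_def)
    qed
    show "(\<Phi> has_real_derivative \<Phi>' s) (at s)" if "0 < s" for s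
    proof -
      have "(\<Phi> has_real_derivative 0 - w (\<rho> s) * (- (\<rho> s powr (q + 1)) / q) / T) (at s)"
        unfolding \<Phi>_def[abs_def]
        by (intro DERIV_diff DERIV_const DERIV_cdivide DERIV_chain2[OF W' \<rho>'[OF that]])
      then show ?thesis
        using w_eq[OF \<rho>[OF that]] by (simp add: \<Phi>'_def)
    qed
    show "(\<Phi>' has_real_derivative \<Phi>'' s) (at s)" if "0 < s" for s
      unfolding \<Phi>'_def[abs_def] \<Phi>''_def
      by (intro DERIV_cdivide DERIV_chain2[OF M' \<rho>'[OF that]])
    have "continuous_on {0<..} \<rho>"
      unfolding \<rho>_def by (intro continuous_intros) auto
    then show "continuous_on {0<..} \<Phi>''"
      unfolding \<Phi>''_def using q \<open>0 < T\<close> \<rho>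
      by (intro continuous_intros continuous_on_compose2[OF g_cont]) (auto simp: less_imp_neq[THEN not_sym])
    show "0 \<le> \<Phi>' s" if "0 < s" for s
      using M_nonneg q \<open>0 < T\<close> by (simp add: \<Phi>'_def)
    show "\<Phi>'' s \<le> 0" if "0 < s" for s
      using g_nonneg[of "\<rho> s"] q \<open>0 < T\<close>
      by (simp add: \<Phi>''_def divide_nonpos_pos mult_nonneg_nonpos)
    show "\<Phi>' s = 0" if "1 \<le> s" for s
    proof -
      have "\<rho> s \<le> 1"
        using that q powr_mono[of "- 1 / q" 0 s] by (simp add: \<rho>_def)
      then show ?thesis by (simp add: \<Phi>'_def M_0)
    qed
    have "filterlim \<rho> at_top (at_right 0)"
      unfolding filterlim_at_top
    proof
      fix Z :: real
      define Y where "Y = max Z 1"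
      have "Z \<le> \<rho> s" if "0 < s" "s < Y powr - q" for s
      proof -
        have "(Y powr - q) powr (- 1 / q) \<le> \<rho> s"
          unfolding \<rho>_def using that q by (intro powr_mono2') auto
        moreover have "(Y powr - q) powr (- 1 / q) = Y"
          using q by (simp add: powr_powr Y_def)
        ultimately show ?thesis by (simp add: Y_def)
      qed
      moreover have "0 < Y powr - q"
        by (simp add: Y_def)
      ultimately show "eventually (\<lambda>s. Z \<le> \<rho> s) (at_right 0)"
        unfolding eventually_at_right_field by blast
    qed
    then have "((\<lambda>s. W (\<rho> s)) \<longlongrightarrow> T) (at_right 0)"
      by (rule filterlim_compose[OF W_lim])
    then have "((\<lambda>s. 1 - W (\<rho> s) / T) \<longlongrightarrow> 1 - T / T) (at_right 0)"
      using \<open>0 < T\<close> by (intro tendsto_intros) auto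
    then show "(\<Phi> \<longlongrightarrow> 0) (at_right 0)"
      using \<open>0 < T\<close> by (simp add: \<Phi>_def[abs_def])
    show "\<Phi> s \<le> 1" if "0 < s" for s
      using W_mono[of 0 "\<rho> s"] W_0[of 0] \<rho>[OF that] \<open>0 < T\<close> by (simp add: \<Phi>_def)
  qed
qed

subsection \<open>Cutoff test functions\<close>

lemma max_0_power_deriv:
  "((\<lambda>s::real. max s 0 ^ Suc (Suc k)) has_real_derivative real (Suc (Suc k)) * max x 0 ^ Suc k) (at x)"
proof -
  consider "x < 0" | "x = 0" | "0 < x" by linarith
  then show ?thesis
  proof cases
    case 1
    have "((\<lambda>s::real. 0) has_real_derivative 0) (at x)" by simp
    then have "((\<lambda>s::real. max s 0 ^ Suc (Suc k)) has_real_derivative 0) (at x)"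
      by (rule has_field_derivative_transform_within_open[of _ _ _ "{..<0}"]) (use 1 in auto)
    then show ?thesis using 1 by simp
  next
    case 2
    have "((\<lambda>h. (max h 0 ^ Suc (Suc k)) / h) \<longlongrightarrow> 0) (at (0::real))"
    proof (rule Lim_null_comparison)
      show "eventually (\<lambda>h. norm (max h 0 ^ Suc (Suc k) / h) \<le> max h 0 ^ Suc k) (at (0::real))"
        by (intro always_eventually allI) (auto simp: max_def)
      have "((\<lambda>h. max h 0 ^ Suc k) \<longlongrightarrow> max 0 0 ^ Suc k) (at (0::real))"
        by (intro tendsto_intros)
      then show "((\<lambda>h. max h 0 ^ Suc k) \<longlongrightarrow> 0) (at (0::real))" by simp
    qed
    then show ?thesis using 2 by (simp add: DERIV_def)
  next
    case 3
    have "((\<lambda>s::real. s ^ Suc (Suc k)) has_real_derivative real (Suc (Suc k)) * x ^ Suc k) (at x)"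
      using DERIV_pow[of "Suc (Suc k)" x] by simp
    then have "((\<lambda>s::real. max s 0 ^ Suc (Suc k)) has_real_derivative real (Suc (Suc k)) * x ^ Suc k) (at x)"
      by (rule has_field_derivative_transform_within_open[of _ _ _ "{0<..}"]) (use 3 in auto)
    then show ?thesis using 3 by simp
  qed
qed

lemma bounded_if_zero_outside:
  fixes g :: "real \<Rightarrow> real"
  assumes "continuous_on UNIV g" "\<And>s. s \<notin> {a..b} \<Longrightarrow> g s = 0"
  obtains B where "0 \<le> B" "\<And>s. \<bar>g s\<bar> \<le> B"
proof -
  have "compact (g ` {a..b})"
    by (intro compact_continuous_image continuous_on_subset[OF assms(1)]) auto
  then obtain B where "\<forall>y\<in>g ` {a..b}. \<bar>y\<bar> \<le> B"
    by (metis compact_imp_bounded bounded_iff real_norm_def)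
  then have "\<bar>g s\<bar> \<le> max B 0" for s
    using assms(2)[of s] by (cases "s \<in> {a..b}") (auto simp: le_max_iff_disj)
  then show thesis
    by (intro that[of "max B 0"]) auto
qed

text \<open>The quotient a / (a + c) of the cubes of the positive parts of s and 1 - s. Cubes are
  twice continuously differentiable, and the denominator never vanishes because s and 1 - s are not
  both nonpositive. The derivatives are bounded as continuous functions vanishing outside
  [0, 1].\<close>

lemma C2_step_function:
  obtains p p' p'' :: "real \<Rightarrow> real" and B :: real where
    "\<And>s. (p has_real_derivative p' s) (at s)" "\<And>s. (p' has_real_derivative p'' s) (at s)"
    "continuous_on UNIV p''" "\<And>s. 0 \<le> p s" "\<And>s. p s \<le> 1"
    "\<And>s. s \<le> 0 \<Longrightarrow> p s = 0 \<and> p' s = 0 \<and> p'' s = 0"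
    "\<And>s. 1 \<le> s \<Longrightarrow> p s = 1 \<and> p' s = 0 \<and> p'' s = 0"
    "0 \<le> B" "\<And>s. \<bar>p' s\<bar> \<le> B" "\<And>s. \<bar>p'' s\<bar> \<le> B"
proof -
  define a a' a'' where "a s = max s 0 ^ 3" and "a' s = 3 * max s 0 ^ 2" and "a'' s = 6 * max s 0" for s :: real
  define c c' c'' where "c s = a (1 - s)" and "c' s = - a' (1 - s)" and "c'' s = a'' (1 - s)" for s :: real
  have a: "(a has_real_derivative a' s) (at s)" for s
    using max_0_power_deriv[of 1 s] by (simp add: a_def[abs_def] a'_def eval_nat_numeral)
  have a': "(a' has_real_derivative a'' s) (at s)" for s
    using DERIV_cmult[OF max_0_power_deriv[of 0 s], of 3]
    by (simp add: a''_def a'_def[abs_def] eval_nat_numeral)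
  have r: "((\<lambda>s. 1 - s) has_real_derivative - 1) (at (s::real))" for s
    by (auto intro!: derivative_eq_intros)
  have c: "(c has_real_derivative c' s) (at s)" for s
    using DERIV_chain2[OF a r] by (simp add: c_def[abs_def] c'_def)
  have c': "(c' has_real_derivative c'' s) (at s)" for s
    using DERIV_minus[OF DERIV_chain2[OF a' r]] by (simp add: c'_def[abs_def] c''_def)
  define D where "D s = a s + c s" for s
  have nonneg: "0 \<le> a s" "0 \<le> c s" for s
    by (auto simp: a_def c_def)
  have "0 < a s \<or> 0 < c s" for s
    by (cases "0 < s") (auto simp: a_def c_def max_def)
  then have "0 < D s" for s
    using nonneg[of s] by (metis D_def add_pos_nonneg add_nonneg_pos)
  then have D: "0 < D s" "D s \<noteq> 0" for s
    using less_irrefl[of "0 :: real"] by metis+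
  define N where "N s = a' s * c s - a s * c' s" for s
  define p p' p'' where "p s = a s / D s" and "p' s = N s / (D s * D s)"
    and "p'' s = ((a'' s * c s - a s * c'' s) * (D s * D s) - N s * ((a' s + c' s) * D s + (a' s + c' s) * D s)) / ((D s * D s) * (D s * D s))" for s
  have D': "(D has_real_derivative a' s + c' s) (at s)" for s
    unfolding D_def[abs_def] by (rule DERIV_add[OF a c])
  have p: "(p has_real_derivative p' s) (at s)" for s
  proof -
    have "(p has_real_derivative (a' s * D s - a s * (a' s + c' s)) / (D s * D s)) (at s)"
      unfolding p_def[abs_def] by (rule DERIV_divide[OF a D' D(2)])
    then show ?thesis
      by (simp add: p'_def N_def D_def algebra_simps)
  qed
  have N': "(N has_real_derivative a'' s * c s - a s * c'' s) (at s)" for s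
    using DERIV_diff[OF DERIV_mult[OF a' c] DERIV_mult[OF a c'], of s]
    by (simp add: N_def[abs_def] algebra_simps)
  have p': "(p' has_real_derivative p'' s) (at s)" for s
    using DERIV_divide[OF N' DERIV_mult[OF D' D'], of s] D(2)[of s]
    by (simp add: p'_def[abs_def] p''_def algebra_simps)
  have cont: "continuous_on UNIV p" "continuous_on UNIV p'" "continuous_on UNIV a" "continuous_on UNIV c"
    "continuous_on UNIV a'" "continuous_on UNIV c'" "continuous_on UNIV D" "continuous_on UNIV N"
    using DERIV_isCont[OF p] DERIV_isCont[OF p'] DERIV_isCont[OF a] DERIV_isCont[OF c]
      DERIV_isCont[OF a'] DERIV_isCont[OF c'] DERIV_isCont[OF D'] DERIV_isCont[OF N']
    by (simp_all add: continuous_at_imp_continuous_on)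
  have "continuous_on UNIV a''" "continuous_on UNIV c''"
    unfolding a''_def c''_def by (intro continuous_intros)+
  with cont D(2) have cp'': "continuous_on UNIV p''"
    unfolding p''_def by (intro continuous_on_divide continuous_on_mult continuous_on_diff continuous_on_add) auto
  have left: "p s = 0 \<and> p' s = 0 \<and> p'' s = 0" if "s \<le> 0" for s
    using that by (simp add: p_def p'_def p''_def N_def a_def a'_def a''_def)
  have right: "p s = 1 \<and> p' s = 0 \<and> p'' s = 0" if "1 \<le> s" for s
  proof -
    have "c s = 0" "c' s = 0" "c'' s = 0"
      using that by (auto simp: c_def c'_def c''_def a_def a'_def a''_def)
    then show ?thesis
      using D(2)[of s] by (simp add: p_def p'_def p''_def N_def D_def)
  qed
  obtain B1 where B1: "0 \<le> B1" "\<And>s. \<bar>p' s\<bar> \<le> B1"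
    by (rule bounded_if_zero_outside[OF cont(2), of 0 1]) (use left right in auto)
  obtain B2 where B2: "0 \<le> B2" "\<And>s. \<bar>p'' s\<bar> \<le> B2"
    by (rule bounded_if_zero_outside[OF cp'', of 0 1]) (use left right in auto)
  show thesis
  proof (rule that[OF p p' cp'' _ _ left right, of "max B1 B2"])
    show "0 \<le> p s" "p s \<le> 1" for s
      using nonneg[of s] D(1)[of s] by (auto simp: p_def D_def)
    show "0 \<le> max B1 B2" "\<bar>p' s\<bar> \<le> max B1 B2" "\<bar>p'' s\<bar> \<le> max B1 B2" for s
      using B1(1) B1(2)[of s] B2(2)[of s] by (auto simp: le_max_iff_disj)
  qed
qed

text \<open>Every point has a neighbourhood inside \<open>S\<close> or inside the complement of
  \<open>K\<close>, and on their overlap the given data already vanish.\<close>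

lemma C2_data_extend_zero:
  assumes f: "C2_data S f f' f''" and S: "open S" and K: "compact K" "K \<subseteq> S"
    and zero: "\<And>x i. x \<in> S - K \<Longrightarrow> f x = 0 \<and> f' i x = 0 \<and> f'' i x = 0"
  shows "C2_data UNIV (\<lambda>x. if x \<in> S then f x else 0) (\<lambda>i x. if x \<in> S then f' i x else 0)
           (\<lambda>i x. if x \<in> S then f'' i x else 0)"
proof -
  have oK: "open (- K)"
    using K(1) by (simp add: compact_imp_closed open_Compl)
  have U: "S \<union> - K = UNIV" using K(2) by auto
  have cont: "continuous_on UNIV (\<lambda>x. if x \<in> S then g x else 0)"
    if "continuous_on S g" "\<And>x. x \<in> S - K \<Longrightarrow> g x = 0" for g :: "_ \<Rightarrow> real"
  proof -
    have "continuous_on S (\<lambda>x. if x \<in> S then g x else 0)"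
      using that(1) by (subst continuous_on_cong[OF refl, of _ _ g]) auto
    moreover have "continuous_on (- K) (\<lambda>x. if x \<in> S then g x else 0)"
      using that(2) by (subst continuous_on_cong[OF refl, of _ _ "\<lambda>_. 0"]) auto
    ultimately show ?thesis
      unfolding U[symmetric] by (rule continuous_on_open_Un[OF S oK])
  qed
  have hp: "has_partial i (\<lambda>x. if x \<in> S then g x else 0) (if x \<in> S then g' x else 0) x"
    if "\<And>x. x \<in> S \<Longrightarrow> has_partial i g (g' x) x" "\<And>x. x \<in> S - K \<Longrightarrow> g x = 0" for g g' i x
  proof (cases "x \<in> S")
    case True
    then show ?thesis
      using has_partial_cong[OF S True _ that(1)[OF True], of "\<lambda>x. if x \<in> S then g x else 0"] by simp
  next
    case False
    then have "x \<in> - K" using K by auto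
    then have "has_partial i (\<lambda>x. if x \<in> S then g x else 0) 0 x"
      by (rule has_partial_cong[OF oK, of _ "\<lambda>_. 0"]) (use that(2) in \<open>auto simp: has_partial_def\<close>)
    then show ?thesis using False by simp
  qed
  show ?thesis
    unfolding C2_data_def
    by (intro conjI allI ballI cont hp) (use f zero in \<open>auto simp: C2_data_def\<close>)
qed

text \<open>The test function is Theta(N) with Theta = A X, where A is the shifted profile and X a
  cutoff in s = N; its Laplacian is Theta''(N) q^2 N^2 / |x|^2. Only an upper bound is wanted, so
  the term A'' X <= 0 can be discarded everywhere. The essential point is that \<open>C\<close>
  depends on \<open>h\<close> but not on \<open>R\<close>.\<close>

lemma cutoff_test_function:
  fixes \<Phi> \<Phi>' \<Phi>'' :: "real \<Rightarrow> real"
  defines "q \<equiv> real CARD('n::finite) - 2"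
  assumes n: "3 \<le> CARD('n)" and h: "0 < h"
    and \<Phi>: "\<And>s. 0 < s \<Longrightarrow> (\<Phi> has_real_derivative \<Phi>' s) (at s)"
    and \<Phi>': "\<And>s. 0 < s \<Longrightarrow> (\<Phi>' has_real_derivative \<Phi>'' s) (at s)"
    and \<Phi>'': "continuous_on {0<..} \<Phi>''"
    and mono: "\<And>s. 0 < s \<Longrightarrow> 0 \<le> \<Phi>' s" and concave: "\<And>s. 0 < s \<Longrightarrow> \<Phi>'' s \<le> 0"
    and flat: "\<And>s. 1 \<le> s \<Longrightarrow> \<Phi>' s = 0"
    and range: "\<And>s. 0 < s \<Longrightarrow> 0 \<le> \<Phi> s \<and> \<Phi> s \<le> 1"
  obtains C where "0 \<le> C"
    "\<And>R. 2 \<le> R \<Longrightarrow> \<exists>\<psi> \<psi>' \<psi>''. C2_data UNIV \<psi> \<psi>' \<psi>'' \<and>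
       (\<forall>x i. x \<notin> {x :: real ^ 'n. 1 / (2 * R) \<le> norm x \<and> norm x \<le> R} \<longrightarrow>
           \<psi> x = 0 \<and> \<psi>' i x = 0 \<and> \<psi>'' i x = 0) \<and>
       (\<forall>x. 0 \<le> \<psi> x) \<and> (\<forall>x. x \<noteq> 0 \<longrightarrow> \<psi> x \<le> \<Phi> (norm x powr - q + h) - \<Phi> h) \<and>
       (\<forall>x. 1 / R \<le> norm x \<and> norm x \<le> R / 2 \<longrightarrow> \<psi> x = \<Phi> (norm x powr - q + h) - \<Phi> h) \<and>
       (\<forall>x. (\<Sum>i\<in>UNIV. \<psi>'' i x) \<le>
          (if R / 2 \<le> norm x \<and> norm x \<le> R then C / R ^ CARD('n)
           else if 1 / (2 * R) \<le> norm x \<and> norm x \<le> 1 / R then C * R\<^sup>2 else 0))"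
proof -
  obtain p p' p'' B where p: "\<And>s. (p has_real_derivative p' s) (at s)"
    and p': "\<And>s. (p' has_real_derivative p'' s) (at s)" and p'': "continuous_on UNIV p''"
    and p_range: "\<And>s. 0 \<le> p s" "\<And>s. p s \<le> 1"
    and p_left: "\<And>s. s \<le> 0 \<Longrightarrow> p s = 0 \<and> p' s = 0 \<and> p'' s = 0"
    and p_right: "\<And>s. 1 \<le> s \<Longrightarrow> p s = 1 \<and> p' s = 0 \<and> p'' s = 0"
    and B: "0 \<le> B" "\<And>s. \<bar>p' s\<bar> \<le> B" "\<And>s. \<bar>p'' s\<bar> \<le> B"
    by (rule C2_step_function) (rule that)
  have q: "1 \<le> q" "real CARD('n) = q + 2"
    using n by (auto simp: q_def)
  have \<Phi>'_anti: "\<Phi>' t \<le> \<Phi>' s" if "0 < s" "s \<le> t" for s t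
    using that \<Phi>' concave by (intro DERIV_nonpos_imp_nonincreasing[OF that(2)]) (meson less_le_trans)
  have \<Phi>_mono: "\<Phi> s \<le> \<Phi> t" if "0 < s" "s \<le> t" for s t
    using that \<Phi> mono by (intro DERIV_nonneg_imp_nondecreasing[OF that(2)]) (meson less_le_trans)
  have flat2: "\<Phi>'' s = 0" if "1 < s" for s
  proof -
    have "((\<lambda>_. 0) has_real_derivative 0) (at s)" by simp
    then have "(\<Phi>' has_real_derivative 0) (at s)"
      by (rule has_field_derivative_transform_within_open[of _ _ _ "{1<..}"]) (use that flat in auto)
    then show ?thesis
      using \<Phi>'[of s] that DERIV_unique by fastforce
  qed
  define A A' A'' where "A s = \<Phi> (s + h) - \<Phi> h" and "A' s = \<Phi>' (s + h)" and "A'' s = \<Phi>'' (s + h)" for s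
  have sh: "((\<lambda>s. s + h) has_real_derivative 1) (at s)" for s
    by (auto intro!: derivative_eq_intros)
  have A: "(A has_real_derivative A' s) (at s)" if "0 < s" for s
    unfolding A_def[abs_def] A'_def using DERIV_diff[OF DERIV_chain2[OF \<Phi> sh] DERIV_const] that h by auto
  have A': "(A' has_real_derivative A'' s) (at s)" if "0 < s" for s
    unfolding A'_def[abs_def] A''_def using DERIV_chain2[OF \<Phi>' sh] that h by auto
  have A'': "continuous_on {0<..} A''"
    unfolding A''_def by (rule continuous_on_compose2[OF \<Phi>'']) (use h in \<open>auto intro!: continuous_intros\<close>)
  have A_nonneg: "0 \<le> A s" and A_le: "A s \<le> 1" if "0 < s" for s
    using \<Phi>_mono[of h "s + h"] range[of "s + h"] range[of h] h that by (auto simp: A_def)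
  \<comment> \<open>Finite thanks to the shift: the slope of \<open>\<Phi>\<close> itself may be
    unbounded near 0. By concavity \<open>c\<close> bounds the slope of \<open>A\<close> on the
    whole half line.\<close>
  define c where "c = \<Phi>' h"
  have c: "0 \<le> c" using mono h by (simp add: c_def)
  have A'_bound: "0 \<le> A' s" "A' s \<le> c" if "0 < s" for s
    using that h \<Phi>'_anti[of h "s + h"] mono by (auto simp: A'_def c_def)
  have A_lin: "A s \<le> c * s" if "0 < s" for s
  proof -
    have "\<exists>z. h < z \<and> z < s + h \<and> \<Phi> (s + h) - \<Phi> h = (s + h - h) * \<Phi>' z"
      using that h by (intro MVT2) (auto intro!: \<Phi>)
    then obtain z where z: "h < z" "A s = s * \<Phi>' z"
      by (auto simp: A_def)
    then show ?thesis
      using \<Phi>'_anti[of h z] h that by (simp add: c_def mult.commute)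
  qed
  \<comment> \<open>The outer shell needs 4 * 4 * 4 = 64: one factor from the bound on Theta'', one
    from N <= 2 delta squared, one from |x| >= R/2 squared. The inner shell needs only 4 * 4 =
    16.\<close>
  define C where "C = 64 * q\<^sup>2 * (c * B + B)"
  have "0 \<le> C" using B c by (simp add: C_def)
  show thesis
  proof (rule that[OF \<open>0 \<le> C\<close>])
    fix R :: real assume R: "2 \<le> R"
    \<comment> \<open>The value of N at radius R; its reciprocal is the value at radius 1/R.\<close>
    define \<delta> where "\<delta> = R powr - q"
    have Rpos: "0 < R" using R by simp
    have \<delta>0: "0 < \<delta>" using R by (simp add: \<delta>_def)
    have two: "2 \<le> 2 powr q" using q powr_mono[of 1 q 2] by simp
    have "R powr - q \<le> 2 powr - q"
      using R q by (intro powr_mono2') auto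
    also have "2 powr - q \<le> 2 powr - 1"
      using q by (intro powr_mono) auto
    finally have \<delta>1: "\<delta> \<le> 1 / 2" by (simp add: \<delta>_def powr_minus_divide)
    have \<delta>sq: "2 * \<delta> * \<delta> \<le> 1 / 2"
      using mult_mono[of "2 * \<delta>" 1 \<delta> "1 / 2"] \<delta>0 \<delta>1 by simp
    have \<delta>R: "\<delta> / R\<^sup>2 = 1 / R ^ CARD('n)"
    proof -
      have "R ^ CARD('n) = R powr (q + 2)"
        using Rpos q powr_realpow[of R "CARD('n)"] by simp
      also have "\<dots> = R powr q * R\<^sup>2"
        using Rpos by (simp add: powr_add powr_numeral)
      finally show ?thesis
        using Rpos by (simp add: \<delta>_def powr_minus_divide)
    qed
    \<comment> \<open>The first factor rises from 0 to 1 for s between delta and 2 delta, the second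
      falls from 1 to 0 for s between 1/delta and 2/delta.\<close>
    define X X' X'' where "X s = p (s / \<delta> - 1) * p (2 - \<delta> * s)"
      and "X' s = p' (s / \<delta> - 1) / \<delta> * p (2 - \<delta> * s) - p (s / \<delta> - 1) * (\<delta> * p' (2 - \<delta> * s))"
      and "X'' s = p'' (s / \<delta> - 1) / \<delta>\<^sup>2 * p (2 - \<delta> * s)
         - 2 * (p' (s / \<delta> - 1) * p' (2 - \<delta> * s)) + p (s / \<delta> - 1) * (\<delta>\<^sup>2 * p'' (2 - \<delta> * s))" for s
    have d1: "((\<lambda>s. s / \<delta> - 1) has_real_derivative 1 / \<delta>) (at s)" for s
      using \<delta>0 by (auto intro!: derivative_eq_intros)
    have d2: "((\<lambda>s. 2 - \<delta> * s) has_real_derivative - \<delta>) (at s)" for s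
      by (auto intro!: derivative_eq_intros)
    have X: "(X has_real_derivative X' s) (at s)" for s
      using DERIV_mult[OF DERIV_chain2[OF p d1] DERIV_chain2[OF p d2], of s]
      by (simp add: X_def[abs_def] X'_def algebra_simps)
    have X': "(X' has_real_derivative X'' s) (at s)" for s
      using DERIV_diff[OF DERIV_mult[OF DERIV_cdivide[OF DERIV_chain2[OF p' d1], of \<delta>] DERIV_chain2[OF p d2]]
          DERIV_mult[OF DERIV_chain2[OF p d1] DERIV_cmult[OF DERIV_chain2[OF p' d2], of \<delta>]], of s] \<delta>0
      by (simp add: X'_def[abs_def] X''_def field_simps power2_eq_square)
    have pc: "continuous_on UNIV p" "continuous_on UNIV p'"
      using DERIV_isCont[OF p] DERIV_isCont[OF p'] by (simp_all add: continuous_at_imp_continuous_on)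
    have X'': "continuous_on {0<..} X''"
      unfolding X''_def using \<delta>0
      by (intro continuous_intros continuous_on_compose2[OF p''] continuous_on_compose2[OF pc(1)]
          continuous_on_compose2[OF pc(2)]) auto
    define \<Theta> \<Theta>' \<Theta>'' where "\<Theta> s = A s * X s" and "\<Theta>' s = A' s * X s + X' s * A s"
      and "\<Theta>'' s = A'' s * X s + 2 * (A' s * X' s) + A s * X'' s" for s
    have \<Theta>: "(\<Theta> has_real_derivative \<Theta>' s) (at s)" if "0 < s" for s
      unfolding \<Theta>_def[abs_def] \<Theta>'_def by (rule DERIV_mult[OF A[OF that] X])
    have \<Theta>': "(\<Theta>' has_real_derivative \<Theta>'' s) (at s)" if "0 < s" for s
      using DERIV_add[OF DERIV_mult[OF A'[OF that] X] DERIV_mult[OF X' A[OF that]]]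
      by (simp add: \<Theta>'_def[abs_def] \<Theta>''_def algebra_simps)
    have \<Theta>'': "continuous_on {0<..} \<Theta>''"
    proof -
      have "continuous_on {0<..} A" "continuous_on {0<..} A'"
        "continuous_on {0<..} X" "continuous_on {0<..} X'"
        using DERIV_isCont[OF A] DERIV_isCont[OF A'] DERIV_isCont[OF X] DERIV_isCont[OF X']
        by (simp_all add: continuous_at_imp_continuous_on)
      then show ?thesis
        unfolding \<Theta>''_def by (intro continuous_on_add continuous_on_mult continuous_on_const A'' X'')
    qed
    have low: "X s = 0" "X' s = 0" "X'' s = 0" if "s \<le> \<delta>" for s
      using that \<delta>0 p_left[of "s / \<delta> - 1"] by (auto simp: X_def X'_def X''_def)
    have high: "X s = 0" "X' s = 0" "X'' s = 0" if "2 / \<delta> \<le> s" for s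
      using that \<delta>0 p_left[of "2 - \<delta> * s"] by (auto simp: X_def X'_def X''_def field_simps)
    \<comment> \<open>The cutoff costs 1/delta in X' and 1/delta^2 in X''. The linear bound A <= 2 c
      delta regains one power of delta, so both products are of order 1/delta.\<close>
    have outer: "\<Theta>'' s \<le> 4 * c * B / \<delta>" if "\<delta> \<le> s" "s \<le> 2 * \<delta>" for s
    proof -
      have s: "0 < s" using that \<delta>0 by simp
      have "\<delta> * s \<le> \<delta> * (2 * \<delta>)"
        using that \<delta>0 by (intro mult_left_mono) auto
      then have "1 \<le> 2 - \<delta> * s" using \<delta>sq by simp
      then have X_eq: "X s = p (s / \<delta> - 1)" "X' s = p' (s / \<delta> - 1) / \<delta>" "X'' s = p'' (s / \<delta> - 1) / \<delta>\<^sup>2"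
        using p_right by (auto simp: X_def X'_def X''_def)
      have "A'' s * X s \<le> 0"
        using concave[of "s + h"] s h p_range by (auto simp: X_eq A''_def mult_nonpos_nonneg)
      moreover have "A' s * X' s \<le> c * (B / \<delta>)"
        using A'_bound[OF s] B(2)[of "s / \<delta> - 1"] \<delta>0 c B(1)
        by (intro order_trans[OF mult_left_mono mult_right_mono]) (auto simp: X_eq divide_right_mono abs_le_iff)
      moreover have "A s * X'' s \<le> (c * (2 * \<delta>)) * (B / \<delta>\<^sup>2)"
      proof -
        have "A s \<le> c * (2 * \<delta>)"
          using A_lin[OF s] that c mult_left_mono[of s "2 * \<delta>" c] by simp
        moreover have "X'' s \<le> B / \<delta>\<^sup>2"
          using B(3)[of "s / \<delta> - 1"] by (auto simp: X_eq abs_le_iff intro!: divide_right_mono)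
        ultimately show ?thesis
          using A_nonneg[OF s] B(1) by (intro order_trans[OF mult_left_mono mult_right_mono]) auto
      qed
      moreover have "c * (2 * \<delta>) * (B / \<delta>\<^sup>2) = 2 * (c * B / \<delta>)"
        using \<delta>0 by (simp add: field_simps power2_eq_square)
      moreover have "4 * c * B / \<delta> = 4 * (c * B / \<delta>)" "c * (B / \<delta>) = c * B / \<delta>"
        by simp_all
      ultimately show ?thesis
        unfolding \<Theta>''_def by linarith
    qed
    have middle: "X s = 1" "\<Theta>'' s \<le> 0" if "2 * \<delta> \<le> s" "s \<le> 1 / \<delta>" for s
    proof -
      have "0 < s" "1 \<le> s / \<delta> - 1" "1 \<le> 2 - \<delta> * s"
        using that \<delta>0 by (auto simp: field_simps)
      then have "X s = 1" "X' s = 0" "X'' s = 0"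
        using p_right by (auto simp: X_def X'_def X''_def)
      moreover have "A'' s \<le> 0"
        using concave[of "s + h"] \<open>0 < s\<close> h by (simp add: A''_def)
      ultimately show "X s = 1" "\<Theta>'' s \<le> 0"
        by (auto simp: \<Theta>''_def)
    qed
    \<comment> \<open>Here s >= 2 lies in the range where \<open>\<Phi>\<close> is flat, so A' and
      A'' vanish and only A X'' with A <= 1 remains.\<close>
    have inner: "\<Theta>'' s \<le> B * \<delta>\<^sup>2" if "1 / \<delta> \<le> s" for s
    proof -
      have "2 \<le> 1 / \<delta>" using \<delta>0 \<delta>1 by (simp add: field_simps)
      then have s: "2 \<le> s" using that by simp
      have "\<delta> * 2 \<le> s" using \<delta>1 s by simp
      then have "1 \<le> s / \<delta> - 1" using \<delta>0 by (simp add: field_simps)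
      then have "X'' s = \<delta>\<^sup>2 * p'' (2 - \<delta> * s)"
        using p_right by (simp add: X''_def)
      moreover have "A' s = 0" "A'' s = 0"
        using flat[of "s + h"] flat2[of "s + h"] s h by (auto simp: A'_def A''_def)
      ultimately have "\<Theta>'' s = A s * (\<delta>\<^sup>2 * p'' (2 - \<delta> * s))"
        by (simp add: \<Theta>''_def)
      also have "\<dots> \<le> 1 * (\<delta>\<^sup>2 * B)"
        using A_nonneg[of s] A_le[of s] s B(1) B(3)[of "2 - \<delta> * s"]
        by (intro order_trans[OF mult_left_mono mult_right_mono]) (auto simp: abs_le_iff mult_left_mono)
      finally show ?thesis by (simp add: mult.commute)
    qed
    define N where "N r = r powr - q" for r :: real
    have N_pos: "0 < N r" if "0 < r" for r using that by (simp add: N_def)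
    have N_anti: "N s \<le> N r" if "0 < r" "r \<le> s" for r s
      unfolding N_def using that q by (intro powr_mono2') auto
    have N_half: "N (r / 2) = 2 powr q * N r" if "0 < r" for r
      using that by (simp add: N_def powr_divide powr_minus_divide)
    have N_R: "N R = \<delta>" "2 * \<delta> \<le> N (R / 2)"
      using two \<delta>0 Rpos by (auto simp: N_half) (auto simp: N_def \<delta>_def)
    have N_inv: "N (1 / R) = 1 / \<delta>" "2 / \<delta> \<le> N (1 / (2 * R))"
    proof -
      show 1: "N (1 / R) = 1 / \<delta>"
        using Rpos by (simp add: N_def \<delta>_def powr_divide powr_minus_divide)
      have "N (1 / (2 * R)) = 2 powr q * N (1 / R)"
        using N_half[of "1 / R"] Rpos by (simp add: mult.commute)
      moreover have "2 / \<delta> \<le> 2 powr q / \<delta>"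
        using two \<delta>0 by (intro divide_right_mono) auto
      ultimately show "2 / \<delta> \<le> N (1 / (2 * R))"
        using 1 by simp
    qed
    define N' N'' where "N' r = - q * r powr (- q - 1)" and "N'' r = q * (q + 1) * r powr (- q - 2)" for r :: real
    have N': "(N has_real_derivative N' r) (at r)" if "0 < r" for r
      unfolding N_def[abs_def] N'_def by (rule has_real_derivative_powr[OF that])
    have N'': "(N' has_real_derivative N'' r) (at r)" if "0 < r" for r
      using DERIV_cmult[OF has_real_derivative_powr[OF that, of "- q - 1"], of "- q"]
      by (simp add: N'_def[abs_def] N''_def algebra_simps)
    define k k' k'' where "k r = \<Theta> (N r)" and "k' r = \<Theta>' (N r) * N' r"
      and "k'' r = \<Theta>'' (N r) * N' r * N' r + N'' r * \<Theta>' (N r)" for r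
    have k: "(k has_real_derivative k' r) (at r)" if "0 < r" for r
      unfolding k_def[abs_def] k'_def by (rule DERIV_chain2[OF \<Theta>[OF N_pos[OF that]] N'[OF that]])
    have k': "(k' has_real_derivative k'' r) (at r)" if "0 < r" for r
      unfolding k'_def[abs_def] k''_def
      by (rule DERIV_mult[OF DERIV_chain2[OF \<Theta>'[OF N_pos[OF that]] N'[OF that]] N''[OF that]])
    have k'': "continuous_on {0<..} k''"
    proof -
      have c1: "continuous_on {0<..} N" "continuous_on {0<..} N'" "continuous_on {0<..} \<Theta>'"
        using DERIV_isCont[OF N'] DERIV_isCont[OF N''] DERIV_isCont[OF \<Theta>']
        by (simp_all add: continuous_at_imp_continuous_on)
      have "continuous_on {0<..} N''"
        unfolding N''_def by (intro continuous_intros) auto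
      moreover have "continuous_on {0<..} (\<lambda>r. \<Theta>'' (N r))" "continuous_on {0<..} (\<lambda>r. \<Theta>' (N r))"
        using N_pos by (auto intro!: continuous_on_compose2[OF \<Theta>'' c1(1)] continuous_on_compose2[OF c1(3) c1(1)])
      ultimately show ?thesis
        unfolding k''_def by (intro continuous_on_add continuous_on_mult c1)
    qed
    obtain g' g'' where g: "C2_data (punctured :: (real ^ 'n) set) (\<lambda>x. k (norm x)) g' g''"
      and lap: "\<And>x. x \<noteq> 0 \<Longrightarrow> (\<Sum>i\<in>UNIV. g'' i x) = k'' (norm x) + (real CARD('n) - 1) / norm x * k' (norm x)"
      and g'0: "\<And>x i. x \<noteq> 0 \<Longrightarrow> k' (norm x) = 0 \<Longrightarrow> g' i x = 0"
      and g''0: "\<And>x i. x \<noteq> 0 \<Longrightarrow> k' (norm x) = 0 \<Longrightarrow> k'' (norm x) = 0 \<Longrightarrow> g'' i x = 0"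
      by (rule C2_data_radial[OF k k' k'', where 'n = 'n]) (assumption, assumption, rule that)
    define K where "K = {x :: real ^ 'n. 1 / (2 * R) \<le> norm x \<and> norm x \<le> R}"
    have K: "compact K" "K \<subseteq> punctured"
    proof -
      have "K = cball 0 R - ball 0 (1 / (2 * R))"
        by (auto simp: K_def)
      then show "compact K" by (simp add: compact_diff)
      show "K \<subseteq> punctured" using Rpos by (auto simp: K_def field_simps)
    qed
    have N_out: "N (norm x) \<le> \<delta> \<or> 2 / \<delta> \<le> N (norm x)" if "x \<noteq> 0" "x \<notin> K" for x
    proof (cases "norm x \<le> R")
      case True
      then have "N (1 / (2 * R)) \<le> N (norm x)"
        using that by (intro N_anti) (auto simp: K_def)
      then show ?thesis using N_inv by simp
    next
      case False
      then have "N (norm x) \<le> N R"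
        using Rpos by (intro N_anti) auto
      then show ?thesis using N_R by simp
    qed
    have zero: "k (norm x) = 0" "k' (norm x) = 0" "k'' (norm x) = 0" if "x \<noteq> 0" "x \<notin> K" for x :: "real ^ 'n"
      using N_out[OF that] low[of "N (norm x)"] high[of "N (norm x)"]
      by (auto simp: k_def k'_def k''_def \<Theta>_def \<Theta>'_def \<Theta>''_def)
    let ?ext = "\<lambda>f (x :: real ^ 'n). if x \<in> punctured then f x else 0 :: real"
    have data: "C2_data UNIV (?ext (\<lambda>x. k (norm x))) (\<lambda>i. ?ext (g' i)) (\<lambda>i. ?ext (g'' i))"
      by (rule C2_data_extend_zero[OF g _ K]) (use zero g'0 g''0 in \<open>auto simp: open_delete\<close>)
    have k_le: "0 \<le> k r \<and> k r \<le> A (N r)" if "0 < r" for r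
      using A_nonneg[OF N_pos[OF that]] p_range
      by (auto simp: k_def \<Theta>_def X_def intro!: mult_left_le mult_le_one)
    have lap_eq: "(\<Sum>i\<in>UNIV. g'' i x) = \<Theta>'' (N (norm x)) * (q\<^sup>2 * (N (norm x))\<^sup>2 / (norm x)\<^sup>2)"
      if "x \<noteq> 0" for x
    proof -
      define r where "r = norm x"
      have r: "0 < r" using that by (simp add: r_def)
      have 1: "r powr (- q - 1) = N r / r" "r powr (- q - 2) = N r / r\<^sup>2"
        using r by (simp_all add: N_def powr_diff powr_numeral)
      show ?thesis
        unfolding lap[OF that] r_def[symmetric] k''_def k'_def N'_def N''_def 1 q(2)
        using r by (simp add: field_simps power2_eq_square)
    qed
    have bound: "(\<Sum>i\<in>UNIV. ?ext (g'' i) x) \<le>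
          (if R / 2 \<le> norm x \<and> norm x \<le> R then C / R ^ CARD('n)
           else if 1 / (2 * R) \<le> norm x \<and> norm x \<le> 1 / R then C * R\<^sup>2 else 0)" for x
    proof (cases "x \<in> K")
      case False
      then have "(\<Sum>i\<in>UNIV. ?ext (g'' i) x) = 0"
        using zero g''0 by (intro sum.neutral) auto
      then show ?thesis using \<open>0 \<le> C\<close> Rpos by simp
    next
      case True
      define r where "r = norm x"
      have r: "1 / (2 * R) \<le> r" "r \<le> R" and x: "x \<noteq> 0"
        using True K by (auto simp: K_def r_def)
      have r0: "0 < r" using x by (simp add: r_def)
      have N1: "\<delta> \<le> N r" using N_anti[OF r0 r(2)] N_R by simp
      define F where "F = q\<^sup>2 * (N r)\<^sup>2 / r\<^sup>2"
      have F: "0 \<le> F" by (simp add: F_def)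
      have S: "(\<Sum>i\<in>UNIV. ?ext (g'' i) x) = \<Theta>'' (N r) * F"
        using lap_eq[OF x] x by (simp add: r_def F_def)
      \<comment> \<open>The shells are given by radii, the transition layers by values of N. Since
        2^q >= 2, each layer is contained in its shell but may be thinner; in the remaining part of
        the shell Theta'' is nonpositive (outer) or zero (inner).\<close>
      consider "R / 2 \<le> r" | "r < R / 2" "1 / R < r" | "r \<le> 1 / R" by linarith
      then show ?thesis
      proof cases
        case 1
        have bnd: "\<Theta>'' (N r) * F \<le> C / R ^ CARD('n)" if Nr: "N r \<le> 2 * \<delta>"
        proof -
          have "\<Theta>'' (N r) * F \<le> 4 * c * B / \<delta> * F"
            using outer[OF N1 Nr] F by (intro mult_right_mono)
          also have "\<dots> \<le> 4 * c * B / \<delta> * (q\<^sup>2 * (2 * \<delta>)\<^sup>2 / (R / 2)\<^sup>2)"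
            unfolding F_def using 1 Rpos Nr N1 \<delta>0 c B(1)
            by (intro mult_left_mono frac_le power_mono mult_nonneg_nonneg) auto
          also have "\<dots> = 64 * q\<^sup>2 * (c * B) * (\<delta> / R\<^sup>2)"
            using \<delta>0 Rpos by (simp add: field_simps power2_eq_square)
          also have "\<dots> \<le> C * (\<delta> / R\<^sup>2)"
            unfolding C_def using B c \<delta>0 by (intro mult_right_mono mult_left_mono) auto
          finally show ?thesis by (simp add: \<delta>R)
        qed
        have "\<Theta>'' (N r) * F \<le> C / R ^ CARD('n)"
        proof (cases "N r \<le> 2 * \<delta>")
          case False
          have "N r \<le> N (R / 2)" using 1 Rpos by (intro N_anti) auto
          have "1 / R \<le> 1 / 2" using R by (simp add: field_simps)
          then have "1 / R < R / 2" using R by linarith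
          then have "N r \<le> N (1 / R)" using 1 Rpos by (intro N_anti) auto
          then have "\<Theta>'' (N r) \<le> 0"
            using middle[of "N r"] False N_inv by simp
          then have "\<Theta>'' (N r) * F \<le> 0" using F by (simp add: mult_nonpos_nonneg)
          also have "0 \<le> C / R ^ CARD('n)" using \<open>0 \<le> C\<close> Rpos by simp
          finally show ?thesis .
        qed (rule bnd)
        then show ?thesis
          unfolding S r_def[symmetric] using 1 r by simp
      next
        case 2
        have "2 * \<delta> \<le> N r" using N_anti[of r "R / 2"] 2 r0 N_R by simp
        moreover have "N r \<le> 1 / \<delta>" using N_anti[of "1 / R" r] 2 Rpos N_inv by simp
        ultimately have "\<Theta>'' (N r) * F \<le> 0"
          using middle[of "N r"] F by (simp add: mult_nonpos_nonneg)
        then show ?thesis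
          unfolding S r_def[symmetric] using 2 by simp
      next
        case 3
        have N2: "1 / \<delta> \<le> N r" using N_anti[OF r0 3] N_inv by simp
        \<comment> \<open>For R >= 2 the two shells are disjoint, so the bound selects its second
          branch.\<close>
        have small: "r < R / 2"
        proof -
          have "1 / R \<le> 1 / 2" using R by (simp add: field_simps)
          then show ?thesis using 3 R by linarith
        qed
        have "\<Theta>'' (N r) * F \<le> C * R\<^sup>2"
        proof (cases "N r \<le> 2 / \<delta>")
          case True
          have "\<Theta>'' (N r) * F \<le> B * \<delta>\<^sup>2 * F"
            using inner[OF N2] F by (intro mult_right_mono)
          also have "\<dots> \<le> B * \<delta>\<^sup>2 * (q\<^sup>2 * (2 / \<delta>)\<^sup>2 / (1 / (2 * R))\<^sup>2)"
            unfolding F_def using r Rpos True N_pos[OF r0] \<delta>0 B(1)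
            by (intro mult_left_mono frac_le power_mono mult_nonneg_nonneg) auto
          also have "\<dots> = 16 * q\<^sup>2 * B * R\<^sup>2"
            using \<delta>0 Rpos by (simp add: field_simps power2_eq_square)
          also have "\<dots> \<le> C * R\<^sup>2"
          proof (rule mult_right_mono)
            have "0 \<le> q\<^sup>2 * (c * B)" "0 \<le> q\<^sup>2 * B" using B(1) c by auto
            then show "16 * q\<^sup>2 * B \<le> C" unfolding C_def by (simp add: algebra_simps)
          qed simp
          finally show ?thesis .
        next
          case False
          then have "\<Theta>'' (N r) = 0"
            using high[of "N r"] by (simp add: \<Theta>''_def)
          then show ?thesis using \<open>0 \<le> C\<close> by simp
        qed
        then show ?thesis
          unfolding S r_def[symmetric] using 3 r small by simp
      qed
    qed
    show "\<exists>\<psi> \<psi>' \<psi>''. C2_data UNIV \<psi> \<psi>' \<psi>'' \<and>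
       (\<forall>x i. x \<notin> {x :: real ^ 'n. 1 / (2 * R) \<le> norm x \<and> norm x \<le> R} \<longrightarrow>
           \<psi> x = 0 \<and> \<psi>' i x = 0 \<and> \<psi>'' i x = 0) \<and>
       (\<forall>x. 0 \<le> \<psi> x) \<and> (\<forall>x. x \<noteq> 0 \<longrightarrow> \<psi> x \<le> \<Phi> (norm x powr - q + h) - \<Phi> h) \<and>
       (\<forall>x. 1 / R \<le> norm x \<and> norm x \<le> R / 2 \<longrightarrow> \<psi> x = \<Phi> (norm x powr - q + h) - \<Phi> h) \<and>
       (\<forall>x. (\<Sum>i\<in>UNIV. \<psi>'' i x) \<le>
          (if R / 2 \<le> norm x \<and> norm x \<le> R then C / R ^ CARD('n)
           else if 1 / (2 * R) \<le> norm x \<and> norm x \<le> 1 / R then C * R\<^sup>2 else 0))"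
    proof (rule exI[of _ "?ext (\<lambda>x. k (norm x))"], rule exI[of _ "\<lambda>i. ?ext (g' i)"],
        rule exI[of _ "\<lambda>i. ?ext (g'' i)"], intro conjI allI impI data bound)
      fix x i assume "x \<notin> {x :: real ^ 'n. 1 / (2 * R) \<le> norm x \<and> norm x \<le> R}"
      then show "?ext (\<lambda>x. k (norm x)) x = 0" "?ext (g' i) x = 0" "?ext (g'' i) x = 0"
        using zero[of x] g'0[of x] g''0[of x] by (auto simp: K_def)
    next
      fix x :: "real ^ 'n"
      show "0 \<le> ?ext (\<lambda>x. k (norm x)) x"
        using k_le[of "norm x"] by auto
      show "?ext (\<lambda>x. k (norm x)) x \<le> \<Phi> (norm x powr - q + h) - \<Phi> h" if "x \<noteq> 0"
        using k_le[of "norm x"] that by (auto simp: A_def N_def)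
      assume x: "1 / R \<le> norm x \<and> norm x \<le> R / 2"
      then have x0: "0 < norm x" using Rpos by (metis less_le_trans zero_less_divide_1_iff)
      have "2 * \<delta> \<le> N (norm x)" using N_anti[of "norm x" "R / 2"] x x0 N_R by simp
      moreover have "N (norm x) \<le> 1 / \<delta>" using N_anti[of "1 / R" "norm x"] x Rpos N_inv by simp
      ultimately have "X (N (norm x)) = 1" by (rule middle)
      then show "?ext (\<lambda>x. k (norm x)) x = \<Phi> (norm x powr - q + h) - \<Phi> h"
        using x0 by (simp add: k_def \<Theta>_def A_def N_def)
    qed
  qed
qed

subsection \<open>Comparison of solutions\<close>

text \<open>As alpha = beta gamma, the power |y|^(-gamma) is invariant under the self-similar
  scaling, so a bound f(y) <= C |y|^(-gamma) passes to all times with the same C. Since beta < 0,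
  the point t^(-beta) x moves towards the origin as t decreases. Far away there are two regimes: if
  t^(-beta) x stays in a fixed ball, the invariant bound applies and |x|^(-gamma) is small;
  otherwise f is small there, and t^(-alpha) <= T^(-alpha).\<close>

lemma self_similar_barrier:
  fixes f :: "real ^ 'n::finite \<Rightarrow> real"
  assumes f: "is_profile m \<alpha> \<beta> l f" and par: "0 < m" "m < 1" "\<beta> < 0" "0 < \<gamma>" "\<alpha> = \<beta> * \<gamma>"
    and T: "0 < T"
  obtains C r where "0 \<le> C" "0 < r"
    "\<And>x t. 0 < norm x \<Longrightarrow> norm x \<le> r \<Longrightarrow> 0 < t \<Longrightarrow> t \<le> T \<Longrightarrow>
       self_similar \<alpha> \<beta> f x t \<le> C * norm x powr - \<gamma>"
    "\<And>e. 0 < e \<Longrightarrow> \<exists>R. \<forall>x t. R \<le> norm x \<and> 0 < t \<and> t \<le> T \<longrightarrow> self_similar \<alpha> \<beta> f x t \<le> e"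
proof -
  define i :: 'n where "i = undefined"
  define k where "k r = f (r *\<^sub>R axis i 1)" for r
  have fk: "f y = k (norm y)" for y
    using f radially_symmetric_eq[of f y i] by (simp add: k_def is_profile_def)
  have \<gamma>: "\<alpha> / \<beta> = \<gamma>" using par by simp
  have k_lim: "(k \<longlongrightarrow> 0) at_top"
    unfolding k_def[abs_def] by (rule profile_tends_to_0[OF f]) (use par \<gamma> in auto)
  have "continuous_on punctured f"
    using C2_data_continuous(1)[OF C_k_on_2_imp_C2_data] f by (auto simp: is_profile_def)
  then have k_cont: "continuous_on {0<..} k"
    unfolding k_def by (rule continuous_on_compose2) (auto intro!: continuous_intros simp: axis_eq_0_iff)
  define A where "A = l powr (1 / ((1 - m) * \<beta>))"
  have "((\<lambda>x. norm x powr \<gamma> * f x) \<longlongrightarrow> A) (at 0)"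
    using f by (simp add: is_profile_def \<gamma> A_def)
  then have "eventually (\<lambda>x. norm x powr \<gamma> * f x < A + 1) (at 0)"
    by (rule order_tendstoD) simp
  then obtain \<rho> where \<rho>: "0 < \<rho>" "\<And>x. x \<noteq> 0 \<Longrightarrow> norm x < \<rho> \<Longrightarrow> norm x powr \<gamma> * f x < A + 1"
    by (auto simp: eventually_at)
  have A0: "0 \<le> A" by (simp add: A_def)
  have near: "f y \<le> (A + 1) * norm y powr - \<gamma>" if "y \<noteq> 0" "norm y < \<rho>" for y
    using \<rho>(2)[OF that] that by (simp add: powr_minus_divide field_simps)
  have scale: "t powr - \<alpha> * (C * norm (t powr - \<beta> *\<^sub>R x) powr - \<gamma>) = C * norm x powr - \<gamma>"
    if "0 < t" for C t and x :: "real ^ 'n"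
  proof -
    have "norm (t powr - \<beta> *\<^sub>R x) powr - \<gamma> = t powr \<alpha> * norm x powr - \<gamma>"
      using that by (simp add: powr_mult powr_powr par(5))
    moreover have "t powr - \<alpha> * t powr \<alpha> = 1"
      using that by (simp add: powr_add[symmetric])
    ultimately show ?thesis
      by (simp add: mult.left_commute mult.assoc[symmetric])
  qed
  have time: "t powr a \<le> T powr a" if "0 < t" "t \<le> T" "0 \<le> a" for t a
    using that by (intro powr_mono2) auto
  \<comment> \<open>Ensures t^(-beta) |x| <= rho/2 for all |x| <= r and t <= T.\<close>
  define r where "r = \<rho> * T powr \<beta> / 2"
  have inner: "self_similar \<alpha> \<beta> f x t \<le> (A + 1) * norm x powr - \<gamma>"
    if x: "0 < norm x" "norm x \<le> r" and t: "0 < t" "t \<le> T" for x t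
  proof -
    have "norm (t powr - \<beta> *\<^sub>R x) \<le> T powr - \<beta> * r"
      using x t time[of t "- \<beta>"] par by (auto intro!: mult_mono)
    also have "T powr - \<beta> * r = \<rho> / 2"
      using T by (simp add: r_def powr_minus field_simps)
    also have "\<dots> < \<rho>" using \<rho> by simp
    finally have "f (t powr - \<beta> *\<^sub>R x) \<le> (A + 1) * norm (t powr - \<beta> *\<^sub>R x) powr - \<gamma>"
      using x t by (intro near) auto
    then have "self_similar \<alpha> \<beta> f x t \<le> t powr - \<alpha> * ((A + 1) * norm (t powr - \<beta> *\<^sub>R x) powr - \<gamma>)"
      unfolding self_similar_def by (intro mult_left_mono) auto
    then show ?thesis by (simp only: scale[OF t(1)])
  qed
  have outer: "\<exists>R. \<forall>x t. R \<le> norm x \<and> 0 < t \<and> t \<le> T \<longrightarrow> self_similar \<alpha> \<beta> f x t \<le> e" if e: "0 < e" for e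
  proof -
    \<comment> \<open>This threshold for the profile becomes \<open>e\<close> after multiplication
      by T^(-alpha), the largest prefactor for t <= T.\<close>
    have "0 < e * T powr \<alpha>" using e T by simp
    then have "eventually (\<lambda>s. k s < e * T powr \<alpha>) at_top"
      using k_lim by (intro order_tendstoD)
    then obtain s0 where s0: "\<And>s. s0 \<le> s \<Longrightarrow> k s < e * T powr \<alpha>"
      by (auto simp: eventually_at_top_linorder)
    define s1 where "s1 = max s0 \<rho>"
    have "compact (k ` {\<rho> / 2..s1})"
      using \<rho> by (intro compact_continuous_image continuous_on_subset[OF k_cont]) auto
    then obtain B where "\<forall>y\<in>k ` {\<rho> / 2..s1}. \<bar>y\<bar> \<le> B"
      by (metis compact_imp_bounded bounded_iff real_norm_def)
    have B: "k s \<le> max B 0" if "\<rho> / 2 \<le> s" "s \<le> s1" for s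
    proof -
      have "\<bar>k s\<bar> \<le> B" using \<open>\<forall>y\<in>_. _\<close> that by auto
      then show ?thesis by simp
    qed
    \<comment> \<open>The first summand covers |y| < rho, the second the compact range up to
      \<open>s1\<close>, where f is bounded and |y|^(-gamma) is at least s1^(-gamma).\<close>
    define C where "C = (A + 1) + max B 0 * s1 powr \<gamma>"
    have mid: "f y \<le> C * norm y powr - \<gamma>" if y: "y \<noteq> 0" "norm y \<le> s1" for y
    proof (cases "norm y < \<rho>")
      case True
      have "(A + 1) * norm y powr - \<gamma> \<le> C * norm y powr - \<gamma>"
        by (intro mult_right_mono) (auto simp: C_def)
      then show ?thesis using near[OF y(1) True] by simp
    next
      case False
      have "f y \<le> max B 0 * 1"
        using B[of "norm y"] False y \<rho>(1) by (simp add: fk)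
      also have "norm y powr \<gamma> * norm y powr - \<gamma> = 1"
        using y by (simp add: powr_add[symmetric])
      then have "max B 0 * 1 \<le> max B 0 * (s1 powr \<gamma> * norm y powr - \<gamma>)"
        using y par mult_right_mono[OF powr_mono2[of \<gamma> "norm y" s1], of "norm y powr - \<gamma>"]
        by (intro mult_left_mono) auto
      also have "\<dots> \<le> C * norm y powr - \<gamma>"
        unfolding C_def using A0 by (simp add: distrib_right mult.assoc)
      finally show ?thesis .
    qed
    have "((\<lambda>s. C * s powr - \<gamma>) \<longlongrightarrow> C * 0) at_top"
      using par by (intro tendsto_intros tendsto_neg_powr filterlim_ident) auto
    then have "eventually (\<lambda>s. C * s powr - \<gamma> < e) at_top"
      using e by (intro order_tendstoD) auto
    then obtain R where R: "\<And>s. R \<le> s \<Longrightarrow> C * s powr - \<gamma> < e"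
      by (auto simp: eventually_at_top_linorder)
    have "self_similar \<alpha> \<beta> f x t \<le> e" if x: "max R 1 \<le> norm x" and t: "0 < t" "t \<le> T" for x t
    proof (cases "norm (t powr - \<beta> *\<^sub>R x) \<le> s1")
      case True
      have "f (t powr - \<beta> *\<^sub>R x) \<le> C * norm (t powr - \<beta> *\<^sub>R x) powr - \<gamma>"
        using x t True by (intro mid) auto
      then have "self_similar \<alpha> \<beta> f x t \<le> t powr - \<alpha> * (C * norm (t powr - \<beta> *\<^sub>R x) powr - \<gamma>)"
        unfolding self_similar_def by (intro mult_left_mono) auto
      also have "\<dots> \<le> e" unfolding scale[OF t(1)] using R[of "norm x"] x by simp
      finally show ?thesis .
    next
      case False
      have "0 \<le> - \<alpha>" using par by (simp add: mult_nonpos_nonneg)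
      have pos: "0 \<le> f (t powr - \<beta> *\<^sub>R x)"
        using f x t by (auto simp: is_profile_def intro!: less_imp_le)
      have "f (t powr - \<beta> *\<^sub>R x) \<le> e * T powr \<alpha>"
        unfolding fk[of "t powr - \<beta> *\<^sub>R x"] using False by (intro less_imp_le s0) (auto simp: s1_def)
      then have "self_similar \<alpha> \<beta> f x t \<le> T powr - \<alpha> * (e * T powr \<alpha>)"
        unfolding self_similar_def using time[OF t \<open>0 \<le> - \<alpha>\<close>] pos by (intro mult_mono) auto
      also have "\<dots> = e" using T by (simp add: powr_minus)
      finally show ?thesis .
    qed
    then show ?thesis by blast
  qed
  have "0 < r" using \<rho> T by (simp add: r_def)
  with A0 show thesis
    by (intro that[OF _ _ inner outer]) auto
qed

section \<open>The differential inequality for a fixed test function\<close>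

lemma is_solution_flux:
  assumes sol: "is_solution m u0 u" and m: "0 < m" and t: "0 < t"
  obtains z' z'' where "C2_data punctured (\<lambda>x. u x t powr m / m) z' z''"
    "\<And>x. x \<noteq> 0 \<Longrightarrow> (\<Sum>i\<in>UNIV. z'' i x) = deriv (u x) t"
proof -
  have "C_k_on 2 punctured (\<lambda>x. u x t)" and pos: "\<And>x. x \<noteq> 0 \<Longrightarrow> 0 < u x t"
    using sol t by (auto simp: is_solution_def C21_on_def)
  note C2 = C_k_on_2_imp_C2_data[OF this(1)]
  have d: "((\<lambda>s. s powr m / m) has_real_derivative s powr (m - 1)) (at s)"
    "((\<lambda>s. s powr (m - 1)) has_real_derivative (m - 1) * s powr (m - 2)) (at s)" if "s \<in> {0<..}" for s
    using that m DERIV_cdivide[OF has_real_derivative_powr[of s m], of m]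
      has_real_derivative_powr[of s "m - 1"] by auto
  have c: "continuous_on {0<..} (\<lambda>s. (m - 1) * s powr (m - 2))"
    by (intro continuous_intros) auto
  note data = C2_data_chain[OF C2 _ d c, simplified]
  show thesis
  proof (rule that[OF data])
    fix x :: "real ^ 'a" assume x: "x \<noteq> 0"
    have "deriv (u x) t = laplacian (\<lambda>y. u y t powr m / m) x"
      using sol x t by (auto simp: is_solution_def)
    also have "\<dots> = (\<Sum>i\<in>UNIV. (m - 1) * u x t powr (m - 2) * (partial_deriv i (\<lambda>x. u x t) x)\<^sup>2 +
        u x t powr (m - 1) * partial_deriv i (partial_deriv i (\<lambda>x. u x t)) x)"
      by (rule C2_data_laplacian[OF data]) (use pos x in \<open>auto simp: open_delete\<close>)
    finally show "(\<Sum>i\<in>UNIV. (m - 1) * u x t powr (m - 2) * (partial_deriv i (\<lambda>x. u x t) x)\<^sup>2 +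
        u x t powr (m - 1) * partial_deriv i (partial_deriv i (\<lambda>x. u x t)) x) = deriv (u x) t" ..
  qed (use pos in auto)
qed

text \<open>Makes the sign factor of Kato's inequality for z = (u^m - v^m) / m agree with the one in
  the time derivative of the positive part of u - v, including the value at equality.\<close>

lemma sgn_powr_diff:
  fixes a b m :: real
  assumes "0 < a" "0 < b" "0 < m"
  shows "sgn (a powr m / m - b powr m / m) = sgn (a - b)"
  using assms powr_less_mono2[of m a b] powr_less_mono2[of m b a]
  by (cases a b rule: linorder_cases) (auto simp: sgn_real_def diff_divide_distrib[symmetric] divide_less_0_iff zero_less_divide_iff)

text \<open>The time derivative of u - v is the Laplacian of z, so the integrand produced by the
  time increment is the left-hand side of Kato's inequality. The interval starts at a positive time
  because the equation is classical only there.\<close>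

lemma test_function_increment:
  fixes u v :: "real ^ 'n::finite \<Rightarrow> real \<Rightarrow> real"
  assumes u: "is_solution m u0 u" and v: "is_solution m v0 v" and m: "0 < m"
    and \<psi>: "C2_data UNIV \<psi> \<psi>' \<psi>''" and K: "compact K" "K \<subseteq> punctured"
    and supp: "\<And>x i. x \<notin> K \<Longrightarrow> \<psi> x = 0 \<and> \<psi>' i x = 0 \<and> \<psi>'' i x = 0" and nonneg: "\<And>x. 0 \<le> \<psi> x"
    and ab: "0 < a" "a \<le> b"
    and E: "\<And>t. t \<in> {a..b} \<Longrightarrow>
       (\<integral>x. max (u x t powr m / m - v x t powr m / m) 0 * (\<Sum>i\<in>UNIV. \<psi>'' i x) \<partial>lborel) \<le> E"
  shows "(\<integral>x. max (u x b - v x b) 0 * \<psi> x \<partial>lborel) - (\<integral>x. max (u x a - v x a) 0 * \<psi> x \<partial>lborel) \<le> E * (b - a)"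
proof (rule weighted_positive_part_increment[OF ab(2) K(1), where w' = "\<lambda>x t. deriv (u x) t - deriv (v x) t"])
  have sub: "K \<times> {a..b} \<subseteq> punctured \<times> {0<..}"
    using K ab by auto
  have cu: "continuous_on (K \<times> {a..b}) (\<lambda>(x, t). u x t)" "continuous_on (K \<times> {a..b}) (\<lambda>(x, t). deriv (u x) t)"
    and cv: "continuous_on (K \<times> {a..b}) (\<lambda>(x, t). v x t)" "continuous_on (K \<times> {a..b}) (\<lambda>(x, t). deriv (v x) t)"
    using u v by (auto simp: is_solution_def C21_on_def intro: continuous_on_subset[OF _ sub])
  show "continuous_on (K \<times> {a..b}) (\<lambda>(x, t). u x t - v x t)"
    "continuous_on (K \<times> {a..b}) (\<lambda>(x, t). deriv (u x) t - deriv (v x) t)"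
    using continuous_on_diff[OF cu(1) cv(1)] continuous_on_diff[OF cu(2) cv(2)] by (simp_all add: case_prod_unfold)
  show "((\<lambda>t. u x t - v x t) has_real_derivative deriv (u x) t - deriv (v x) t) (at t)"
    if "x \<in> K" "t \<in> {a..b}" for x t
  proof -
    have "x \<in> punctured" "t \<in> {0<..}" using that K ab by auto
    then have "u x differentiable (at t)" "v x differentiable (at t)"
      using u v by (simp_all add: is_solution_def C21_on_def)
    then show ?thesis
      by (intro DERIV_diff) (auto simp: DERIV_deriv_iff_real_differentiable)
  qed
  show "continuous_on UNIV \<psi>" by (rule C2_data_continuous[OF \<psi>])
  show "\<psi> x = 0" if "x \<notin> K" for x using supp that by blast
  fix t assume t: "t \<in> {a..b}"
  then have t0: "0 < t" using ab by simp
  obtain y' y'' where y: "C2_data punctured (\<lambda>x. u x t powr m / m) y' y''"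
    "\<And>x. x \<noteq> 0 \<Longrightarrow> (\<Sum>i\<in>UNIV. y'' i x) = deriv (u x) t"
    by (rule is_solution_flux[OF u m t0]) (rule that)
  obtain z' z'' where z: "C2_data punctured (\<lambda>x. v x t powr m / m) z' z''"
    "\<And>x. x \<noteq> 0 \<Longrightarrow> (\<Sum>i\<in>UNIV. z'' i x) = deriv (v x) t"
    by (rule is_solution_flux[OF v m t0]) (rule that)
  have "(1 + sgn (u x t - v x t)) / 2 * ((deriv (u x) t - deriv (v x) t) * \<psi> x)
     = (1 + sgn (u x t powr m / m - v x t powr m / m)) / 2 * ((\<Sum>i\<in>UNIV. y'' i x - z'' i x) * \<psi> x)" for x
  proof (cases "x \<in> K")
    case True
    then have "x \<in> punctured" using K by auto
    then have "0 < u x t" "0 < v x t" "x \<noteq> 0"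
      using u v t0 by (auto simp: is_solution_def)
    then show ?thesis
      using m by (simp add: sgn_powr_diff sum_subtractf y z)
  qed (use supp in auto)
  then have "(\<integral>x. (1 + sgn (u x t - v x t)) / 2 * ((deriv (u x) t - deriv (v x) t) * \<psi> x) \<partial>lborel)
     = (\<integral>x. (1 + sgn (u x t powr m / m - v x t powr m / m)) / 2 * ((\<Sum>i\<in>UNIV. y'' i x - z'' i x) * \<psi> x) \<partial>lborel)"
    by (rule Bochner_Integration.integral_cong[OF refl])
  also have "\<dots> \<le> (\<integral>x. max (u x t powr m / m - v x t powr m / m) 0 * (\<Sum>i\<in>UNIV. \<psi>'' i x) \<partial>lborel)"
    by (rule kato_inequality[OF C2_data_diff[OF y(1) z(1)] \<psi> _ K supp nonneg]) (auto simp: open_delete)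
  also have "\<dots> \<le> E" using t by (rule E)
  finally show "(\<integral>x. (1 + sgn (u x t - v x t)) / 2 * ((deriv (u x) t - deriv (v x) t) * \<psi> x) \<partial>lborel) \<le> E" .
qed

section \<open>Passage to the initial time\<close>

lemma is_solution_measurable:
  assumes sol: "is_solution m u0 u" and K: "compact K" "K \<subseteq> punctured"
  shows "(\<lambda>x. indicator K x * u0 x) \<in> borel_measurable lebesgue"
    and "0 < t \<Longrightarrow> continuous_on K (\<lambda>x. u x t)"
    and "0 < t \<Longrightarrow> (\<lambda>x. indicator K x * u x t) \<in> borel_measurable lebesgue"
proof -
  have "u0 absolutely_integrable_on K"
    using sol K by (auto simp: is_solution_def L1_loc_def)
  then show "(\<lambda>x. indicator K x * u0 x) \<in> borel_measurable lebesgue"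
    unfolding set_integrable_def using borel_measurable_integrable by fastforce
  show c: "continuous_on K (\<lambda>x. u x t)" if "0 < t"
  proof -
    have "C_k_on 2 punctured (\<lambda>x. u x t)"
      using sol that by (auto simp: is_solution_def C21_on_def)
    from C2_data_continuous(1)[OF C_k_on_2_imp_C2_data[OF this]] show ?thesis
      using K(2) by (rule continuous_on_subset)
  qed
  assume "0 < t"
  have "(\<lambda>x. indicator K x *\<^sub>R u x t) \<in> borel_measurable borel"
    using K by (intro borel_measurable_continuous_on_indicator c \<open>0 < t\<close>) (auto intro: borel_compact)
  then show "(\<lambda>x. indicator K x * u x t) \<in> borel_measurable lebesgue"
    by (auto intro: measurable_completion)
qed

text \<open>The bound \<open>E\<close> holds on all of (0, b], so the initial time \<open>a\<close>
  may be chosen so small that both solutions are within e/2 of their initial values in L^1(K). The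
  positive part is Lipschitz with constant 1 and \<open>\<psi> \<le> 1\<close>, hence replacing time
  \<open>a\<close> by the initial values costs at most e.\<close>

lemma test_function_estimate:
  fixes u v :: "real ^ 'n::finite \<Rightarrow> real \<Rightarrow> real"
  assumes u: "is_solution m u0 u" and v: "is_solution m v0 v" and m: "0 < m"
    and \<psi>: "C2_data UNIV \<psi> \<psi>' \<psi>''" and K: "compact K" "K \<subseteq> punctured"
    and supp: "\<And>x i. x \<notin> K \<Longrightarrow> \<psi> x = 0 \<and> \<psi>' i x = 0 \<and> \<psi>'' i x = 0" and \<psi>01: "\<And>x. 0 \<le> \<psi> x \<and> \<psi> x \<le> 1"
    and b: "0 < b" and E0: "0 \<le> E"
    and E: "\<And>t. 0 < t \<Longrightarrow> t \<le> b \<Longrightarrow>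
       (\<integral>x. max (u x t powr m / m - v x t powr m / m) 0 * (\<Sum>i\<in>UNIV. \<psi>'' i x) \<partial>lborel) \<le> E"
  shows "(\<integral>\<^sup>+x. ennreal (max (u x b - v x b) 0 * \<psi> x) \<partial>lebesgue)
       \<le> (\<integral>\<^sup>+x. ennreal (max (u0 x - v0 x) 0 * \<psi> x) \<partial>lebesgue) + ennreal (E * b)"
proof (rule ennreal_le_epsilon)
  fix e :: real assume e: "0 < e"
  have eq: "(\<integral>\<^sup>+x. ennreal (max (u x t - v x t) 0 * \<psi> x) \<partial>lebesgue) = ennreal (\<integral>x. max (u x t - v x t) 0 * \<psi> x \<partial>lborel)"
    if "0 < t" for t
  proof -
    have "continuous_on K (\<lambda>x. max (u x t - v x t) 0 * \<psi> x)"
      by (intro continuous_intros is_solution_measurable(2)[OF u K that] is_solution_measurable(2)[OF v K that]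
          continuous_on_subset[OF C2_data_continuous(1)[OF \<psi>]]) auto
    then have "integrable lborel (\<lambda>x. indicator K x *\<^sub>R (max (u x t - v x t) 0 * \<psi> x))"
      by (rule borel_integrable_compact[OF K(1)])
    moreover have "(\<lambda>x. indicator K x *\<^sub>R (max (u x t - v x t) 0 * \<psi> x)) = (\<lambda>x. max (u x t - v x t) 0 * \<psi> x)"
      using supp by (auto simp: indicator_def fun_eq_iff)
    ultimately show ?thesis
      unfolding nn_integral_completion using \<psi>01 by (intro nn_integral_eq_integral) auto
  qed
  have lim: "eventually (\<lambda>t. (\<integral>\<^sup>+x\<in>K. ennreal \<bar>w x t - w0 x\<bar> \<partial>lebesgue) < ennreal (e / 2)) (at_right 0)"
    if "is_solution m w0 w" for w w0
    using that K e by (intro order_tendstoD(2)[of _ 0]) (auto simp: is_solution_def)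
  have "eventually (\<lambda>t. 0 < t \<and> t < b) (at_right 0)"
    using b by (auto simp: eventually_at_right_field)
  with lim[OF u] lim[OF v] have "eventually (\<lambda>t. (0 < t \<and> t < b) \<and>
      (\<integral>\<^sup>+x\<in>K. ennreal \<bar>u x t - u0 x\<bar> \<partial>lebesgue) < ennreal (e / 2) \<and>
      (\<integral>\<^sup>+x\<in>K. ennreal \<bar>v x t - v0 x\<bar> \<partial>lebesgue) < ennreal (e / 2)) (at_right 0)"
    by eventually_elim auto
  from eventually_happens'[OF _ this] obtain a where a: "0 < a" "a < b"
    and au: "(\<integral>\<^sup>+x\<in>K. ennreal \<bar>u x a - u0 x\<bar> \<partial>lebesgue) < ennreal (e / 2)"
    and av: "(\<integral>\<^sup>+x\<in>K. ennreal \<bar>v x a - v0 x\<bar> \<partial>lebesgue) < ennreal (e / 2)"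
    by auto
  have "(\<integral>x. max (u x b - v x b) 0 * \<psi> x \<partial>lborel) - (\<integral>x. max (u x a - v x a) 0 * \<psi> x \<partial>lborel) \<le> E * (b - a)"
    by (rule test_function_increment[OF u v m \<psi> K supp]) (use \<psi>01 a E in auto)
  also have "\<dots> \<le> E * b"
    using a E0 by (intro mult_left_mono) auto
  finally have "(\<integral>x. max (u x b - v x b) 0 * \<psi> x \<partial>lborel) \<le> (\<integral>x. max (u x a - v x a) 0 * \<psi> x \<partial>lborel) + E * b"
    by simp
  then have "(\<integral>\<^sup>+x. ennreal (max (u x b - v x b) 0 * \<psi> x) \<partial>lebesgue)
      \<le> (\<integral>\<^sup>+x. ennreal (max (u x a - v x a) 0 * \<psi> x) \<partial>lebesgue) + ennreal (E * b)"
  proof -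
    assume le: "(\<integral>x. max (u x b - v x b) 0 * \<psi> x \<partial>lborel) \<le> (\<integral>x. max (u x a - v x a) 0 * \<psi> x \<partial>lborel) + E * b"
    have "0 \<le> (\<integral>x. max (u x a - v x a) 0 * \<psi> x \<partial>lborel)"
      using \<psi>01 by (intro Bochner_Integration.integral_nonneg) auto
    then show ?thesis
      unfolding eq[OF b] eq[OF a(1)] using ennreal_leI[OF le] E0 b by simp
  qed
  also have "(\<integral>\<^sup>+x. ennreal (max (u x a - v x a) 0 * \<psi> x) \<partial>lebesgue)
      \<le> (\<integral>\<^sup>+x. ennreal (max (u0 x - v0 x) 0 * \<psi> x) + (ennreal \<bar>u x a - u0 x\<bar> * indicator K x
           + ennreal \<bar>v x a - v0 x\<bar> * indicator K x) \<partial>lebesgue)"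
  proof (rule nn_integral_mono)
    fix x
    show "ennreal (max (u x a - v x a) 0 * \<psi> x) \<le> ennreal (max (u0 x - v0 x) 0 * \<psi> x)
       + (ennreal \<bar>u x a - u0 x\<bar> * indicator K x + ennreal \<bar>v x a - v0 x\<bar> * indicator K x)"
    proof (cases "x \<in> K")
      case True
      have "max (u x a - v x a) 0 * \<psi> x \<le> (max (u0 x - v0 x) 0 + (\<bar>u x a - u0 x\<bar> + \<bar>v x a - v0 x\<bar>)) * \<psi> x"
        using \<psi>01 by (intro mult_right_mono) auto
      also have "\<dots> \<le> max (u0 x - v0 x) 0 * \<psi> x + (\<bar>u x a - u0 x\<bar> + \<bar>v x a - v0 x\<bar>)"
        using \<psi>01[of x] by (subst distrib_right) (intro add_left_mono mult_left_le, auto)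
      finally have "ennreal (max (u x a - v x a) 0 * \<psi> x)
          \<le> ennreal (max (u0 x - v0 x) 0 * \<psi> x + (\<bar>u x a - u0 x\<bar> + \<bar>v x a - v0 x\<bar>))"
        by (rule ennreal_leI)
      then show ?thesis
        using True \<psi>01[of x] by (simp add: ennreal_plus)
    qed (use supp in auto)
  qed
  also have "\<dots> = (\<integral>\<^sup>+x. ennreal (max (u0 x - v0 x) 0 * \<psi> x) \<partial>lebesgue)
      + ((\<integral>\<^sup>+x\<in>K. ennreal \<bar>u x a - u0 x\<bar> \<partial>lebesgue) + (\<integral>\<^sup>+x\<in>K. ennreal \<bar>v x a - v0 x\<bar> \<partial>lebesgue))"
  proof -
    note mu = is_solution_measurable[OF u K] and mv = is_solution_measurable[OF v K]
    have m\<psi>: "\<psi> \<in> borel_measurable lebesgue"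
      using borel_measurable_continuous_onI[OF C2_data_continuous(1)[OF \<psi>]] by (auto intro: measurable_completion)
    have "(\<lambda>x. ennreal (max (indicator K x * u0 x - indicator K x * v0 x) 0 * \<psi> x)) \<in> borel_measurable lebesgue"
      using mu(1) mv(1) m\<psi> by measurable
    moreover have "(\<lambda>x. ennreal (max (indicator K x * u0 x - indicator K x * v0 x) 0 * \<psi> x))
        = (\<lambda>x. ennreal (max (u0 x - v0 x) 0 * \<psi> x))"
      using supp by (auto simp: indicator_def fun_eq_iff)
    ultimately have 1: "(\<lambda>x. ennreal (max (u0 x - v0 x) 0 * \<psi> x)) \<in> borel_measurable lebesgue"
      by simp
    have 2: "(\<lambda>x. ennreal \<bar>w x a - w0 x\<bar> * indicator K x) \<in> borel_measurable lebesgue"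
      if "(\<lambda>x. indicator K x * w x a) \<in> borel_measurable lebesgue"
         "(\<lambda>x. indicator K x * w0 x) \<in> borel_measurable lebesgue" for w :: "real ^ 'n \<Rightarrow> real \<Rightarrow> real" and w0
    proof -
      have "(\<lambda>x. ennreal \<bar>indicator K x * w x a - indicator K x * w0 x\<bar>) \<in> borel_measurable lebesgue"
        using that by measurable
      moreover have "(\<lambda>x. ennreal \<bar>indicator K x * w x a - indicator K x * w0 x\<bar>)
          = (\<lambda>x. ennreal \<bar>w x a - w0 x\<bar> * indicator K x)"
        by (auto simp: indicator_def fun_eq_iff)
      ultimately show ?thesis by simp
    qed
    show ?thesis
      using 1 2[of u u0, OF mu(3)[OF a(1)] mu(1)] 2[of v v0, OF mv(3)[OF a(1)] mv(1)]
      by (simp add: nn_integral_add)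
  qed
  also have "\<dots> \<le> (\<integral>\<^sup>+x. ennreal (max (u0 x - v0 x) 0 * \<psi> x) \<partial>lebesgue) + (ennreal (e / 2) + ennreal (e / 2))"
    using au av by (intro add_mono order_refl) auto
  also have "ennreal (e / 2) + ennreal (e / 2) = ennreal e"
    using e by (subst ennreal_plus[symmetric]) auto
  finally show "(\<integral>\<^sup>+x. ennreal (max (u x b - v x b) 0 * \<psi> x) \<partial>lebesgue)
      \<le> (\<integral>\<^sup>+x. ennreal (max (u0 x - v0 x) 0 * \<psi> x) \<partial>lebesgue) + ennreal (E * b) + ennreal e"
    by (simp add: add_ac)
qed

text \<open>Fatou's lemma with slack: the integrals only have to come below \<open>B + e\<close>
  eventually, which absorbs the cutoff errors. \<open>B\<close> may be infinite.\<close>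

lemma nn_integral_limit_le:
  fixes F :: "nat \<Rightarrow> 'a \<Rightarrow> ennreal"
  assumes meas: "\<And>k. F k \<in> borel_measurable M" and lim: "AE x in M. (\<lambda>k. F k x) \<longlonglongrightarrow> G x"
    and bound: "\<And>e. 0 < e \<Longrightarrow> eventually (\<lambda>k. (\<integral>\<^sup>+x. F k x \<partial>M) \<le> B + ennreal e) sequentially"
  shows "(\<integral>\<^sup>+x. G x \<partial>M) \<le> B"
proof (rule ennreal_le_epsilon)
  fix e :: real assume e: "0 < e"
  have "(\<integral>\<^sup>+x. G x \<partial>M) = (\<integral>\<^sup>+x. liminf (\<lambda>k. F k x) \<partial>M)"
    using lim by (intro nn_integral_cong_AE) (auto elim!: eventually_mono simp: lim_imp_Liminf)
  also have "\<dots> \<le> liminf (\<lambda>k. \<integral>\<^sup>+x. F k x \<partial>M)"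
    by (rule nn_integral_liminf[OF meas])
  also have "\<dots> \<le> limsup (\<lambda>k. \<integral>\<^sup>+x. F k x \<partial>M)"
    by (rule Liminf_le_Limsup) simp
  also have "\<dots> \<le> B + ennreal e"
    by (rule Limsup_bounded[OF bound[OF e]])
  finally show "(\<integral>\<^sup>+x. G x \<partial>M) \<le> B + ennreal e" .
qed

section \<open>Removal of the cutoff and of the shift\<close>

lemma AE_lebesgue_nonzero: "AE x in lebesgue. x \<noteq> (0 :: real ^ 'n::finite)"
  by (rule AE_completion[OF AE_lborel_singleton])

lemma compact_annulus:
  fixes a b :: real
  assumes "0 < a"
  shows "compact {x :: real ^ 'n::finite. a \<le> norm x \<and> norm x \<le> b}"
    "{x :: real ^ 'n. a \<le> norm x \<and> norm x \<le> b} \<subseteq> punctured"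
proof -
  have "{x :: real ^ 'n. a \<le> norm x \<and> norm x \<le> b} = cball 0 b - ball 0 a"
    by auto
  then show "compact {x :: real ^ 'n. a \<le> norm x \<and> norm x \<le> b}"
    by (simp add: compact_diff)
qed (use assms in auto)

text \<open>Because v^m >= 0, the positive part of z is at most u^m / m, so an upper barrier for
  \<open>u\<close> controls the error. Exchanging the two solutions later gives the negative
  part.\<close>

lemma one_sided_contraction:
  fixes u v :: "real ^ 'n::finite \<Rightarrow> real \<Rightarrow> real"
  assumes n: "3 \<le> CARD('n)" and m: "0 < m" "m < 1" and \<mu>: "0 < \<mu>" "\<mu> < real CARD('n) - 2"
    and \<beta>: "\<beta> < 0" and \<gamma>: "0 < \<gamma>" "\<alpha> = \<beta> * \<gamma>" "\<gamma> * m < real CARD('n) - 2"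
    and f: "is_profile m \<alpha> \<beta> l f"
    and u: "is_solution m u0 u" and v: "is_solution m v0 v"
    and le: "\<And>x t. x \<in> punctured \<Longrightarrow> 0 < t \<Longrightarrow> u x t \<le> self_similar \<alpha> \<beta> f x t"
    and \<phi>: "is_weight \<mu> \<phi>" and b: "0 < b"
  shows "(\<integral>\<^sup>+x. ennreal (max (u x b - v x b) 0 * \<phi> x) \<partial>lebesgue)
       \<le> (\<integral>\<^sup>+x. ennreal (max (u0 x - v0 x) 0 * \<phi> x) \<partial>lebesgue)" (is "_ \<le> ?Y")
proof -
  define q where "q = real CARD('n) - 2"
  obtain \<Phi> \<Phi>' \<Phi>'' where \<phi>_eq: "\<And>x. x \<noteq> 0 \<Longrightarrow> \<phi> x = \<Phi> (norm x powr - q)"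
    and \<Phi>: "\<And>s. 0 < s \<Longrightarrow> (\<Phi> has_real_derivative \<Phi>' s) (at s)"
    and \<Phi>': "\<And>s. 0 < s \<Longrightarrow> (\<Phi>' has_real_derivative \<Phi>'' s) (at s)"
    and \<Phi>'': "continuous_on {0<..} \<Phi>''"
    and mono: "\<And>s. 0 < s \<Longrightarrow> 0 \<le> \<Phi>' s" and concave: "\<And>s. 0 < s \<Longrightarrow> \<Phi>'' s \<le> 0"
    and flat: "\<And>s. 1 \<le> s \<Longrightarrow> \<Phi>' s = 0"
    and \<Phi>_0: "(\<Phi> \<longlongrightarrow> 0) (at_right 0)" and \<Phi>_le: "\<And>s. 0 < s \<Longrightarrow> \<Phi> s \<le> 1"
    by (rule weight_concave_profile[OF \<phi> n \<mu>, folded q_def]) (rule that)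
  have \<Phi>_mono: "\<Phi> s \<le> \<Phi> t" if "0 < s" "s \<le> t" for s t
    using that \<Phi> mono by (intro DERIV_nonneg_imp_nondecreasing[OF that(2)]) (meson less_le_trans)
  have \<Phi>_nonneg: "0 \<le> \<Phi> s" if "0 < s" for s
  proof (rule tendsto_upperbound[OF \<Phi>_0])
    show "eventually (\<lambda>t. \<Phi> t \<le> \<Phi> s) (at_right 0)"
      using \<Phi>_mono that unfolding eventually_at_right_field by (auto intro!: exI[of _ s])
  qed simp
  \<comment> \<open>Subadditivity of a concave function with limit 0 at the origin: Phi(s + t) -
    Phi(t) is nonincreasing in t, and its limit as t decreases to 0 is Phi(s).\<close>
  have \<Phi>_subadd: "\<Phi> (s + h) - \<Phi> h \<le> \<Phi> s" if sh: "0 < s" "0 < h" for s h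
  proof (rule tendsto_lowerbound)
    have "isCont \<Phi> s" using DERIV_isCont[OF \<Phi>[OF sh(1)]] .
    moreover have "((\<lambda>t. s + t) \<longlongrightarrow> s + 0) (at_right 0)" by (intro tendsto_intros)
    ultimately have "((\<lambda>t. \<Phi> (s + t)) \<longlongrightarrow> \<Phi> s) (at_right 0)"
      by (simp add: isCont_tendsto_compose)
    from tendsto_diff[OF this \<Phi>_0] show "((\<lambda>t. \<Phi> (s + t) - \<Phi> t) \<longlongrightarrow> \<Phi> s) (at_right 0)"
      by simp
    have "\<Phi> (s + h) - \<Phi> h \<le> \<Phi> (s + t) - \<Phi> t" if t: "0 < t" "t < h" for t
    proof (rule DERIV_nonpos_imp_nonincreasing[of t h])
      fix x assume x: "t \<le> x" "x \<le> h"
      have "((\<lambda>x. \<Phi> (s + x) - \<Phi> x) has_real_derivative \<Phi>' (s + x) * 1 - \<Phi>' x) (at x)"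
        using x t sh by (intro DERIV_diff DERIV_chain2[OF \<Phi>] \<Phi>) (auto intro!: derivative_eq_intros)
      moreover have "\<Phi>' (s + x) \<le> \<Phi>' x"
        using \<Phi>' concave x t sh by (intro DERIV_nonpos_imp_nonincreasing[of x "s + x" \<Phi>']) (auto, meson less_le_trans)
      ultimately show "\<exists>y. ((\<lambda>x. \<Phi> (s + x) - \<Phi> x) has_real_derivative y) (at x) \<and> y \<le> 0"
        by auto
    qed (use t in auto)
    then show "eventually (\<lambda>t. \<Phi> (s + h) - \<Phi> h \<le> \<Phi> (s + t) - \<Phi> t) (at_right 0)"
      using sh unfolding eventually_at_right_field by blast
  qed simp

  obtain C0 r0 where C0: "0 \<le> C0" and r0: "0 < r0"
    and near: "\<And>x t. 0 < norm x \<Longrightarrow> norm x \<le> r0 \<Longrightarrow> 0 < t \<Longrightarrow> t \<le> b \<Longrightarrow>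
       self_similar \<alpha> \<beta> f x t \<le> C0 * norm x powr - \<gamma>"
    and far: "\<And>e. 0 < e \<Longrightarrow> \<exists>R. \<forall>x t. R \<le> norm x \<and> 0 < t \<and> t \<le> b \<longrightarrow> self_similar \<alpha> \<beta> f x t \<le> e"
    by (rule self_similar_barrier[OF f m \<beta> \<gamma>(1,2) b]) (rule that)
  define D where "D = C0 powr m / m"
  have D: "0 \<le> D" using m by (simp add: D_def)
  define Z where "Z t x = max (u x t powr m / m - v x t powr m / m) 0" for t x
  have u_pos: "0 < u x t" if "x \<noteq> 0" "0 < t" for x t
    using u that by (auto simp: is_solution_def)
  have Z_le: "0 \<le> Z t x" "Z t x \<le> s powr m / m" if "x \<noteq> 0" "0 < t" "self_similar \<alpha> \<beta> f x t \<le> s" for s t x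
  proof -
    have "u x t powr m \<le> s powr m"
      using u_pos[OF that(1,2)] le[of x t] that m by (intro powr_mono2) auto
    then have "u x t powr m / m \<le> s powr m / m"
      using m by (intro divide_right_mono) auto
    moreover have "0 \<le> v x t powr m / m" "0 \<le> s powr m / m"
      using m by auto
    ultimately show "0 \<le> Z t x" "Z t x \<le> s powr m / m"
      by (auto simp: Z_def)
  qed
  have Z_near: "Z t x \<le> D * norm x powr - (\<gamma> * m)" if "x \<noteq> 0" "norm x \<le> r0" "0 < t" "t \<le> b" for t x
    using Z_le(2)[OF that(1,3) near] that C0 by (simp add: D_def powr_mult powr_powr)
  have Z_far: "\<exists>R. \<forall>x t. x \<noteq> 0 \<and> R \<le> norm x \<and> 0 < t \<and> t \<le> b \<longrightarrow> Z t x \<le> e" if "0 < e" for e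
  proof -
    define s where "s = (m * e) powr (1 / m)"
    have s: "0 < s" "s powr m / m = e" using that m by (auto simp: s_def powr_powr)
    show ?thesis using far[OF s(1)] Z_le(2)[of _ _ s] unfolding s(2) by blast
  qed
  have meas_K: "continuous_on K (\<lambda>x. max (u x b - v x b) 0)" if "compact K" "K \<subseteq> punctured" for K
    by (intro continuous_intros is_solution_measurable(2)[OF u that b] is_solution_measurable(2)[OF v that b])
  have N_cont: "continuous_on punctured (\<lambda>x :: real ^ 'n. \<Phi> (norm x powr - q + h) - \<Phi> h)" if "0 < h" for h
  proof -
    have "continuous_on {0<..} \<Phi>"
      using DERIV_isCont[OF \<Phi>] by (simp add: continuous_at_imp_continuous_on)
    moreover have "continuous_on punctured (\<lambda>x :: real ^ 'n. norm x powr - q + h)"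
      by (intro continuous_intros) auto
    moreover have "(\<lambda>x :: real ^ 'n. norm x powr - q + h) ` punctured \<subseteq> {0<..}"
      using that by (auto intro: add_nonneg_pos)
    ultimately have "continuous_on punctured (\<lambda>x :: real ^ 'n. \<Phi> (norm x powr - q + h))"
      by (rule continuous_on_compose2)
    then show ?thesis
      by (intro continuous_on_diff continuous_on_const)
  qed

  have shifted: "(\<integral>\<^sup>+x. ennreal (max (u x b - v x b) 0 * (\<Phi> (norm x powr - q + h) - \<Phi> h)) \<partial>lebesgue) \<le> ?Y"
    if h: "0 < h" for h
  proof -
    define \<Psi> where "\<Psi> x = \<Phi> (norm x powr - q + h) - \<Phi> h" for x :: "real ^ 'n"
    have \<Psi>_le: "\<Psi> x \<le> \<phi> x" "\<Psi> x \<le> 1" if "x \<noteq> 0" for x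
    proof -
      have N: "0 < norm x powr - q" using that by simp
      show "\<Psi> x \<le> \<phi> x"
        using \<Phi>_subadd[OF N h] that by (simp add: \<Psi>_def \<phi>_eq)
      then show "\<Psi> x \<le> 1"
        using \<Phi>_le[OF N] that by (simp add: \<phi>_eq)
    qed
    have range: "0 \<le> \<Phi> s \<and> \<Phi> s \<le> 1" if "0 < s" for s
      using \<Phi>_nonneg \<Phi>_le that by simp
    obtain C where C: "0 \<le> C" and test: "\<And>R. 2 \<le> R \<Longrightarrow> \<exists>\<psi> \<psi>' \<psi>''. C2_data UNIV \<psi> \<psi>' \<psi>'' \<and>
       (\<forall>x i. x \<notin> {x :: real ^ 'n. 1 / (2 * R) \<le> norm x \<and> norm x \<le> R} \<longrightarrow>
           \<psi> x = 0 \<and> \<psi>' i x = 0 \<and> \<psi>'' i x = 0) \<and>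
       (\<forall>x. 0 \<le> \<psi> x) \<and> (\<forall>x. x \<noteq> 0 \<longrightarrow> \<psi> x \<le> \<Psi> x) \<and>
       (\<forall>x. 1 / R \<le> norm x \<and> norm x \<le> R / 2 \<longrightarrow> \<psi> x = \<Psi> x) \<and>
       (\<forall>x. (\<Sum>i\<in>UNIV. \<psi>'' i x) \<le>
          (if R / 2 \<le> norm x \<and> norm x \<le> R then C / R ^ CARD('n)
           else if 1 / (2 * R) \<le> norm x \<and> norm x \<le> 1 / R then C * R\<^sup>2 else 0))"
      by (rule cutoff_test_function[OF n h \<Phi> \<Phi>' \<Phi>'' mono concave flat range, folded q_def,
            folded \<Psi>_def]) (assumption | rule that)+
    define \<omega> where "\<omega> = unit_ball_vol (real CARD('n))"
    have \<omega>: "0 \<le> \<omega>" by (simp add: \<omega>_def)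
    \<comment> \<open>\<open>L\<close> stands for the Laplacian of the test function. An upper bound
      for it is enough because \<open>Z\<close> is nonnegative, and the threshold for
      \<open>R\<close> does not depend on t.\<close>
    have error: "eventually (\<lambda>R. \<forall>L t. 0 < t \<and> t \<le> b \<and> (\<forall>x. L x \<le>
          (if R / 2 \<le> norm x \<and> norm x \<le> R then C / R ^ CARD('n)
           else if 1 / (2 * R) \<le> norm x \<and> norm x \<le> 1 / R then C * R\<^sup>2 else 0)) \<longrightarrow>
         (\<integral>x. Z t x * L x \<partial>lborel) \<le> e) at_top" if e: "0 < e" for e
    proof -
      \<comment> \<open>The outer shell contributes at most epsilon * (C / R^n) * (omega R^n) =
        epsilon * C * omega, free of \<open>R\<close>. The added 1 keeps the divisor positive when C
        or omega is 0.\<close>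
      define c where "c = C * \<omega> + 1"
      have c: "0 < c" "C * \<omega> \<le> c" using C \<omega> by (auto simp: c_def add_nonneg_pos)
      define \<epsilon> where "\<epsilon> = e / (2 * c)"
      have \<epsilon>: "0 < \<epsilon>" using e c by (simp add: \<epsilon>_def)
      have "\<epsilon> * (C * \<omega>) \<le> \<epsilon> * c"
        using \<epsilon> c by (intro mult_left_mono) auto
      also have "\<dots> = e / 2" using c by (simp add: \<epsilon>_def)
      finally have \<epsilon>_le: "\<epsilon> * (C * \<omega>) \<le> e / 2" .
      obtain R0 where R0: "\<And>x t. x \<noteq> 0 \<Longrightarrow> R0 \<le> norm x \<Longrightarrow> 0 < t \<Longrightarrow> t \<le> b \<Longrightarrow> Z t x \<le> \<epsilon>"
        using Z_far[OF \<epsilon>] by blast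
      \<comment> \<open>The inner error D (2R)^(gamma m) * C R^2 * omega R^(-n), rewritten. Its
        exponent gamma m - (n - 2) is negative by the upper bound on gamma.\<close>
      define H where "H R = D * C * \<omega> * 2 powr (\<gamma> * m) * R powr (\<gamma> * m - q)" for R :: real
      have "(H \<longlongrightarrow> D * C * \<omega> * 2 powr (\<gamma> * m) * 0) at_top"
        unfolding H_def using \<gamma> by (intro tendsto_intros tendsto_neg_powr filterlim_ident) (auto simp: q_def)
      then have "eventually (\<lambda>R. H R < e / 2) at_top"
        using e by (intro order_tendstoD) auto
      then show ?thesis
        using eventually_ge_at_top[of 2] eventually_ge_at_top[of "2 * R0"] eventually_ge_at_top[of "1 / r0"]
      proof eventually_elim
        case (elim R)
        have R: "0 < R" "1 / R \<le> r0"
          using elim r0 by (auto simp: field_simps)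
        show ?case
        proof (intro allI impI, elim conjE)
          fix L :: "real ^ 'n \<Rightarrow> real" and t
          assume t: "0 < t" "t \<le> b" and L: "\<forall>x. L x \<le>
          (if R / 2 \<le> norm x \<and> norm x \<le> R then C / R ^ CARD('n)
           else if 1 / (2 * R) \<le> norm x \<and> norm x \<le> 1 / R then C * R\<^sup>2 else 0)"
          define X1 where "X1 = \<epsilon> * (C / R ^ CARD('n))"
          define X2 where "X2 = D * (2 * R) powr (\<gamma> * m) * (C * R\<^sup>2)"
          have X: "0 \<le> X1" "0 \<le> X2"
            using \<epsilon> C D R by (auto simp: X1_def X2_def)
          \<comment> \<open>Full balls replace the shells: their volumes have the same order in
            \<open>R\<close> and a closed formula.\<close>
          have ptw: "Z t x * L x \<le> X1 * indicator (cball 0 R) x + X2 * indicator (cball 0 (1 / R)) x" for x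
          proof -
            have nonneg: "0 \<le> X1 * indicator (cball 0 R) x + X2 * indicator (cball 0 (1 / R)) x"
              using X by (auto simp: indicator_def)
            have Z0: "0 \<le> Z t x" by (simp add: Z_def)
            consider (out) "R / 2 \<le> norm x \<and> norm x \<le> R"
              | (inn) "\<not> (R / 2 \<le> norm x \<and> norm x \<le> R)" "1 / (2 * R) \<le> norm x \<and> norm x \<le> 1 / R"
              | (mid) "\<not> (R / 2 \<le> norm x \<and> norm x \<le> R)" "\<not> (1 / (2 * R) \<le> norm x \<and> norm x \<le> 1 / R)"
              by blast
            then show ?thesis
            proof cases
              case out
              then have x: "x \<noteq> 0" using R by auto
              have "Z t x * L x \<le> \<epsilon> * (C / R ^ CARD('n))"
              proof (rule order_trans[OF mult_left_mono mult_right_mono])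
                show "L x \<le> C / R ^ CARD('n)" using L[rule_format, of x] out by simp
                show "Z t x \<le> \<epsilon>" using out elim t x by (intro R0) auto
              qed (use Z0 C R in auto)
              also have "\<dots> \<le> X1 * indicator (cball 0 R) x + X2 * indicator (cball 0 (1 / R)) x"
                using out X by (auto simp: X1_def indicator_def)
              finally show ?thesis .
            next
              case inn
              have "0 < 1 / (2 * R)" using R by simp
              then have x: "x \<noteq> 0" "0 < norm x" using inn by auto
              have "Z t x * L x \<le> D * (2 * R) powr (\<gamma> * m) * (C * R\<^sup>2)"
              proof (rule order_trans[OF mult_left_mono mult_right_mono])
                show "L x \<le> C * R\<^sup>2" using L[rule_format, of x] inn by (auto split: if_splits)
                have "Z t x \<le> D * norm x powr - (\<gamma> * m)"
                  using inn t x R by (intro Z_near) auto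
                also have "norm x powr - (\<gamma> * m) \<le> (1 / (2 * R)) powr - (\<gamma> * m)"
                  using inn \<gamma> m R by (intro powr_mono2') auto
                also have "(1 / (2 * R)) powr - (\<gamma> * m) = (2 * R) powr (\<gamma> * m)"
                  using R by (simp add: powr_divide powr_minus_divide powr_mult)
                finally show "Z t x \<le> D * (2 * R) powr (\<gamma> * m)"
                  using D by (simp add: mult_left_mono)
              qed (use Z0 C R in auto)
              also have "\<dots> \<le> X1 * indicator (cball 0 R) x + X2 * indicator (cball 0 (1 / R)) x"
                using inn X by (auto simp: X2_def indicator_def)
              finally show ?thesis .
            next
              case mid
              then have "L x \<le> 0" using L[rule_format, of x] by (auto split: if_splits)
              then have "Z t x * L x \<le> 0" using Z0 by (simp add: mult_nonneg_nonpos)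
              then show ?thesis using nonneg by simp
            qed
          qed
          have int: "integrable lborel (\<lambda>x :: real ^ 'n. c * indicator (cball 0 r) x)" for c r :: real
            using borel_integrable_compact[OF compact_cball continuous_on_const[of "cball (0 :: real ^ 'n) r" c]]
            by (simp add: mult.commute)
          \<comment> \<open>Integrability of the left integrand is not claimed. Should it fail, the
            Bochner integral is 0, and the nonnegative majorant still gives the inequality.\<close>
          have "(\<integral>x. Z t x * L x \<partial>lborel)
             \<le> (\<integral>x. X1 * indicator (cball (0 :: real ^ 'n) R) x + X2 * indicator (cball 0 (1 / R)) x \<partial>lborel)"
            by (rule Bochner_Integration.integral_mono'[OF Bochner_Integration.integrable_add[OF int int] ptw])
               (use X in \<open>auto simp: indicator_def\<close>)
          also have "\<dots> = X1 * measure lborel (cball (0 :: real ^ 'n) R) + X2 * measure lborel (cball (0 :: real ^ 'n) (1 / R))"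
            by (simp add: Bochner_Integration.integral_add[OF int int])
          also have "\<dots> = \<epsilon> * (C * \<omega>) + D * (2 * R) powr (\<gamma> * m) * (C * R\<^sup>2) * (\<omega> / R ^ CARD('n))"
            using R by (simp add: content_cball X1_def X2_def \<omega>_def power_divide)
          also have "D * (2 * R) powr (\<gamma> * m) * (C * R\<^sup>2) * (\<omega> / R ^ CARD('n)) = H R"
          proof -
            have "R ^ CARD('n) = R powr q * R\<^sup>2"
              using R n powr_realpow[of R "CARD('n)"] powr_add[of R q 2]
              by (simp add: q_def powr_numeral)
            then show ?thesis
              using R by (simp add: H_def powr_mult powr_diff field_simps)
          qed
          finally show "(\<integral>x. Z t x * L x \<partial>lborel) \<le> e"
            using \<epsilon>_le elim by simp
        qed
      qed
    qed
    \<comment> \<open>The annulus on which the test function for R = k + 2 equals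
      \<open>\<Psi>\<close>. The offset 2 guarantees R >= 2, and these annuli exhaust the punctured
      space.\<close>
    define A where "A k = {x :: real ^ 'n. 1 / (real k + 2) \<le> norm x \<and> norm x \<le> (real k + 2) / 2}" for k
    have A: "compact (A k)" "A k \<subseteq> punctured" for k
      unfolding A_def by (intro compact_annulus; simp)+
    define F where "F k x = ennreal (indicator (A k) x *\<^sub>R (max (u x b - v x b) 0 * \<Psi> x))" for k x
    have F_meas: "F k \<in> borel_measurable lebesgue" for k
    proof -
      have "continuous_on (A k) (\<lambda>x. max (u x b - v x b) 0 * \<Psi> x)"
        using continuous_on_subset[OF N_cont[OF h] A(2)] unfolding \<Psi>_def
        by (intro continuous_on_mult meas_K A)
      then have "(\<lambda>x. indicator (A k) x *\<^sub>R (max (u x b - v x b) 0 * \<Psi> x)) \<in> borel_measurable borel"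
        using A by (intro borel_measurable_continuous_on_indicator) (auto intro: borel_compact)
      then show ?thesis
        unfolding F_def by (auto intro!: measurable_completion)
    qed
    have F_lim: "AE x in lebesgue. (\<lambda>k. F k x) \<longlonglongrightarrow> ennreal (max (u x b - v x b) 0 * \<Psi> x)"
      using AE_lebesgue_nonzero
    proof eventually_elim
      case (elim x)
      have "eventually (\<lambda>k. x \<in> A k) sequentially"
      proof -
        define K where "K = nat \<lceil>max (1 / norm x) (2 * norm x)\<rceil>"
        have "x \<in> A k" if "K \<le> k" for k
        proof -
          have "max (1 / norm x) (2 * norm x) \<le> real K" by (simp add: K_def real_nat_ceiling_ge)
          also have "\<dots> \<le> real k" using that by simp
          finally have "1 / norm x \<le> real k + 2" "2 * norm x \<le> real k + 2" by auto
          then show ?thesis using elim by (simp add: A_def field_simps)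
        qed
        then show ?thesis by (auto simp: eventually_sequentially)
      qed
      then have "eventually (\<lambda>k. F k x = ennreal (max (u x b - v x b) 0 * \<Psi> x)) sequentially"
        by eventually_elim (simp add: F_def)
      then show ?case by (rule tendsto_eventually)
    qed
    show ?thesis
      unfolding \<Psi>_def[symmetric]
    proof (rule nn_integral_limit_le[OF F_meas F_lim])
      fix e :: real assume e: "0 < e"
      \<comment> \<open>The error bound is per unit of time and gets multiplied by \<open>b\<close>
        in \<open>test_function_estimate\<close>.\<close>
      have "0 < e / b" using e b by simp
      have "filterlim (\<lambda>k. real k + 2) at_top sequentially"
        by (intro filterlim_tendsto_add_at_top[OF tendsto_const, of _ _ 2, simplified add.commute]
            filterlim_real_sequentially)
      from eventually_compose_filterlim[OF error[OF \<open>0 < e / b\<close>] this]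
      have "eventually (\<lambda>k. \<forall>L t. 0 < t \<and> t \<le> b \<and> (\<forall>x. L x \<le>
          (if (real k + 2) / 2 \<le> norm x \<and> norm x \<le> (real k + 2) then C / (real k + 2) ^ CARD('n)
           else if 1 / (2 * (real k + 2)) \<le> norm x \<and> norm x \<le> 1 / (real k + 2) then C * (real k + 2)\<^sup>2 else 0)) \<longrightarrow>
         (\<integral>x. Z t x * L x \<partial>lborel) \<le> e / b) sequentially" .
      then show "eventually (\<lambda>k. (\<integral>\<^sup>+x. F k x \<partial>lebesgue) \<le> ?Y + ennreal e) sequentially"
      proof eventually_elim
        case (elim k)
        define R where "R = real k + 2"
        have R: "2 \<le> R" "0 < R" by (auto simp: R_def)
        obtain \<psi> \<psi>' \<psi>'' where \<psi>: "C2_data UNIV \<psi> \<psi>' \<psi>''"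
          and supp': "\<forall>x i. x \<notin> {x :: real ^ 'n. 1 / (2 * R) \<le> norm x \<and> norm x \<le> R} \<longrightarrow>
             \<psi> x = 0 \<and> \<psi>' i x = 0 \<and> \<psi>'' i x = 0"
          and \<psi>0: "\<forall>x. 0 \<le> \<psi> x" and \<psi>_le': "\<forall>x. x \<noteq> 0 \<longrightarrow> \<psi> x \<le> \<Psi> x"
          and \<psi>_eq: "\<forall>x. 1 / R \<le> norm x \<and> norm x \<le> R / 2 \<longrightarrow> \<psi> x = \<Psi> x"
          and lap: "\<forall>x. (\<Sum>i\<in>UNIV. \<psi>'' i x) \<le>
          (if R / 2 \<le> norm x \<and> norm x \<le> R then C / R ^ CARD('n)
           else if 1 / (2 * R) \<le> norm x \<and> norm x \<le> 1 / R then C * R\<^sup>2 else 0)"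
          using test[OF R(1)] by (elim exE conjE) (rule that)
        note supp = supp'[rule_format] and \<psi>_le = \<psi>_le'[rule_format]
        have "\<psi> 0 = 0" using supp[of 0] R by simp
        have \<psi>1: "\<psi> x \<le> 1" for x
          using \<psi>_le[of x] \<Psi>_le[of x] \<open>\<psi> 0 = 0\<close> by (cases "x = 0") auto
        have "(\<integral>\<^sup>+x. F k x \<partial>lebesgue) \<le> (\<integral>\<^sup>+x. ennreal (max (u x b - v x b) 0 * \<psi> x) \<partial>lebesgue)"
          by (intro nn_integral_mono) (auto simp: F_def A_def R_def[symmetric] indicator_def \<psi>_eq)
        also have "\<dots> \<le> (\<integral>\<^sup>+x. ennreal (max (u0 x - v0 x) 0 * \<psi> x) \<partial>lebesgue) + ennreal (e / b * b)"
        proof (rule test_function_estimate[OF u v m(1) \<psi> compact_annulus supp _ b])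
          show "(\<integral>x. max (u x t powr m / m - v x t powr m / m) 0 * (\<Sum>i\<in>UNIV. \<psi>'' i x) \<partial>lborel) \<le> e / b"
            if "0 < t" "t \<le> b" for t
            using elim[rule_format, of t "\<lambda>x. \<Sum>i\<in>UNIV. \<psi>'' i x"] lap that
            unfolding Z_def R_def[symmetric] by blast
        qed (use \<psi>0 \<psi>1 R e b in auto)
        also have "(\<integral>\<^sup>+x. ennreal (max (u0 x - v0 x) 0 * \<psi> x) \<partial>lebesgue) \<le> ?Y"
        proof (rule nn_integral_mono)
          fix x
          show "ennreal (max (u0 x - v0 x) 0 * \<psi> x) \<le> ennreal (max (u0 x - v0 x) 0 * \<phi> x)"
          proof (cases "x = 0")
            case False
            then show ?thesis
              using \<psi>_le[of x] \<Psi>_le[of x] by (intro ennreal_leI mult_left_mono) auto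
          qed (use \<open>\<psi> 0 = 0\<close> in simp)
        qed
        also have "e / b * b = e" using b by simp
        finally show ?case by simp
      qed
    qed
  qed

  \<comment> \<open>The second limit carries no error: the estimate \<open>shifted\<close> has the
    full right-hand side for every positive shift, because the shifted weight lies below
    \<open>\<phi>\<close>.\<close>
  define h where "h k = inverse (real (Suc k))" for k
  have h: "0 < h k" "h \<longlonglongrightarrow> 0" for k
    using LIMSEQ_inverse_Suc by (auto simp: h_def[abs_def])
  define G where "G k x = ennreal (indicator punctured x *\<^sub>R (max (u x b - v x b) 0 * (\<Phi> (norm x powr - q + h k) - \<Phi> (h k))))"
    for k and x :: "real ^ 'n"
  show ?thesis
  proof (rule nn_integral_limit_le)
    show "G k \<in> borel_measurable lebesgue" for k
    proof -
      have "continuous_on punctured (\<lambda>x. w x b)" if "is_solution m w0 w" for w w0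
      proof -
        have "C_k_on 2 punctured (\<lambda>x. w x b)"
          using that b by (auto simp: is_solution_def C21_on_def)
        then show ?thesis by (rule C2_data_continuous(1)[OF C_k_on_2_imp_C2_data])
      qed
      from this[OF u] this[OF v]
      have "continuous_on punctured (\<lambda>x. max (u x b - v x b) 0 * (\<Phi> (norm x powr - q + h k) - \<Phi> (h k)))"
        by (intro continuous_on_mult N_cont h continuous_on_max continuous_on_diff continuous_on_const)
      then have "(\<lambda>x. indicator punctured x *\<^sub>R (max (u x b - v x b) 0 * (\<Phi> (norm x powr - q + h k) - \<Phi> (h k))))
          \<in> borel_measurable borel"
        by (intro borel_measurable_continuous_on_indicator) (auto intro: borel_open simp: open_delete)
      then show ?thesis
        unfolding G_def by (auto intro!: measurable_completion)
    qed
    show "AE x in lebesgue. (\<lambda>k. G k x) \<longlonglongrightarrow> ennreal (max (u x b - v x b) 0 * \<phi> x)"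
      using AE_lebesgue_nonzero
    proof eventually_elim
      case (elim x)
      define N where "N = norm x powr - q"
      have N: "0 < N" using elim by (simp add: N_def)
      have "filterlim h (at_right 0) sequentially"
        using h by (auto intro!: filterlim_at_withinI)
      then have 1: "(\<lambda>k. \<Phi> (h k)) \<longlonglongrightarrow> 0"
        by (rule filterlim_compose[OF \<Phi>_0])
      have "(\<lambda>k. N + h k) \<longlonglongrightarrow> N + 0" by (intro tendsto_intros h)
      then have 2: "(\<lambda>k. \<Phi> (N + h k)) \<longlonglongrightarrow> \<Phi> N"
        using isCont_tendsto_compose[OF DERIV_isCont[OF \<Phi>[OF N]]] by simp
      have "(\<lambda>k. ennreal (max (u x b - v x b) 0 * (\<Phi> (N + h k) - \<Phi> (h k)))) \<longlonglongrightarrow>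
          ennreal (max (u x b - v x b) 0 * (\<Phi> N - 0))"
        by (intro tendsto_ennrealI tendsto_mult tendsto_diff tendsto_const 1 2)
      then show ?case
        using elim by (simp add: G_def N_def \<phi>_eq)
    qed
    show "eventually (\<lambda>k. (\<integral>\<^sup>+x. G k x \<partial>lebesgue) \<le> ?Y + ennreal e) sequentially" for e
    proof (intro always_eventually allI)
      fix k
      have "(\<integral>\<^sup>+x. G k x \<partial>lebesgue)
         \<le> (\<integral>\<^sup>+x. ennreal (max (u x b - v x b) 0 * (\<Phi> (norm x powr - q + h k) - \<Phi> (h k))) \<partial>lebesgue)"
        by (intro nn_integral_mono) (auto simp: G_def indicator_def)
      also have "\<dots> \<le> ?Y" by (rule shifted[OF h(1)])
      finally show "(\<integral>\<^sup>+x. G k x \<partial>lebesgue) \<le> ?Y + ennreal e"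
        by (simp add: add_increasing2)
    qed
  qed
qed

section \<open>Measurability on the punctured space and the splitting of the absolute value\<close>

lemma punctured_measurable:
  assumes u: "is_solution m u0 u"
  shows "(\<lambda>x. indicator punctured x * u0 x) \<in> borel_measurable lebesgue"
    and "0 < t \<Longrightarrow> (\<lambda>x. indicator punctured x * u x t) \<in> borel_measurable lebesgue"
proof -
  define K where "K k = {x :: real ^ 'a. 1 / real (Suc k) \<le> norm x \<and> norm x \<le> real (Suc k)}" for k
  have K: "compact (K k)" "K k \<subseteq> punctured" for k
    unfolding K_def by (intro compact_annulus; simp)+
  \<comment> \<open>Local integrability gives measurability on compact annuli only; these exhaust
    the punctured space, and the indicator removes the arbitrary value at the origin.\<close>
  have lim: "(\<lambda>k. indicator (K k) x * w x) \<longlonglongrightarrow> indicator punctured x * w x" for x and w :: "real ^ 'a \<Rightarrow> real"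
  proof (cases "x = 0")
    case False
    define k0 where "k0 = nat \<lceil>max (1 / norm x) (norm x)\<rceil>"
    have "x \<in> K k" if "k0 \<le> k" for k
    proof -
      have "max (1 / norm x) (norm x) \<le> real k0" by (simp add: k0_def real_nat_ceiling_ge)
      also have "\<dots> \<le> real (Suc k)" using that by simp
      finally have "1 / norm x \<le> real (Suc k)" "norm x \<le> real (Suc k)" by auto
      then show ?thesis using False by (simp add: K_def field_simps)
    qed
    then have "eventually (\<lambda>k. indicator (K k) x * w x = indicator punctured x * w x) sequentially"
      using False unfolding eventually_sequentially by (intro exI[of _ k0]) simp
    then show ?thesis by (rule tendsto_eventually)
  qed (simp add: K_def)
  note meas = is_solution_measurable[OF u K]
  show "(\<lambda>x. indicator punctured x * u0 x) \<in> borel_measurable lebesgue"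
    by (rule borel_measurable_LIMSEQ_real[OF lim[of _ u0] meas(1)])
  show "(\<lambda>x. indicator punctured x * u x t) \<in> borel_measurable lebesgue" if "0 < t"
    by (rule borel_measurable_LIMSEQ_real[OF lim[of _ "\<lambda>x. u x t"] meas(3)[OF that]])
qed

lemma weight_measurable:
  fixes \<phi> :: "real ^ 'n::finite \<Rightarrow> real"
  assumes "is_weight \<mu> \<phi>" "3 \<le> CARD('n)" "0 < \<mu>" "\<mu> < real CARD('n) - 2"
  shows "(\<lambda>x. indicator punctured x * \<phi> x) \<in> borel_measurable lebesgue"
proof -
  obtain \<Phi> \<Phi>' where \<phi>: "\<And>x. x \<noteq> 0 \<Longrightarrow> \<phi> x = \<Phi> (norm x powr - (real CARD('n) - 2))"
    and \<Phi>: "\<And>s. 0 < s \<Longrightarrow> (\<Phi> has_real_derivative \<Phi>' s) (at s)"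
    by (rule weight_concave_profile[OF assms]) (rule that)
  have "continuous_on {0<..} \<Phi>"
    using DERIV_isCont[OF \<Phi>] by (simp add: continuous_at_imp_continuous_on)
  moreover have "continuous_on punctured (\<lambda>x :: real ^ 'n. norm x powr - (real CARD('n) - 2))"
    by (intro continuous_intros) auto
  ultimately have "continuous_on punctured (\<lambda>x :: real ^ 'n. \<Phi> (norm x powr - (real CARD('n) - 2)))"
    by (rule continuous_on_compose2) auto
  then have "continuous_on punctured \<phi>"
    by (subst continuous_on_cong[OF refl \<phi>]) auto
  then have "(\<lambda>x. indicator punctured x *\<^sub>R \<phi> x) \<in> borel_measurable borel"
    by (intro borel_measurable_continuous_on_indicator) (auto intro: borel_open simp: open_delete)
  then show ?thesis
    by (auto intro: measurable_completion)
qed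

text \<open>At each point one of the two parts of \<open>w\<close> is 0, so the splitting survives
  \<open>ennreal\<close> whatever the sign of \<open>\<phi>\<close>. The origin is a null
  set.\<close>

lemma nn_integral_abs_split:
  fixes w \<phi> :: "real ^ 'n::finite \<Rightarrow> real"
  assumes "(\<lambda>x. indicator punctured x * w x) \<in> borel_measurable lebesgue"
    "(\<lambda>x. indicator punctured x * \<phi> x) \<in> borel_measurable lebesgue"
  shows "(\<integral>\<^sup>+x. ennreal (\<bar>w x\<bar> * \<phi> x) \<partial>lebesgue)
     = (\<integral>\<^sup>+x. ennreal (max (w x) 0 * \<phi> x) \<partial>lebesgue) + (\<integral>\<^sup>+x. ennreal (max (- w x) 0 * \<phi> x) \<partial>lebesgue)"
proof -
  define W P where "W x = indicator punctured x * w x" and "P x = indicator punctured x * \<phi> x" for x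
  have eq: "(\<integral>\<^sup>+x. ennreal (g (w x) * \<phi> x) \<partial>lebesgue) = (\<integral>\<^sup>+x. ennreal (g (W x) * P x) \<partial>lebesgue)"
    for g :: "real \<Rightarrow> real"
    using AE_lebesgue_nonzero by (intro nn_integral_cong_AE) (auto elim!: eventually_mono simp: W_def P_def)
  have [measurable]: "W \<in> borel_measurable lebesgue" "P \<in> borel_measurable lebesgue"
    using assms unfolding W_def[abs_def] P_def[abs_def] by auto
  have "(\<integral>\<^sup>+x. ennreal (\<bar>W x\<bar> * P x) \<partial>lebesgue)
      = (\<integral>\<^sup>+x. ennreal (max (W x) 0 * P x) + ennreal (max (- W x) 0 * P x) \<partial>lebesgue)"
    by (intro nn_integral_cong) (auto simp: max_def abs_if)
  also have "\<dots> = (\<integral>\<^sup>+x. ennreal (max (W x) 0 * P x) \<partial>lebesgue) + (\<integral>\<^sup>+x. ennreal (max (- W x) 0 * P x) \<partial>lebesgue)"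
    by (intro nn_integral_add) measurable
  finally show ?thesis
    using eq[of abs] eq[of "\<lambda>s. max s 0"] eq[of "\<lambda>s. max (- s) 0"] by simp
qed

theorem theorem1p4:
  fixes u v :: "real ^ 'n::finite \<Rightarrow> real \<Rightarrow> real"
    and u0 v0 f1 f2 \<phi> :: "real ^ 'n \<Rightarrow> real"
    and m \<mu> \<alpha> \<beta> \<gamma> lam1 lam2 :: real
  assumes "CARD('n) \<ge> 3"
    and "0 < m" and "m < (real CARD('n) - 2) / real CARD('n)"
    and "lam1 > lam2" and "lam2 > 0"
    and "0 < \<mu>" and "\<mu> < real CARD('n) - 2"
    and "\<beta> < 0" and "\<alpha> = (2 * \<beta> - 1) / (1 - m)"
    and "\<gamma> = \<alpha> / \<beta>"
    and "2 / (1 - m) < \<gamma>" and "\<gamma> < (real CARD('n) - 2) / m"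
    and "is_profile m \<alpha> \<beta> lam1 f1" and "is_profile m \<alpha> \<beta> lam2 f2"
    and "is_solution m u0 u" and "is_solution m v0 v"
    and "\<And>x t. x \<in> punctured \<Longrightarrow> t > 0 \<Longrightarrow>
           self_similar \<alpha> \<beta> f1 x t \<le> u x t \<and> u x t \<le> self_similar \<alpha> \<beta> f2 x t"
    and "\<And>x t. x \<in> punctured \<Longrightarrow> t > 0 \<Longrightarrow>
           self_similar \<alpha> \<beta> f1 x t \<le> v x t \<and> v x t \<le> self_similar \<alpha> \<beta> f2 x t"
    and "is_weight \<mu> \<phi>"
    and "(\<lambda>x. \<bar>u0 x - v0 x\<bar>) \<in> weighted_L1 \<phi> punctured"
  shows "(\<forall>t>0. (\<integral>\<^sup>+x. ennreal (\<bar>u x t - v x t\<bar> * \<phi> x) \<partial>lebesgue)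
                \<le> (\<integral>\<^sup>+x. ennreal (\<bar>u0 x - v0 x\<bar> * \<phi> x) \<partial>lebesgue)) \<and>
         (\<forall>t>0. (\<integral>\<^sup>+x. ennreal (max (u x t - v x t) 0 * \<phi> x) \<partial>lebesgue)
                \<le> (\<integral>\<^sup>+x. ennreal (max (u0 x - v0 x) 0 * \<phi> x) \<partial>lebesgue))"
proof -
  have m1: "m < 1"
  proof -
    have "(real CARD('n) - 2) / real CARD('n) < 1" by simp
    then show ?thesis using assms(3) by linarith
  qed
  have "0 < 2 / (1 - m)" using m1 by simp
  then have \<gamma>: "0 < \<gamma>" using assms(11) by linarith
  have \<gamma>': "\<alpha> = \<beta> * \<gamma>" "\<gamma> * m < real CARD('n) - 2"
    using assms(2,8,10,12) by (auto simp: pos_less_divide_eq)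
  have \<phi>: "(\<lambda>x. indicator punctured x * \<phi> x) \<in> borel_measurable lebesgue"
    by (rule weight_measurable[OF assms(19,1,6,7)])
  have uv: "(\<integral>\<^sup>+x. ennreal (max (u x t - v x t) 0 * \<phi> x) \<partial>lebesgue)
       \<le> (\<integral>\<^sup>+x. ennreal (max (u0 x - v0 x) 0 * \<phi> x) \<partial>lebesgue)" if "0 < t" for t
    by (rule one_sided_contraction[OF assms(1,2) m1 assms(6,7,8) \<gamma> \<gamma>' assms(14,15,16) _ assms(19) that])
       (use assms(17) in blast)
  \<comment> \<open>Exchanging the solutions bounds the negative part of u - v; added to
    \<open>uv\<close> it gives the estimate for the absolute value.\<close>
  have vu: "(\<integral>\<^sup>+x. ennreal (max (v x t - u x t) 0 * \<phi> x) \<partial>lebesgue)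
       \<le> (\<integral>\<^sup>+x. ennreal (max (v0 x - u0 x) 0 * \<phi> x) \<partial>lebesgue)" if "0 < t" for t
    by (rule one_sided_contraction[OF assms(1,2) m1 assms(6,7,8) \<gamma> \<gamma>' assms(14,16,15) _ assms(19) that])
       (use assms(18) in blast)
  have diff: "(\<lambda>x. indicator punctured x * (a x - b x)) \<in> borel_measurable lebesgue"
    if "(\<lambda>x. indicator punctured x * a x) \<in> borel_measurable lebesgue"
       "(\<lambda>x. indicator punctured x * b x) \<in> borel_measurable lebesgue" for a b :: "real ^ 'n \<Rightarrow> real"
    using borel_measurable_diff[OF that] by (simp add: right_diff_distrib)
  have "(\<integral>\<^sup>+x. ennreal (\<bar>u x t - v x t\<bar> * \<phi> x) \<partial>lebesgue)
       \<le> (\<integral>\<^sup>+x. ennreal (\<bar>u0 x - v0 x\<bar> * \<phi> x) \<partial>lebesgue)" if t: "0 < t" for t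
  proof -
    have "(\<lambda>x. indicator punctured x * (u x t - v x t)) \<in> borel_measurable lebesgue"
      by (rule diff[OF punctured_measurable(2)[OF assms(15) t] punctured_measurable(2)[OF assms(16) t]])
    moreover have "(\<lambda>x. indicator punctured x * (u0 x - v0 x)) \<in> borel_measurable lebesgue"
      by (rule diff[OF punctured_measurable(1)[OF assms(15)] punctured_measurable(1)[OF assms(16)]])
    ultimately show ?thesis
      using add_mono[OF uv[OF t] vu[OF t]] by (simp add: nn_integral_abs_split[OF _ \<phi>])
  qed
  with uv show ?thesis by blast
qed

end
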